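(* Let $\Omega\subseteq\mathbb{R}^n$ be a bounded domain with Lipschitz continuous boundary. Let $\sigma>n/2+1$, let $V\in H^{\sigma-1}(\Omega;\mathbb{R}^{n\times n})$ and $f\in H^{\sigma-1}(\Omega;\mathbb{R}^n)$. Define $F:H^{\sigma}(\Omega;\mathbb{S}^{n\times n})\to H^{\sigma-1}(\Omega;\mathbb{S}^{n\times n})$ by \[ F(M)(x):=V(x)^TM(x)+M(x)V(x)+M'(x), \] where $(M'(x))_{ij}=\nabla M_{ij}(x)\cdot f(x)$. Assume that for each $x_0\in\Omega$ with $f(x_0)=0$ all eigenvalues of $V(x_0)$ have negative real part (or, alternatively, that for each such $x_0$ all eigenvalues of $V(x_0)$ have positive real part). Let $X=\{x_1,\ldots,x_N\}\subseteq\Omega$ be a set of pairwise distinct points and let \[ \lambda_k^{(i,j)}(M):=e_i^TF(M)(x_k)e_j,\qquad 1\le k\le N,\quad 1\le i\le j\le n. \] Then each $\lambda_k^{(i,j)}$ belongs to the dual of $H^\sigma(\Omega;\mathbb{S}^{n\times n})$ and these functionals are linearly independent. If $S$ denotes the optimal recovery of $M\in H^\sigma(\Omega;\mathbb{S}^{n\times n})$ based on these functionals, then \[ \|F(M)-F(S)\|_{L_\infty(\Omega;\mathbb{S}^{n\times n})}\le C\,h_{X,\Omega}^{\sigma-1-n/2}\,\|M\|_{H^\sigma(\Omega;\mathbb{S}^{n\times n})}, \] where $C>0$ is a constant independent of $X$ and $M$.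
   Context: $\mathbb{S}^{n\times n}$ is the space of symmetric real $n\times n$ matrices and $e_i$ is the $i$-th standard unit vector of $\mathbb{R}^n$. $H^\sigma(\Omega)$ is the $L_2$-based Sobolev space of (possibly non-integer) order $\sigma$; for orders larger than $n/2$ its elements are identified with their continuous representatives. $H^\sigma(\Omega;\mathbb{R}^{n\times n})$, $H^\sigma(\Omega;\mathbb{S}^{n\times n})$ and $H^{\sigma}(\Omega;\mathbb{R}^n)$ are the spaces of functions with values in the indicated space and every component in $H^\sigma(\Omega)$, with inner product $\langle M,S\rangle=\sum_{i,j=1}^n\langle M_{ij},S_{ij}\rangle_{H^\sigma(\Omega)}$ in the matrix case (any equivalent inner product on $H^\sigma(\Omega)$ may be used). Optimal recovery: given linearly independent bounded linear functionals $\lambda_1,\dots,\lambda_L$ on a Hilbert space $H$ and $g\in H$, the optimal recovery of $g$ is the (unique) element $s^*\in H$ which minimises $\|s\|_H$ among all $s\in H$ with $\lambda_j(s)=\lambda_j(g)$, $1\le j\le L$. Here $H=H^\sigma(\Omega;\mathbb{S}^{n\times n})$. The fill distance is $h_{X,\Omega}:=\sup_{x\in\Omega}\min_{x_i\in X}\|x-x_i\|_2$, and $\|A\|_{L_\infty(\Omega;\mathbb{S}^{n\times n})}:=\max_{i,j=1,\dots,n}\|a_{ij}\|_{L_\infty(\Omega)}$ for $A=(a_{ij})$. *)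

theory Defs
  imports "HOL-Analysis.Analysis" "HOL-Probability.Essential_Supremum"
begin

section \<open>Lipschitz domains\<close>

text \<open>Near each boundary point, \<open>\<Omega>\<close> is the strict hypograph, in some direction \<open>\<nu>\<close>, of a
  Lipschitz function on the hyperplane orthogonal to \<open>\<nu>\<close>.\<close>

definition lipschitz_boundary :: "'a::euclidean_space set \<Rightarrow> bool" where
  "lipschitz_boundary \<Omega> \<longleftrightarrow>
    (\<forall>p \<in> frontier \<Omega>. \<exists>\<nu> r L \<gamma>. norm \<nu> = 1 \<and> 0 < r \<and> L-lipschitz_on {z. z \<bullet> \<nu> = 0} \<gamma> \<and>
      \<Omega> \<inter> ball p r = {y \<in> ball p r. y \<bullet> \<nu> < \<gamma> (y - (y \<bullet> \<nu>) *\<^sub>R \<nu>)})"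

definition bounded_lipschitz_domain :: "'a::euclidean_space set \<Rightarrow> bool" where
  "bounded_lipschitz_domain \<Omega> \<longleftrightarrow>
    open \<Omega> \<and> connected \<Omega> \<and> \<Omega> \<noteq> {} \<and> bounded \<Omega> \<and> lipschitz_boundary \<Omega>"

section \<open>Sobolev spaces of real order\<close>

text \<open>\<open>g\<close> is a version of the unitary Fourier(-Plancherel) transform of the \<open>L\<^sub>2\<close> function \<open>u\<close>,
  that is, the \<open>L\<^sub>2\<close> limit of the Fourier integrals of \<open>u\<close> truncated to balls. The distance is
  a nonnegative integral with values in \<^typ>\<open>ennreal\<close>, so that no integrability has to be assumed.\<close>

definition plancherel_transform :: "('a::euclidean_space \<Rightarrow> real) \<Rightarrow> ('a \<Rightarrow> complex) \<Rightarrow> bool" where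
  "plancherel_transform u g \<longleftrightarrow>
    g \<in> borel_measurable lborel \<and> integrable lborel (\<lambda>\<omega>. (cmod (g \<omega>))\<^sup>2) \<and>
    ((\<lambda>R::real. \<integral>\<^sup>+ \<omega>. ennreal ((cmod (g \<omega> -
        (2 * pi) powr (- real DIM('a) / 2) *\<^sub>R
          (LINT x:ball 0 R|lborel. complex_of_real (u x) * cis (- (x \<bullet> \<omega>)))))\<^sup>2) \<partial>lborel)
      \<longlongrightarrow> 0) at_top"

text \<open>\<open>U\<close> belongs to \<open>H\<^sup>s(\<real>\<^sup>n)\<close>, \<open>s \<ge> 0\<close>, and \<open>g\<close> is its Fourier transform.\<close>

definition sobolev_fun ::
    "real \<Rightarrow> ('a::euclidean_space \<Rightarrow> real) \<Rightarrow> ('a \<Rightarrow> complex) \<Rightarrow> bool" where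
  "sobolev_fun s U g \<longleftrightarrow>
    U \<in> borel_measurable lborel \<and> integrable lborel (\<lambda>x. (U x)\<^sup>2) \<and> plancherel_transform U g \<and>
    integrable lborel (\<lambda>\<omega>. (1 + (norm \<omega>)\<^sup>2) powr s * (cmod (g \<omega>))\<^sup>2)"

definition sobolev_extensions ::
    "real \<Rightarrow> 'a::euclidean_space set \<Rightarrow> ('a \<Rightarrow> real) \<Rightarrow> (('a \<Rightarrow> real) \<times> ('a \<Rightarrow> complex)) set" where
  "sobolev_extensions s \<Omega> u =
    {(U, g). sobolev_fun s U g \<and> (AE x in lborel. x \<in> \<Omega> \<longrightarrow> U x = u x)}"

text \<open>\<open>H\<^sup>s(\<Omega>)\<close> consists of the restrictions to \<open>\<Omega>\<close> of elements of \<open>H\<^sup>s(\<real>\<^sup>n)\<close>, with the quotient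
  norm. It is used here only for \<open>s > n/2\<close> and open \<open>\<Omega>\<close>, where every element has a unique
  continuous representative on \<open>\<Omega>\<close>; this is the representative that is meant. The values of a
  representing function outside \<open>\<Omega>\<close> are irrelevant.\<close>

definition sobolev_space :: "real \<Rightarrow> 'a::euclidean_space set \<Rightarrow> ('a \<Rightarrow> real) set" where
  "sobolev_space s \<Omega> = {u. continuous_on \<Omega> u \<and> sobolev_extensions s \<Omega> u \<noteq> {}}"

definition sobolev_norm :: "real \<Rightarrow> 'a::euclidean_space set \<Rightarrow> ('a \<Rightarrow> real) \<Rightarrow> real" where
  "sobolev_norm s \<Omega> u =
    (INF (U, g) \<in> sobolev_extensions s \<Omega> u.
      sqrt (LINT \<omega>|lborel. (1 + (norm \<omega>)\<^sup>2) powr s * (cmod (g \<omega>))\<^sup>2))"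

text \<open>Any inner product on \<open>H\<^sup>s(\<Omega>)\<close> whose norm is equivalent to the quotient norm is admitted,
  for instance the one of the Sobolev--Slobodeckij norm.\<close>

definition equivalent_inner_product ::
    "real \<Rightarrow> 'a::euclidean_space set \<Rightarrow> (('a \<Rightarrow> real) \<Rightarrow> ('a \<Rightarrow> real) \<Rightarrow> real) \<Rightarrow> bool" where
  "equivalent_inner_product s \<Omega> ip \<longleftrightarrow>
    (\<forall>u \<in> sobolev_space s \<Omega>. \<forall>v \<in> sobolev_space s \<Omega>. ip u v = ip v u) \<and>
    (\<forall>u \<in> sobolev_space s \<Omega>. \<forall>v \<in> sobolev_space s \<Omega>. \<forall>w \<in> sobolev_space s \<Omega>.
      ip (\<lambda>x. u x + v x) w = ip u w + ip v w) \<and>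
    (\<forall>c. \<forall>u \<in> sobolev_space s \<Omega>. \<forall>v \<in> sobolev_space s \<Omega>. ip (\<lambda>x. c * u x) v = c * ip u v) \<and>
    (\<exists>a > 0. \<exists>b > 0. \<forall>u \<in> sobolev_space s \<Omega>.
      a * (sobolev_norm s \<Omega> u)\<^sup>2 \<le> ip u u \<and> ip u u \<le> b * (sobolev_norm s \<Omega> u)\<^sup>2)"

definition sobolev_vec :: "real \<Rightarrow> 'a::euclidean_space set \<Rightarrow> ('a \<Rightarrow> real^'n) set" where
  "sobolev_vec s \<Omega> = {f. \<forall>i. (\<lambda>x. f x $ i) \<in> sobolev_space s \<Omega>}"

definition sobolev_mat :: "real \<Rightarrow> 'a::euclidean_space set \<Rightarrow> ('a \<Rightarrow> real^'n^'n) set" where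
  "sobolev_mat s \<Omega> = {M. \<forall>i j. (\<lambda>x. M x $ i $ j) \<in> sobolev_space s \<Omega>}"

definition sobolev_symmat :: "real \<Rightarrow> 'a::euclidean_space set \<Rightarrow> ('a \<Rightarrow> real^'n^'n) set" where
  "sobolev_symmat s \<Omega> = {M \<in> sobolev_mat s \<Omega>. \<forall>x \<in> \<Omega>. transpose (M x) = M x}"

definition mat_norm ::
    "(('a \<Rightarrow> real) \<Rightarrow> ('a \<Rightarrow> real) \<Rightarrow> real) \<Rightarrow> ('a \<Rightarrow> real^'n^'n) \<Rightarrow> real" where
  "mat_norm ip M = sqrt (\<Sum>i\<in>UNIV. \<Sum>j\<in>UNIV. ip (\<lambda>x. M x $ i $ j) (\<lambda>x. M x $ i $ j))"

definition mat_Linf_norm :: "'a::euclidean_space set \<Rightarrow> ('a \<Rightarrow> real^'n^'n) \<Rightarrow> ereal" where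
  "mat_Linf_norm \<Omega> A =
    (MAX (i, j) \<in> UNIV. esssup (restrict_space lborel \<Omega>) (\<lambda>x. ereal \<bar>A x $ i $ j\<bar>))"

section \<open>Functionals and optimal recovery\<close>

definition in_dual ::
    "('x \<Rightarrow> 'b::real_vector) set \<Rightarrow> (('x \<Rightarrow> 'b) \<Rightarrow> real) \<Rightarrow> (('x \<Rightarrow> 'b) \<Rightarrow> real) \<Rightarrow> bool" where
  "in_dual H nrm l \<longleftrightarrow>
    (\<forall>u \<in> H. \<forall>v \<in> H. l (\<lambda>x. u x + v x) = l u + l v) \<and>
    (\<forall>c. \<forall>u \<in> H. l (\<lambda>x. c *\<^sub>R u x) = c * l u) \<and>
    (\<exists>B. \<forall>u \<in> H. \<bar>l u\<bar> \<le> B * nrm u)"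

text \<open>The index set \<open>I\<close> is meant to be finite. The family \<open>l\<close> is independent as a family, so in
  particular its members are pairwise different.\<close>

definition independent_functionals :: "'h set \<Rightarrow> 'i set \<Rightarrow> ('i \<Rightarrow> 'h \<Rightarrow> real) \<Rightarrow> bool" where
  "independent_functionals H I l \<longleftrightarrow>
    (\<forall>c. (\<forall>u \<in> H. (\<Sum>p\<in>I. c p * l p u) = 0) \<longrightarrow> (\<forall>p \<in> I. c p = 0))"

definition optimal_recovery ::
    "'h set \<Rightarrow> ('h \<Rightarrow> real) \<Rightarrow> 'i set \<Rightarrow> ('i \<Rightarrow> 'h \<Rightarrow> real) \<Rightarrow> 'h \<Rightarrow> 'h \<Rightarrow> bool" where
  "optimal_recovery H nrm I l g s \<longleftrightarrow>
    s \<in> H \<and> (\<forall>p \<in> I. l p s = l p g) \<and>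
    (\<forall>t \<in> H. (\<forall>p \<in> I. l p t = l p g) \<longrightarrow> nrm s \<le> nrm t)"

definition fill_distance :: "'a::euclidean_space set \<Rightarrow> 'a set \<Rightarrow> real" where
  "fill_distance X \<Omega> = (SUP x \<in> \<Omega>. MIN y \<in> X. norm (x - y))"

section \<open>The matrix-valued differential operator\<close>

text \<open>The operator is applied to functions that are continuously differentiable on the open set
  \<open>\<Omega>\<close>, and evaluated only there.\<close>

definition gradient :: "(real^'n \<Rightarrow> real) \<Rightarrow> real^'n \<Rightarrow> real^'n" where
  "gradient u x = (\<chi> k. frechet_derivative u (at x) (axis k 1))"

definition matrix_op ::
    "(real^'n \<Rightarrow> real^'n^'n) \<Rightarrow> (real^'n \<Rightarrow> real^'n) \<Rightarrow> (real^'n \<Rightarrow> real^'n^'n) \<Rightarrow>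
      real^'n \<Rightarrow> real^'n^'n" where
  "matrix_op V f M x = transpose (V x) ** M x + M x ** V x +
    (\<chi> i j. gradient (\<lambda>y. M y $ i $ j) x \<bullet> f x)"

definition complex_eigenvalue :: "real^'n^'n \<Rightarrow> complex \<Rightarrow> bool" where
  "complex_eigenvalue A \<mu> \<longleftrightarrow>
    (\<exists>v::complex^'n. v \<noteq> 0 \<and> (\<chi> i j. complex_of_real (A $ i $ j)) *v v = \<mu> *s v)"

text \<open>A linear order on the index type \<open>'n\<close> is needed to select the entries \<open>i \<le> j\<close>.\<close>

definition upper_indices :: "nat \<Rightarrow> (nat \<times> 'n::{finite,linorder} \<times> 'n) set" where
  "upper_indices N = {(k, i, j). k \<in> {1..N} \<and> i \<le> j}"

definition entry_functional ::
    "(real^'n \<Rightarrow> real^'n^'n) \<Rightarrow> (real^'n \<Rightarrow> real^'n) \<Rightarrow> (nat \<Rightarrow> real^'n) \<Rightarrow>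
      nat \<times> 'n \<times> 'n \<Rightarrow> (real^'n \<Rightarrow> real^'n^'n) \<Rightarrow> real" where
  "entry_functional V f x = (\<lambda>(k, i, j) M. axis i 1 \<bullet> (matrix_op V f M (x k) *v axis j 1))"

end

theory Submission
  imports Defs "HOL-Probability.Characteristic_Functions"
    "HOL-Computational_Algebra.Fundamental_Theorem_Algebra"
begin

text \<open>The argument works with Fourier transforms. For an order above half the dimension the
  transform \<open>g\<close> of an element of \<open>H\<^sup>s(\<real>\<^sup>n)\<close> is integrable, because \<open>(1 + \<bar>\<omega>\<bar>\<^sup>2)\<close> to the power
  \<open>- s\<close> is. The continuous representative is then the absolutely convergent integral \<open>ift g\<close>,
  and \<open>H\<^sup>s(\<Omega>)\<close> becomes the set of restrictions of real-valued integrals \<open>ift g\<close> with \<open>g\<close> in a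
  weighted \<open>L\<^sub>2\<close> space (\<open>sobolev_space_iff\<close>). This rests on Plancherel's theorem for integrable
  and square integrable functions (\<open>plancherel\<close>) and on the resulting inversion formula for the
  Plancherel transform (\<open>plancherel_transform_inversion\<close>, \<open>plancherel_transform_ift\<close>). In this
  description differentiation multiplies \<open>g\<close> by a linear function, and a product of functions
  corresponds to a convolution, which Young's inequality controls. Hence \<open>F\<close> maps \<open>H\<^sup>\<sigma>\<close>
  boundedly into \<open>H\<close> of order \<open>\<sigma> - 1\<close> (\<open>matrix_op_bounded\<close>), and since point evaluation is
  bounded there, the functionals belong to the dual.

  Independence follows by interpolation (\<open>matrix_interpolation\<close>): for a given point \<open>x\<^sub>0\<close> and a
  symmetric \<open>E\<close> there is \<open>M\<close> such that \<open>F(M)\<close> equals \<open>E\<close> at \<open>x\<^sub>0\<close> and vanishes at the other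
  points. If \<open>f(x\<^sub>0) \<noteq> 0\<close>, a multiple of \<open>E\<close> by a scalar function that vanishes at \<open>x\<^sub>0\<close> and
  has slope 1 in the direction \<open>f(x\<^sub>0)\<close> will do. If \<open>f(x\<^sub>0) = 0\<close>, only the algebraic part of
  \<open>F\<close> remains, and the Lyapunov equation \<open>V\<^sup>T A + A V = E\<close> has to be solved; it is
  uniquely solvable because \<open>V\<close> and \<open>- V\<close> have no eigenvalue in common when the spectrum lies
  in an open half plane (\<open>sylvester_common_eigenvalue\<close>).

  For the error estimate, each entry of \<open>F(M) - F(S)\<close> vanishes on \<open>X\<close>, and its Sobolev norm
  is at most a constant times the norm of \<open>M\<close>, since the norm of \<open>S\<close> is minimal. What remains is
  a sampling inequality (\<open>sampling_inequality\<close>): a function in \<open>H\<^sup>s(\<Omega>)\<close> with zeros on \<open>X\<close> is of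
  size \<open>h\<close> to the power \<open>s - n/2\<close>, where \<open>h\<close> is the fill distance. Its proof splits the
  transform at frequency \<open>1/h\<close>. The high frequencies are of the required size everywhere by the
  Cauchy-Schwarz inequality. The low frequencies are, up to an error of the same size, a
  polynomial near a given point, and by the interior cone property there is a ball of radius
  proportional to \<open>h\<close> near that point in which \<open>X\<close> is dense enough to bound this polynomial by
  its values on \<open>X\<close>, which are small.\<close>

section \<open>Square integrable functions\<close>

lemma lborel_integral_affine:
  fixes f :: "'a::euclidean_space \<Rightarrow> 'b::{banach, second_countable_topology}"
  assumes "c \<noteq> 0" and [measurable]: "f \<in> borel_measurable borel"
  shows "(\<integral>x. f x \<partial>lborel) = \<bar>c\<bar> ^ DIM('a) *\<^sub>R (\<integral>x. f (t + c *\<^sub>R x) \<partial>lborel)"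
  by (subst lborel_affine[OF \<open>c \<noteq> 0\<close>, of t]) (simp add: integral_density integral_distr)

lemma lborel_integrable_affine_iff:
  fixes f :: "'a::euclidean_space \<Rightarrow> 'b::{banach, second_countable_topology}"
  assumes "c \<noteq> 0" and [measurable]: "f \<in> borel_measurable borel"
  shows "integrable lborel (\<lambda>x. f (t + c *\<^sub>R x)) \<longleftrightarrow> integrable lborel f"
proof -
  have "integrable lborel f \<longleftrightarrow> integrable lborel (\<lambda>x. \<bar>c\<bar> ^ DIM('a) *\<^sub>R f (t + c *\<^sub>R x))"
    by (subst lborel_affine[OF \<open>c \<noteq> 0\<close>, of t]) (simp add: integrable_density integrable_distr_eq)
  also have "\<dots> \<longleftrightarrow> integrable lborel (\<lambda>x. f (t + c *\<^sub>R x))"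
    using assms(1) integrable_scaleR_right[of "1 / \<bar>c\<bar> ^ DIM('a)" lborel "\<lambda>x. \<bar>c\<bar> ^ DIM('a) *\<^sub>R
        f (t + c *\<^sub>R x)"]
    by auto
  finally show ?thesis ..
qed

definition square_integrable :: "('a::euclidean_space \<Rightarrow> complex) \<Rightarrow> bool" where
  "square_integrable f \<longleftrightarrow>
    f \<in> borel_measurable lborel \<and> integrable lborel (\<lambda>x. (cmod (f x))\<^sup>2)"

lemma square_integrable_measurable [measurable_dest]:
  "square_integrable f \<Longrightarrow> f \<in> borel_measurable borel"
  by (simp add: square_integrable_def)

lemma cmod_mult_le_squares: "cmod (a * b) \<le> (cmod a)\<^sup>2 + (cmod b)\<^sup>2"
proof -
  have "2 * (cmod a * cmod b) \<le> (cmod a)\<^sup>2 + (cmod b)\<^sup>2"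
    using sum_squares_bound[of "cmod a" "cmod b"] by (simp add: mult.assoc)
  moreover have "0 \<le> cmod a * cmod b" by simp
  ultimately show ?thesis unfolding norm_mult by linarith
qed

lemma square_integrable_times_integrable:
  assumes f: "square_integrable f" and g: "square_integrable g"
  shows "integrable lborel (\<lambda>x. f x * g x)"
proof (rule Bochner_Integration.integrable_bound)
  show "integrable lborel (\<lambda>x. (cmod (f x))\<^sup>2 + (cmod (g x))\<^sup>2)"
    using assms by (auto simp: square_integrable_def)
  show "(\<lambda>x. f x * g x) \<in> borel_measurable lborel" using f g by measurable
qed (use cmod_mult_le_squares in auto)

lemma cmod_add_squares: "(cmod (a + b))\<^sup>2 \<le> 2 * (cmod a)\<^sup>2 + 2 * (cmod b)\<^sup>2"
proof -
  have "(cmod (a + b))\<^sup>2 \<le> (cmod a + cmod b)\<^sup>2"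
    by (intro power_mono norm_triangle_ineq) auto
  also have "\<dots> \<le> 2 * (cmod a)\<^sup>2 + 2 * (cmod b)\<^sup>2"
    using sum_squares_bound[of "cmod a" "cmod b"] by (simp add: power2_sum)
  finally show ?thesis .
qed

lemma square_integrable_add:
  assumes f: "square_integrable f" and g: "square_integrable g"
  shows "square_integrable (\<lambda>x. f x + g x)"
  unfolding square_integrable_def
proof
  show m: "(\<lambda>x. f x + g x) \<in> borel_measurable lborel" using f g by measurable
  show "integrable lborel (\<lambda>x. (cmod (f x + g x))\<^sup>2)"
  proof (rule Bochner_Integration.integrable_bound)
    show "integrable lborel (\<lambda>x. 2 * (cmod (f x))\<^sup>2 + 2 * (cmod (g x))\<^sup>2)"
      using assms by (auto simp: square_integrable_def)
    show "(\<lambda>x. (cmod (f x + g x))\<^sup>2) \<in> borel_measurable lborel" using m by measurable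
  qed (use cmod_add_squares in auto)
qed

lemma square_integrable_mult_bounded:
  assumes f: "square_integrable f" and m[measurable]: "m \<in> borel_measurable borel"
    and b: "\<And>x. cmod (m x) \<le> B"
  shows "square_integrable (\<lambda>x. m x * f x)"
  unfolding square_integrable_def
proof
  show M: "(\<lambda>x. m x * f x) \<in> borel_measurable lborel" using f by measurable
  show "integrable lborel (\<lambda>x. (cmod (m x * f x))\<^sup>2)"
  proof (rule Bochner_Integration.integrable_bound)
    show "integrable lborel (\<lambda>x. B\<^sup>2 * (cmod (f x))\<^sup>2)"
      using assms by (auto simp: square_integrable_def)
    show "(\<lambda>x. (cmod (m x * f x))\<^sup>2) \<in> borel_measurable lborel" using M by measurable
    have "(cmod (m x))\<^sup>2 \<le> B\<^sup>2" for x using b by (intro power_mono) auto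
    then show "AE x in lborel. norm ((cmod (m x * f x))\<^sup>2) \<le> norm (B\<^sup>2 * (cmod (f x))\<^sup>2)"
      by (auto simp: norm_mult power_mult_distrib intro!: AE_I2 mult_right_mono)
  qed
qed

lemma square_integrable_diff:
  assumes f: "square_integrable f" and g: "square_integrable g"
  shows "square_integrable (\<lambda>x. f x - g x)"
  using square_integrable_add[OF f square_integrable_mult_bounded[OF g, of "\<lambda>_. -1" 1]] by simp

lemma square_integrable_cnj:
  "square_integrable f \<Longrightarrow> square_integrable (\<lambda>x. cnj (f x))"
  by (auto simp: square_integrable_def
      intro!: measurable_compose[OF _ borel_measurable_continuous_onI[of cnj]] continuous_intros)

lemma square_integrable_affine:
  fixes f :: "'a::euclidean_space \<Rightarrow> complex"
  assumes f: "square_integrable f" and "c \<noteq> 0"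
  shows "square_integrable (\<lambda>x. f (t + c *\<^sub>R x))"
  unfolding square_integrable_def
proof
  note [measurable] = square_integrable_measurable[OF f]
  show "(\<lambda>x. f (t + c *\<^sub>R x)) \<in> borel_measurable lborel" by measurable
  show "integrable lborel (\<lambda>x. (cmod (f (t + c *\<^sub>R x)))\<^sup>2)"
    using f lborel_integrable_affine_iff[OF \<open>c \<noteq> 0\<close>, of "\<lambda>x. (cmod (f x))\<^sup>2" t]
    by (simp add: square_integrable_def)
qed

lemma integral_cauchy_schwarz:
  assumes f: "square_integrable f" and g: "square_integrable g"
  shows "(cmod (\<integral>x. f x * g x \<partial>lborel))\<^sup>2 \<le>
    (\<integral>x. (cmod (f x))\<^sup>2 \<partial>lborel) * (\<integral>x. (cmod (g x))\<^sup>2 \<partial>lborel)"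
proof -
  note [measurable] = square_integrable_measurable[OF f] square_integrable_measurable[OF g]
  have i: "integrable lborel (\<lambda>x. f x * g x)" by (rule square_integrable_times_integrable[OF f g])
  have "cmod (\<integral>x. f x * g x \<partial>lborel) \<le> (\<integral>x. cmod (f x * g x) \<partial>lborel)"
    by (rule integral_norm_bound)
  then have "ennreal ((cmod (\<integral>x. f x * g x \<partial>lborel))\<^sup>2)
      \<le> ennreal ((\<integral>x. cmod (f x * g x) \<partial>lborel)\<^sup>2)"
    by (intro ennreal_leI power_mono) auto
  also have "\<dots> = (\<integral>\<^sup>+x. ennreal (cmod (f x)) * ennreal (cmod (g x)) \<partial>lborel)\<^sup>2"
    using nn_integral_eq_integral[OF integrable_norm[OF i]]
    by (simp add: norm_mult ennreal_mult ennreal_power[symmetric])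
  also have "\<dots> \<le> (\<integral>\<^sup>+x. (ennreal (cmod (f x)))\<^sup>2 \<partial>lborel) * (\<integral>\<^sup>+x. (ennreal (cmod (g
      x)))\<^sup>2 \<partial>lborel)"
    by (intro Cauchy_Schwarz_nn_integral) auto
  also have "\<dots> = ennreal ((\<integral>x. (cmod (f x))\<^sup>2 \<partial>lborel) * (\<integral>x. (cmod (g x))\<^sup>2 \<partial>lborel))"
    using f g by (simp add: ennreal_power nn_integral_eq_integral square_integrable_def
        ennreal_mult)
  finally show ?thesis by (subst (asm) ennreal_le_iff) (auto intro!: mult_nonneg_nonneg)
qed

section \<open>Continuity of translations\<close>

text \<open>A Lebesgue measurable function is an almost everywhere limit of continuous functions.
  Truncating these to the bound \<open>B\<close> and multiplying them by a continuous cutoff keeps the limit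
  and makes dominated convergence applicable.\<close>

lemma approx_bounded_support:
  fixes f :: "'a::euclidean_space \<Rightarrow> complex"
  assumes [measurable]: "f \<in> borel_measurable lborel" and B: "\<And>x. cmod (f x) \<le> B"
    and R: "\<And>x. norm x > R \<Longrightarrow> f x = 0" and "\<eta> > 0"
  shows "\<exists>k. continuous_on UNIV k \<and> (\<forall>x. cmod (k x) \<le> B) \<and> (\<forall>x. norm x > R + 1 \<longrightarrow> k x = 0) \<and>
      (\<integral>x. (cmod (f x - k x))\<^sup>2 \<partial>lborel) < \<eta>"
proof -
  have B0: "0 \<le> B" using B[of 0] norm_ge_zero[of "f 0"] by linarith
  have "f \<in> borel_measurable lebesgue" by (rule measurable_completion) simp
  then have "f measurable_on UNIV"
    by (intro lebesgue_measurable_imp_measurable_on) auto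
  then obtain N g where N: "negligible N" and g: "\<And>n. continuous_on UNIV (g n)"
    and lim: "\<And>x. x \<notin> N \<Longrightarrow> (\<lambda>n. g n x) \<longlonglongrightarrow> f x"
    unfolding measurable_on_def by auto
  define chi where "chi x = max 0 (min 1 (R + 1 - norm x))" for x :: 'a
  \<comment> \<open>\<open>closest_point\<close> onto a ball is the truncation of the values to modulus at most \<open>B\<close>.\<close>
  define k where "k n x = chi x *\<^sub>R closest_point (cball 0 B) (g n x)" for n x
  have cp: "continuous_on UNIV (closest_point (cball (0::complex) B))"
    using B0 by (intro continuous_on_closest_point) auto
  have kc: "continuous_on UNIV (k n)" for n
    unfolding k_def chi_def
    by (intro continuous_intros continuous_on_compose2[OF cp] g) auto
  have chi01: "0 \<le> chi x" "chi x \<le> 1" for x by (auto simp: chi_def)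
  have cpB: "cmod (closest_point (cball 0 B) z) \<le> B" for z
    using closest_point_in_set[of "cball (0::complex) B" z] B0 by auto
  have kB: "cmod (k n x) \<le> B" for n x
    using mult_mono[OF chi01(2)[of x] cpB[of "g n x"]] chi01(1)[of x] by (simp add: k_def)
  have k0: "k n x = 0" if "norm x > R + 1" for n x
    using that by (simp add: k_def chi_def)
  have chif: "chi x *\<^sub>R f x = f x" for x
    using R[of x] by (cases "norm x > R") (auto simp: chi_def)
  have klim: "(\<lambda>n. k n x) \<longlonglongrightarrow> f x" if "x \<notin> N" for x
  proof -
    have "(\<lambda>n. closest_point (cball 0 B) (g n x)) \<longlonglongrightarrow> closest_point (cball 0 B) (f x)"
      by (rule continuous_on_tendsto_compose[OF cp lim[OF that]]) auto
    then have "(\<lambda>n. k n x) \<longlonglongrightarrow> chi x *\<^sub>R closest_point (cball 0 B) (f x)"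
      unfolding k_def by (intro tendsto_intros)
    moreover have "closest_point (cball 0 B) (f x) = f x"
      using B by (intro closest_point_self) auto
    ultimately show ?thesis using chif by simp
  qed
  have [measurable]: "k n \<in> borel_measurable borel" for n
    by (intro borel_measurable_continuous_onI kc)
  have "(\<lambda>n. \<integral>x. (cmod (f x - k n x))\<^sup>2 \<partial>lborel) \<longlonglongrightarrow> integral\<^sup>L lborel (\<lambda>x::'a. 0::real)"
  proof (rule integral_dominated_convergence)
    show "integrable lborel (\<lambda>x::'a. (2 * B)\<^sup>2 * indicator (cball 0 (R + 1)) x :: real)"
      by (intro integrable_mult_right integrable_real_indicator emeasure_bounded_finite) auto
    have "AE x in lborel. x \<notin> N"
      using N AE_not_in[of N lebesgue] by (simp add: negligible_iff_null_sets AE_completion_iff)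
    then show "AE x in lborel. (\<lambda>n. (cmod (f x - k n x))\<^sup>2) \<longlonglongrightarrow> 0"
    proof eventually_elim
      case (elim x)
      have "(\<lambda>n. (cmod (f x - k n x))\<^sup>2) \<longlonglongrightarrow> (cmod (f x - f x))\<^sup>2"
        by (intro tendsto_intros klim elim)
      then show ?case by simp
    qed
    fix n
    have "(cmod (f x - k n x))\<^sup>2 \<le> (2 * B)\<^sup>2 * indicator (cball 0 (R + 1)) x" for x
    proof (cases "norm x > R + 1")
      case True
      then show ?thesis using R[of x] k0[of x n] by simp
    next
      case False
      have "cmod (f x - k n x) \<le> 2 * B"
        using norm_triangle_ineq4[of "f x" "k n x"] B[of x] kB[of n x] by linarith
      then have "(cmod (f x - k n x))\<^sup>2 \<le> (2 * B)\<^sup>2" by (intro power_mono) auto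
      then show ?thesis using False by simp
    qed
    then show "AE x in lborel. norm ((cmod (f x - k n x))\<^sup>2) \<le> (2 * B)\<^sup>2 * indicator (cball 0 (R
        + 1)) x"
      by simp
  qed auto
  then have "eventually (\<lambda>n. (\<integral>x. (cmod (f x - k n x))\<^sup>2 \<partial>lborel) < \<eta>) sequentially"
    using \<open>\<eta> > 0\<close> by (auto dest: order_tendstoD)
  then obtain n where "(\<integral>x. (cmod (f x - k n x))\<^sup>2 \<partial>lborel) < \<eta>"
    by (auto simp: eventually_sequentially)
  then show ?thesis using kc kB k0 by (intro exI[of _ "k n"]) auto
qed

lemma square_integrable_truncate:
  fixes f :: "'a::euclidean_space \<Rightarrow> complex"
  assumes f: "square_integrable f"
  shows "(\<lambda>n. \<integral>x. (cmod (f x - (if norm x \<le> real n \<and> cmod (f x)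
      \<le> real n then f x else 0)))\<^sup>2 \<partial>lborel)
    \<longlonglongrightarrow> 0"
proof -
  note [measurable] = square_integrable_measurable[OF f]
  have "(\<lambda>n. \<integral>x. (cmod (f x - (if norm x \<le> real n \<and> cmod (f x)
      \<le> real n then f x else 0)))\<^sup>2 \<partial>lborel)
    \<longlonglongrightarrow> integral\<^sup>L lborel (\<lambda>x::'a. 0::real)"
  proof (rule integral_dominated_convergence)
    show "integrable lborel (\<lambda>x. (cmod (f x))\<^sup>2)" using f by (simp add: square_integrable_def)
    show "AE x in lborel. (\<lambda>n. (cmod (f x - (if norm x \<le> real n \<and> cmod (f x)
        \<le> real n then f x else 0)))\<^sup>2)
        \<longlonglongrightarrow> 0"
    proof (intro AE_I2 tendsto_eventually)
      fix x :: 'a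
      obtain m where m: "real m \<ge> max (norm x) (cmod (f x))" using real_arch_simple by blast
      show "\<forall>\<^sub>F n in sequentially. (cmod (f x - (if norm x \<le> real n \<and> cmod (f x)
          \<le> real n then f x else 0)))\<^sup>2 = 0"
        using eventually_ge_at_top[of m] by eventually_elim (use m in auto)
    qed
  qed auto
  then show ?thesis by simp
qed

text \<open>By the previous two lemmas \<open>f\<close> is close in \<open>L\<^sub>2\<close> to a continuous function of bounded support,
  for which the claim is dominated convergence; translations are isometries, so the
  approximation error is the same for the translate.\<close>

lemma square_integrable_translate_tendsto:
  fixes f :: "'a::euclidean_space \<Rightarrow> complex"
  assumes f: "square_integrable f" and w: "w \<longlonglongrightarrow> 0"
  shows "(\<lambda>n. \<integral>x. (cmod (f (x - w n) - f x))\<^sup>2 \<partial>lborel) \<longlonglongrightarrow> 0"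
proof (rule LIMSEQ_I)
  fix r :: real assume "r > 0"
  note fm[measurable] = square_integrable_measurable[OF f]
  define f' where "f' m x = (if norm x \<le> real m \<and> cmod (f x) \<le> real m then f x else 0)" for m x
  define \<eta> where "\<eta> = r / 40"
  have \<eta>: "\<eta> > 0" using \<open>r > 0\<close> by (simp add: \<eta>_def)
  obtain m where m: "(\<integral>x. (cmod (f x - f' m x))\<^sup>2 \<partial>lborel) < \<eta>"
    using order_tendstoD(2)[OF square_integrable_truncate[OF f] \<eta>]
    unfolding f'_def by (auto simp: eventually_sequentially)
  have f'm[measurable]: "f' m \<in> borel_measurable lborel" unfolding f'_def by measurable
  obtain k where kc: "continuous_on UNIV k" and kB: "\<And>x. cmod (k x) \<le> real m"
    and k0: "\<And>x. norm x > real m + 1 \<Longrightarrow> k x = 0" and k: "(\<integral>x. (cmod (f' m x - k x))\<^sup>2 \<partial>lborel) < \<eta>"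
  proof -
    have "cmod (f' m x) \<le> real m" "norm x > real m \<Longrightarrow> f' m x = 0" for x by (auto simp: f'_def)
    then show ?thesis using approx_bounded_support[OF f'm, of "real m" "real m" \<eta>] \<eta> that by blast
  qed
  have km[measurable]: "k \<in> borel_measurable borel"
    by (intro borel_measurable_continuous_onI kc)
  have bsq: "square_integrable h" if [measurable]: "h \<in> borel_measurable borel"
     and "\<And>x. cmod (h x) \<le> b" "\<And>x. norm x > b' \<Longrightarrow> h x = 0" for h :: "'a \<Rightarrow> complex" and b b'
    unfolding square_integrable_def
  proof
    show "integrable lborel (\<lambda>x. (cmod (h x))\<^sup>2)"
    proof (rule Bochner_Integration.integrable_bound)
      show "integrable lborel (\<lambda>x::'a. b\<^sup>2 * indicator (cball 0 b') x :: real)"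
        by (intro integrable_mult_right integrable_real_indicator emeasure_bounded_finite) auto
      have "(cmod (h x))\<^sup>2 \<le> b\<^sup>2 * indicator (cball 0 b') x" for x
        using that(3)[of x] power_mono[OF that(2)[of x], of 2] by (cases "norm x > b'") auto
      then show "AE x in lborel. norm ((cmod (h x))\<^sup>2) \<le> norm (b\<^sup>2 * indicator (cball 0 b') x)"
        by simp
    qed auto
  qed auto
  have ksq: "square_integrable k" by (rule bsq[OF km kB]) (use k0 in auto)
  have f'sq: "square_integrable (f' m)"
    by (rule bsq[of _ "real m" "real m"]) (auto simp: f'_def)
  have fk_sq: "square_integrable (\<lambda>x. f x - k x)" by (rule square_integrable_diff[OF f ksq])
  have fk: "(\<integral>x. (cmod (f x - k x))\<^sup>2 \<partial>lborel) \<le> 4 * \<eta>"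
  proof -
    have "(\<integral>x. (cmod (f x - k x))\<^sup>2 \<partial>lborel) \<le>
        (\<integral>x. 2 * (cmod (f x - f' m x))\<^sup>2 + 2 * (cmod (f' m x - k x))\<^sup>2 \<partial>lborel)"
    proof (rule integral_mono)
      show "integrable lborel (\<lambda>x. (cmod (f x - k x))\<^sup>2)"
        using fk_sq by (simp add: square_integrable_def)
      show "integrable lborel (\<lambda>x. 2 * (cmod (f x - f' m x))\<^sup>2 + 2 * (cmod (f' m x - k x))\<^sup>2)"
        using square_integrable_diff[OF f f'sq] square_integrable_diff[OF f'sq ksq]
        by (auto simp: square_integrable_def)
      fix x show "(cmod (f x - k x))\<^sup>2 \<le> 2 * (cmod (f x - f' m x))\<^sup>2 + 2 * (cmod (f' m x - k x))\<^sup>2"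
        using cmod_add_squares[of "f x - f' m x" "f' m x - k x"] by simp
    qed
    also have "\<dots> = 2 * (\<integral>x. (cmod (f x - f' m x))\<^sup>2 \<partial>lborel) + 2 * (\<integral>x. (cmod (f' m x
        - k x))\<^sup>2 \<partial>lborel)"
      using square_integrable_diff[OF f f'sq] square_integrable_diff[OF f'sq ksq]
      by (subst Bochner_Integration.integral_add) (auto simp: square_integrable_def)
    finally show ?thesis using m k by linarith
  qed
  have shift: "square_integrable (\<lambda>x. h (x - v))" if "square_integrable h" for h :: "'a \<Rightarrow> complex"
      and v
    using square_integrable_affine[OF that, of 1 "-v"] by simp
  have fk_shift: "(\<integral>x. (cmod (f (x - v) - k (x - v)))\<^sup>2 \<partial>lborel)
      = (\<integral>x. (cmod (f x - k x))\<^sup>2 \<partial>lborel)" for v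
    using lborel_integral_affine[of 1 "\<lambda>x. (cmod (f x - k x))\<^sup>2" "-v"] by simp
  have klim: "(\<lambda>n. \<integral>x. (cmod (k (x - w n) - k x))\<^sup>2 \<partial>lborel) \<longlonglongrightarrow> integral\<^sup>L lborel (\<lambda>x::'a. 0::real)"
  proof -
    obtain W where W: "\<And>n. norm (w n) \<le> W"
      using convergent_imp_Bseq[of w] w by (auto simp: convergent_def Bseq_def)
    have W0: "W \<ge> 0" using W[of 0] norm_ge_zero[of "w 0"] by linarith
    show ?thesis
    proof (rule integral_dominated_convergence)
      show "integrable lborel (\<lambda>x::'a. (2 * real m)\<^sup>2 * indicator (cball 0 (real m + 1
          + W)) x :: real)"
        by (intro integrable_mult_right integrable_real_indicator emeasure_bounded_finite) auto
      show "AE x in lborel. (\<lambda>n. (cmod (k (x - w n) - k x))\<^sup>2) \<longlonglongrightarrow> 0"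
      proof (rule AE_I2)
        fix x
        have "(\<lambda>n. k (x - w n)) \<longlonglongrightarrow> k (x - 0)"
          by (rule continuous_on_tendsto_compose[OF kc tendsto_diff[OF tendsto_const w]]) auto
        then have "(\<lambda>n. (cmod (k (x - w n) - k x))\<^sup>2) \<longlonglongrightarrow> (cmod (k (x - 0) - k x))\<^sup>2"
          by (intro tendsto_intros)
        then show "(\<lambda>n. (cmod (k (x - w n) - k x))\<^sup>2) \<longlonglongrightarrow> 0" by simp
      qed
      fix n
      have "(cmod (k (x - w n) - k x))\<^sup>2 \<le> (2 * real m)\<^sup>2 * indicator (cball 0 (real m + 1
          + W)) x" for x
      proof (cases "norm x > real m + 1 + W")
        case True
        have "norm x \<le> norm (x - w n) + norm (w n)" by (metis diff_add_cancel norm_triangle_ineq)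
        then have "norm (x - w n) > real m + 1" "norm x > real m + 1"
          using True W[of n] W0 by linarith+
        then show ?thesis using k0[of x] k0[of "x - w n"] by simp
      next
        case False
        have "cmod (k (x - w n) - k x) \<le> 2 * real m"
          using norm_triangle_ineq4[of "k (x - w n)" "k x"] kB[of x] kB[of "x - w n"] by linarith
        then have "(cmod (k (x - w n) - k x))\<^sup>2 \<le> (2 * real m)\<^sup>2" by (intro power_mono) auto
        then show ?thesis using False by simp
      qed
      then show "AE x in lborel. norm ((cmod (k (x - w n) - k x))\<^sup>2)
          \<le> (2 * real m)\<^sup>2 * indicator (cball 0 (real m + 1 + W)) x" by simp
    qed auto
  qed
  then obtain n0 where n0: "\<And>n. n \<ge> n0 \<Longrightarrow> (\<integral>x. (cmod (k (x - w n) - k x))\<^sup>2 \<partial>lborel) < \<eta>"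
    using order_tendstoD(2)[OF klim, of \<eta>] \<eta> by (auto simp: eventually_sequentially)
  have "norm ((\<integral>x. (cmod (f (x - w n) - f x))\<^sup>2 \<partial>lborel) - 0) < r" if "n \<ge> n0" for n
  proof -
    have s1: "square_integrable (\<lambda>x. f (x - w n) - k (x - w n))"
      using shift[OF fk_sq] by simp
    have s2: "square_integrable (\<lambda>x. k (x - w n) - k x)"
      by (intro square_integrable_diff shift ksq)
    have "(\<integral>x. (cmod (f (x - w n) - f x))\<^sup>2 \<partial>lborel) \<le>
        (\<integral>x. 2 * (cmod (f (x - w n) - k (x - w n)))\<^sup>2 + (4 * (cmod (k (x - w n) - k x))\<^sup>2
            + 4 * (cmod (f x - k x))\<^sup>2) \<partial>lborel)"
    proof (rule integral_mono)
      show "integrable lborel (\<lambda>x. (cmod (f (x - w n) - f x))\<^sup>2)"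
        using square_integrable_diff[OF shift[OF f] f] by (simp add: square_integrable_def)
      show "integrable lborel (\<lambda>x. 2 * (cmod (f (x - w n) - k (x - w n)))\<^sup>2 + (4 * (cmod (k (x
          - w n) - k x))\<^sup>2 + 4 * (cmod (f x - k x))\<^sup>2))"
        using s1 s2 fk_sq by (auto simp: square_integrable_def)
      fix x
      show "(cmod (f (x - w n) - f x))\<^sup>2 \<le> 2 * (cmod (f (x - w n) - k (x - w n)))\<^sup>2
          + (4 * (cmod (k (x - w n) - k x))\<^sup>2 + 4 * (cmod (f x - k x))\<^sup>2)"
        using cmod_add_squares[of "f (x - w n) - k (x - w n)" "(k (x - w n) - k x) + (k x - f x)"]
          cmod_add_squares[of "k (x - w n) - k x" "k x - f x"] by (simp add: norm_minus_commute)
    qed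
    also have "\<dots> = 2 * (\<integral>x. (cmod (f (x - w n) - k (x - w n)))\<^sup>2 \<partial>lborel) +
       (4 * (\<integral>x. (cmod (k (x - w n) - k x))\<^sup>2 \<partial>lborel) + 4 * (\<integral>x. (cmod (f x - k x))\<^sup>2 \<partial>lborel))"
      using s1 s2 fk_sq
      by (subst Bochner_Integration.integral_add, simp add: square_integrable_def, simp add:
          square_integrable_def,
          subst Bochner_Integration.integral_add) (auto simp: square_integrable_def)
    also have "\<dots> \<le> 2 * (4 * \<eta>) + (4 * \<eta> + 4 * (4 * \<eta>))"
      using fk n0[OF that] unfolding fk_shift by (intro add_mono mult_left_mono) auto
    also have "\<dots> < r" using \<open>r > 0\<close> by (simp add: \<eta>_def)
    finally show ?thesis by simp
  qed
  then show "\<exists>n0. \<forall>n\<ge>n0. norm ((\<integral>x. (cmod (f (x - w n) - f x))\<^sup>2 \<partial>lborel) - 0) < r" by blast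
qed

section \<open>Gaussians\<close>

lemma lborel_integral_prod_coordinates:
  fixes h :: "'a::euclidean_space \<Rightarrow> real \<Rightarrow> 'b::{real_normed_field, banach,
      second_countable_topology}"
  assumes "\<And>b. b \<in> Basis \<Longrightarrow> integrable lborel (h b)"
  shows "integrable lborel (\<lambda>x. \<Prod>b\<in>Basis. h b (x \<bullet> b))"
    and "(\<integral>x. (\<Prod>b\<in>Basis. h b (x \<bullet> b)) \<partial>lborel) = (\<Prod>b\<in>Basis. \<integral>t. h b t \<partial>lborel)"
proof -
  interpret product_sigma_finite "\<lambda>_::'a. lborel :: real measure" ..
  have [measurable]: "h b \<in> borel_measurable borel" if "b \<in> Basis" for b
    using borel_measurable_integrable[OF assms[OF that]] by simp
  have m: "(\<lambda>x. \<Prod>b\<in>Basis. h b (x \<bullet> b)) \<in> borel_measurable borel"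
    by measurable
  have s: "(\<lambda>f. \<Sum>b\<in>Basis. f b *\<^sub>R b) \<in> measurable (\<Pi>\<^sub>M b\<in>Basis. lborel) (borel::'a measure)"
    by measurable
  have e: "(\<Prod>b\<in>Basis. h b ((\<Sum>b\<in>Basis. f b *\<^sub>R b) \<bullet> b)) = (\<Prod>b\<in>Basis. h b (f b))" for f
    by (intro prod.cong) auto
  show "integrable lborel (\<lambda>x. \<Prod>b\<in>Basis. h b (x \<bullet> b))"
    using product_integrable_prod[of Basis h] assms
    by (subst lborel_eq) (simp add: integrable_distr_eq[OF s m] e)
  show "(\<integral>x. (\<Prod>b\<in>Basis. h b (x \<bullet> b)) \<partial>lborel) = (\<Prod>b\<in>Basis. \<integral>t. h b t \<partial>lborel)"
    using product_integral_prod[of Basis h] assms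
    by (subst lborel_eq) (simp add: integral_distr[OF s m] e)
qed

text \<open>The inverse Fourier integral in its unitary normalization. The Fourier integral itself is
  \<open>\<lambda>\<omega>. ift u (- \<omega>)\<close>, so that one transform suffices.\<close>

definition ift :: "('a::euclidean_space \<Rightarrow> complex) \<Rightarrow> 'a \<Rightarrow> complex" where
  "ift g x = (2 * pi) powr (- real DIM('a) / 2) *\<^sub>R (\<integral>\<omega>. g \<omega> * cis (x \<bullet> \<omega>) \<partial>lborel)"

definition gaussian :: "'a::euclidean_space \<Rightarrow> real" where
  "gaussian x = exp (- (norm x)\<^sup>2 / 2)"

text \<open>This is the characteristic function of the standard normal distribution.\<close>

lemma gaussian_1d:
  shows "integrable lborel (\<lambda>x. complex_of_real (exp (- x\<^sup>2 / 2)) * cis (t * x))"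
    and "(\<integral>x. complex_of_real (exp (- x\<^sup>2 / 2)) * cis (t * x) \<partial>lborel)
      = complex_of_real (sqrt (2 * pi) * exp (- t\<^sup>2 / 2))"
proof -
  have "integrable lborel (std_normal_density :: real \<Rightarrow> real)" by simp
  then have "integrable lborel (\<lambda>x. sqrt (2 * pi) * std_normal_density x)"
    by (rule integrable_mult_right)
  moreover have e: "sqrt (2 * pi) * std_normal_density x = exp (- x\<^sup>2 / 2)" for x
    by (simp add: std_normal_density_def)
  ultimately have i: "integrable lborel (\<lambda>x::real. exp (- x\<^sup>2 / 2))" by simp
  have [measurable]: "(\<lambda>x. cis (t * x)) \<in> borel_measurable borel"
    by (intro borel_measurable_continuous_onI continuous_intros)
  show "integrable lborel (\<lambda>x. complex_of_real (exp (- x\<^sup>2 / 2)) * cis (t * x))"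
    by (rule Bochner_Integration.integrable_bound[OF i]) (auto simp: norm_mult)
  have "complex_of_real (exp (- t\<^sup>2 / 2)) = (\<integral>x. cis (t * x) \<partial>std_normal_distribution)"
    using fun_cong[OF char_std_normal_distribution, of t]
    by (simp add: char_def cis_conv_exp)
  also have "\<dots> = (\<integral>x. std_normal_density x *\<^sub>R cis (t * x) \<partial>lborel)"
    by (subst integral_density) (auto simp: normal_density_nonneg)
  finally have "complex_of_real (sqrt (2 * pi)) * complex_of_real (exp (- t\<^sup>2 / 2))
      = (\<integral>x. complex_of_real (sqrt (2 * pi)) * (std_normal_density x *\<^sub>R cis (t * x)) \<partial>lborel)"
    by (simp del: mult_scaleR_right)
  also have "\<dots> = (\<integral>x. complex_of_real (exp (- x\<^sup>2 / 2)) * cis (t * x) \<partial>lborel)"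
    by (intro Bochner_Integration.integral_cong refl)
      (simp only: scaleR_conv_of_real e[symmetric] mult.assoc of_real_mult)
  finally show "(\<integral>x. complex_of_real (exp (- x\<^sup>2 / 2)) * cis (t * x) \<partial>lborel)
      = complex_of_real (sqrt (2 * pi) * exp (- t\<^sup>2 / 2))" by simp
qed

lemma norm_square_coordinates: "(norm x)\<^sup>2 = (\<Sum>b\<in>Basis. (x \<bullet> b)\<^sup>2)"
  unfolding power2_norm_eq_inner by (subst euclidean_inner) (simp add: power2_eq_square)

lemma cis_sum: "finite A \<Longrightarrow> cis (\<Sum>a\<in>A. f a) = (\<Prod>a\<in>A. cis (f a))"
  by (induction rule: finite_induct) (auto simp: cis_mult[symmetric])

lemma gaussian_prod: "gaussian x = (\<Prod>b\<in>Basis. exp (- (x \<bullet> b)\<^sup>2 / 2))"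
  unfolding gaussian_def by (subst norm_square_coordinates[of x])
    (simp add: exp_sum[symmetric] sum_negf sum_divide_distrib)

text \<open>Integrand and result are products over the coordinates, which reduces the claim to the
  one-dimensional case.\<close>

lemma gaussian_transform:
  fixes x :: "'a::euclidean_space"
  shows "integrable lborel (\<lambda>\<omega>. complex_of_real (gaussian \<omega>) * cis (x \<bullet> \<omega>))"
    and "ift (\<lambda>\<omega>. complex_of_real (gaussian \<omega>)) x = complex_of_real (gaussian x)"
proof -
  have e: "complex_of_real (gaussian \<omega>) * cis (x \<bullet> \<omega>) =
      (\<Prod>b\<in>Basis. complex_of_real (exp (- (\<omega> \<bullet> b)\<^sup>2 / 2)) * cis ((x \<bullet> b) * (\<omega> \<bullet> b)))" for \<omega>
  proof -
    have "cis (x \<bullet> \<omega>) = (\<Prod>b\<in>Basis. cis ((x \<bullet> b) * (\<omega> \<bullet> b)))"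
      by (subst euclidean_inner) (simp add: cis_sum)
    then show ?thesis by (simp add: prod.distrib gaussian_prod)
  qed
  show "integrable lborel (\<lambda>\<omega>. complex_of_real (gaussian \<omega>) * cis (x \<bullet> \<omega>))"
    unfolding e by (intro lborel_integral_prod_coordinates(1) gaussian_1d)
  have "(\<integral>\<omega>. complex_of_real (gaussian \<omega>) * cis (x \<bullet> \<omega>) \<partial>lborel) =
      (\<Prod>b\<in>Basis. complex_of_real (sqrt (2 * pi) * exp (- (x \<bullet> b)\<^sup>2 / 2)))"
    unfolding e lborel_integral_prod_coordinates(2)[OF gaussian_1d(1)] gaussian_1d(2) ..
  also have "\<dots> = complex_of_real (sqrt (2 * pi) ^ DIM('a) * gaussian x)"
    by (simp add: gaussian_prod prod.distrib)
  finally have "ift (\<lambda>\<omega>. complex_of_real (gaussian \<omega>)) x = complex_of_real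
      ((2 * pi) powr (- real DIM('a) / 2) * sqrt (2 * pi) ^ DIM('a) * gaussian x)"
    unfolding ift_def by (simp add: scaleR_conv_of_real)
  moreover have "(2 * pi) powr (- real DIM('a) / 2) * sqrt (2 * pi) ^ DIM('a) = 1"
    by (simp add: powr_half_sqrt[symmetric] powr_realpow[symmetric] powr_powr powr_add[symmetric]
        del: powr_half_sqrt)
  ultimately show "ift (\<lambda>\<omega>. complex_of_real (gaussian \<omega>)) x = complex_of_real (gaussian x)"
    by (simp only: mult_1)
qed

lemma gaussian_integrable: "integrable lborel (gaussian :: 'a::euclidean_space \<Rightarrow> real)"
proof -
  have "integrable lborel (\<lambda>x::'a. cmod (complex_of_real (gaussian x) * cis (0 \<bullet> x)))"
    by (intro integrable_norm gaussian_transform)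
  then show ?thesis by (simp add: gaussian_def[abs_def] norm_mult)
qed

lemma gaussian_measurable [measurable]: "gaussian \<in> borel_measurable borel"
  unfolding gaussian_def by measurable

lemma gaussian_bounds: "0 < gaussian x" "gaussian x \<le> 1"
  by (auto simp: gaussian_def)

lemma gaussian_abs [simp]: "\<bar>gaussian x\<bar> = gaussian x"
  by (simp add: gaussian_def)

section \<open>The Fourier integral of integrable functions\<close>

lemma cis_measurable [measurable]: "cis \<in> borel_measurable borel"
  by (intro borel_measurable_continuous_onI continuous_intros)

lemma cnj_measurable [measurable]: "cnj \<in> borel_measurable borel"
  by (intro borel_measurable_continuous_onI continuous_intros)

lemma integrable_mult_cis:
  fixes g :: "'a::euclidean_space \<Rightarrow> complex"
  assumes "integrable lborel g" and [measurable]: "h \<in> borel_measurable borel"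
  shows "integrable lborel (\<lambda>\<omega>. g \<omega> * cis (h \<omega>))"
proof (rule Bochner_Integration.integrable_bound[OF assms(1)])
  have [measurable]: "g \<in> borel_measurable borel" using assms(1) by auto
  show "(\<lambda>\<omega>. g \<omega> * cis (h \<omega>)) \<in> borel_measurable lborel" by measurable
qed (auto simp: norm_mult)

lemma ift_bound:
  fixes g :: "'a::euclidean_space \<Rightarrow> complex"
  shows "cmod (ift g x) \<le> (2 * pi) powr (- real DIM('a) / 2) * (\<integral>\<omega>. cmod (g \<omega>) \<partial>lborel)"
  using integral_norm_bound[of lborel "\<lambda>\<omega>. g \<omega> * cis (x \<bullet> \<omega>)"]
  by (auto simp: ift_def norm_mult intro!: mult_left_mono)

lemma ift_continuous:
  fixes g :: "'a::euclidean_space \<Rightarrow> complex"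
  assumes g: "integrable lborel g"
  shows "continuous_on UNIV (ift g)"
proof -
  have [measurable]: "g \<in> borel_measurable borel" using g by auto
  have "(\<lambda>n. \<integral>\<omega>. g \<omega> * cis (u n \<bullet> \<omega>) \<partial>lborel) \<longlonglongrightarrow> (\<integral>\<omega>. g \<omega> * cis (x \<bullet> \<omega>) \<partial>lborel)"
    if u: "u \<longlonglongrightarrow> x" for u x
  proof (rule integral_dominated_convergence)
    show "integrable lborel (\<lambda>\<omega>. cmod (g \<omega>))" using g by auto
    show "AE \<omega> in lborel. (\<lambda>n. g \<omega> * cis (u n \<bullet> \<omega>)) \<longlonglongrightarrow> g \<omega> * cis (x \<bullet> \<omega>)"
      by (intro AE_I2 tendsto_intros u)
  qed (auto simp: norm_mult)
  then have "isCont (ift g) x" for x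
    unfolding continuous_at_sequentially o_def ift_def
    by (intro allI impI tendsto_scaleR tendsto_const)
  then show ?thesis by (simp add: continuous_on_eq_continuous_at)
qed

lemma ift_measurable: "integrable lborel g \<Longrightarrow> ift g \<in> borel_measurable borel"
  by (intro borel_measurable_continuous_onI ift_continuous)

text \<open>The integrability needed to apply Fubini's theorem to Fourier integrals, where \<open>m\<close> is the
  oscillating factor.\<close>

lemma pair_integrable_mult:
  fixes a b :: "'a::euclidean_space \<Rightarrow> complex"
  assumes a: "integrable lborel a" and b: "integrable lborel b"
    and m[measurable]: "case_prod m \<in> borel_measurable (borel \<Otimes>\<^sub>M borel)"
    and m1: "\<And>x y. cmod (m x y) \<le> 1"
  shows "integrable (lborel \<Otimes>\<^sub>M lborel) (\<lambda>(x, y). a x * b y * m x y)"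
proof -
  have [measurable]: "a \<in> borel_measurable borel" "b \<in> borel_measurable borel"
    using a b by auto
  have "integrable (lborel \<Otimes>\<^sub>M lborel) (\<lambda>(x, y). a x * b y)"
  proof (rule lborel_pair.Fubini_integrable)
    show "integrable lborel (\<lambda>x. \<integral>y. cmod (case (x, y) of (x, y) \<Rightarrow> a x * b y) \<partial>lborel)"
      using a by (simp add: norm_mult)
    show "AE x in lborel. integrable lborel (\<lambda>y. case (x, y) of (x, y) \<Rightarrow> a x * b y)"
      using b by simp
  qed measurable
  then show ?thesis
  proof (rule Bochner_Integration.integrable_bound)
    have "cmod (a x * b y * m x y) \<le> cmod (a x * b y) * 1" for x y
      unfolding norm_mult[of "a x * b y"] using m1 by (intro mult_left_mono) auto
    then show "AE z in lborel \<Otimes>\<^sub>M lborel.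
        cmod (case z of (x, y) \<Rightarrow> a x * b y * m x y) \<le> cmod (case z of (x, y) \<Rightarrow> a x * b y)"
      by (auto simp: split_beta)
  qed measurable
qed

text \<open>Both sides equal one double integral with a symmetric kernel.\<close>

lemma ift_multiplication:
  fixes a b :: "'a::euclidean_space \<Rightarrow> complex"
  assumes a: "integrable lborel a" and b: "integrable lborel b"
  shows "(\<integral>x. ift a x * b x \<partial>lborel) = (\<integral>x. a x * ift b x \<partial>lborel)"
proof -
  define c where "c = (2 * pi) powr (- real DIM('a) / 2)"
  have "(\<integral>x. ift a x * b x \<partial>lborel) = c *\<^sub>R (\<integral>x. (\<integral>\<omega>. a \<omega> * b x * cis (\<omega> \<bullet> x) \<partial>lborel) \<partial>lborel)"
  proof -
    have "ift a x * b x = c *\<^sub>R (\<integral>\<omega>. a \<omega> * b x * cis (\<omega> \<bullet> x) \<partial>lborel)" for x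
    proof -
      have "ift a x * b x = c *\<^sub>R ((\<integral>\<omega>. a \<omega> * cis (x \<bullet> \<omega>) \<partial>lborel) * b x)"
        by (simp add: ift_def c_def)
      also have "(\<integral>\<omega>. a \<omega> * cis (x \<bullet> \<omega>) \<partial>lborel) * b x = (\<integral>\<omega>. a \<omega> * cis (x \<bullet> \<omega>) * b x \<partial>lborel)"
        by (rule integral_mult_left_zero[symmetric])
      finally show ?thesis by (simp add: mult_ac inner_commute)
    qed
    then show ?thesis by simp
  qed
  also have "(\<integral>x. (\<integral>\<omega>. a \<omega> * b x * cis (\<omega> \<bullet> x) \<partial>lborel) \<partial>lborel) =
      (\<integral>\<omega>. (\<integral>x. a \<omega> * b x * cis (\<omega> \<bullet> x) \<partial>lborel) \<partial>lborel)"
    by (intro lborel_pair.Fubini_integral pair_integrable_mult a b) (auto simp: split_beta)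
  also have "c *\<^sub>R \<dots> = (\<integral>x. a x * ift b x \<partial>lborel)"
    unfolding ift_def c_def by (simp add: mult.assoc)
  finally show ?thesis .
qed

lemma ift_cnj: "cnj (ift g x) = ift (\<lambda>\<omega>. cnj (g \<omega>)) (- x)"
proof -
  have "cnj (\<integral>\<omega>. g \<omega> * cis (x \<bullet> \<omega>) \<partial>lborel) = (\<integral>\<omega>. cnj (g \<omega>) * cis (- x \<bullet> \<omega>) \<partial>lborel)"
    by (subst Bochner_Integration.integral_cnj[symmetric]) (simp add: cis_cnj)
  then show ?thesis by (simp add: ift_def)
qed

lemma ift_reflect:
  fixes g :: "'a::euclidean_space \<Rightarrow> complex"
  assumes [measurable]: "g \<in> borel_measurable borel"
  shows "ift (\<lambda>\<omega>. g (- \<omega>)) x = ift g (- x)"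
  using lborel_integral_affine[of "-1" "\<lambda>\<omega>. g \<omega> * cis (- x \<bullet> \<omega>)" 0] by (simp add: ift_def)

lemma ift_add:
  assumes "integrable lborel f" "integrable lborel g"
  shows "ift (\<lambda>\<omega>. f \<omega> + g \<omega>) x = ift f x + ift g x"
  using integrable_mult_cis[OF assms(1), of "\<lambda>\<omega>. x \<bullet> \<omega>"] integrable_mult_cis[OF assms(2), of
      "\<lambda>\<omega>. x \<bullet> \<omega>"]
  by (simp add: ift_def distrib_right scaleR_add_right)

lemma ift_mult_left: "ift (\<lambda>\<omega>. c * g \<omega>) x = c * ift g x"
  by (simp add: ift_def mult.assoc)

lemma ift_diff:
  assumes "integrable lborel f" "integrable lborel g"
  shows "ift (\<lambda>\<omega>. f \<omega> - g \<omega>) x = ift f x - ift g x"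
  using ift_add[OF assms(1), of "\<lambda>\<omega>. - 1 * g \<omega>" x] assms(2) ift_mult_left[of "-1" g x] by simp

section \<open>Plancherel's theorem\<close>

lemma ift_scaled_gaussian:
  fixes z :: "'a::euclidean_space"
  assumes "\<epsilon> > 0"
  shows "ift (\<lambda>\<omega>. complex_of_real (gaussian (\<epsilon> *\<^sub>R \<omega>))) z
    = complex_of_real (gaussian (z /\<^sub>R \<epsilon>) / \<epsilon> ^ DIM('a))"
proof -
  have "(\<integral>\<omega>. complex_of_real (gaussian \<omega>) * cis ((z /\<^sub>R \<epsilon>) \<bullet> \<omega>) \<partial>lborel) =
     \<epsilon> ^ DIM('a) *\<^sub>R (\<integral>\<omega>. complex_of_real (gaussian (\<epsilon> *\<^sub>R \<omega>)) * cis (z \<bullet> \<omega>) \<partial>lborel)"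
    using assms by (subst lborel_integral_affine[of \<epsilon> _ 0]) (auto simp flip: mult.assoc)
  then have "ift (\<lambda>\<omega>. complex_of_real (gaussian \<omega>)) (z /\<^sub>R \<epsilon>) =
      \<epsilon> ^ DIM('a) *\<^sub>R ift (\<lambda>\<omega>. complex_of_real (gaussian (\<epsilon> *\<^sub>R \<omega>))) z"
    by (simp add: ift_def)
  then show ?thesis
    using assms by (simp add: gaussian_transform scaleR_conv_of_real field_simps)
qed

text \<open>The Gaussian factor makes the double integral absolutely convergent, so that the order of
  integration can be exchanged; the transform of the scaled Gaussian then acts as an approximate
  identity.\<close>

lemma ift_regularized_energy:
  fixes f :: "'a::euclidean_space \<Rightarrow> complex"
  assumes f: "integrable lborel f" and "\<epsilon> > 0"
  shows "ift (\<lambda>\<omega>. cnj (ift f \<omega>) * complex_of_real (gaussian (\<epsilon> *\<^sub>R \<omega>))) x =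
    (2 * pi) powr (- real DIM('a) / 2) *\<^sub>R (\<integral>z. complex_of_real (gaussian z) * cnj (f (x
        - \<epsilon> *\<^sub>R z)) \<partial>lborel)"
proof -
  define c where "c = (2 * pi) powr (- real DIM('a) / 2)"
  define K where "K \<omega> = complex_of_real (gaussian (\<epsilon> *\<^sub>R \<omega>))" for \<omega> :: 'a
  have K: "integrable lborel K"
    unfolding K_def
    using lborel_integrable_affine_iff[of \<epsilon> "gaussian :: 'a \<Rightarrow> real" 0] \<open>\<epsilon> > 0\<close> gaussian_integrable
    by (intro integrable_of_real) simp
  have cf: "integrable lborel (\<lambda>y. cnj (f y))" using f by simp
  have fm[measurable]: "f \<in> borel_measurable borel" using f by auto
  have "ift (\<lambda>\<omega>. cnj (ift f \<omega>) * K \<omega>) x = c *\<^sub>R (\<integral>\<omega>. (c *\<^sub>R (\<integral>y. K \<omega> * cnj (f y) * cis ((x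
      - y) \<bullet> \<omega>) \<partial>lborel)) \<partial>lborel)"
  proof -
    have "cnj (ift f \<omega>) * K \<omega> * cis (x \<bullet> \<omega>) = c *\<^sub>R (\<integral>y. K \<omega> * cnj (f y) * cis ((x
        - y) \<bullet> \<omega>) \<partial>lborel)" for \<omega>
    proof -
      have "cnj (ift f \<omega>) * K \<omega> * cis (x \<bullet> \<omega>) =
          c *\<^sub>R ((\<integral>y. cnj (f y) * cis (- \<omega> \<bullet> y) \<partial>lborel) * (K \<omega> * cis (x \<bullet> \<omega>)))"
        unfolding ift_cnj by (simp add: ift_def c_def mult.assoc)
      also have "(\<integral>y. cnj (f y) * cis (- \<omega> \<bullet> y) \<partial>lborel) * (K \<omega> * cis (x \<bullet> \<omega>)) =
          (\<integral>y. cnj (f y) * cis (- \<omega> \<bullet> y) * (K \<omega> * cis (x \<bullet> \<omega>)) \<partial>lborel)"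
        by (rule integral_mult_left_zero[symmetric])
      also have "\<dots> = (\<integral>y. K \<omega> * cnj (f y) * cis ((x - y) \<bullet> \<omega>) \<partial>lborel)"
      proof (intro Bochner_Integration.integral_cong refl)
        fix y
        have "cis ((x - y) \<bullet> \<omega>) = cis (- \<omega> \<bullet> y) * cis (x \<bullet> \<omega>)"
          by (simp add: cis_mult inner_diff_right inner_commute)
        then show "cnj (f y) * cis (- \<omega> \<bullet> y) * (K \<omega> * cis (x \<bullet> \<omega>)) = K \<omega> * cnj (f y) * cis ((x
            - y) \<bullet> \<omega>)"
          by simp
      qed
      finally show ?thesis .
    qed
    then show ?thesis by (simp add: ift_def c_def)
  qed
  also have "\<dots> = c *\<^sub>R c *\<^sub>R (\<integral>\<omega>. (\<integral>y. K \<omega> * cnj (f y) * cis ((x - y) \<bullet> \<omega>) \<partial>lborel) \<partial>lborel)"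
    by simp
  also have "(\<integral>\<omega>. (\<integral>y. K \<omega> * cnj (f y) * cis ((x - y) \<bullet> \<omega>) \<partial>lborel) \<partial>lborel) =
     (\<integral>y. (\<integral>\<omega>. K \<omega> * cnj (f y) * cis ((x - y) \<bullet> \<omega>) \<partial>lborel) \<partial>lborel)"
    by (rule lborel_pair.Fubini_integral[symmetric], rule pair_integrable_mult[OF K cf]) auto
  also have "c *\<^sub>R \<dots> = (\<integral>y. cnj (f y) * ift K (x - y) \<partial>lborel)"
  proof -
    have "c *\<^sub>R (\<integral>\<omega>. K \<omega> * cnj (f y) * cis ((x - y) \<bullet> \<omega>) \<partial>lborel) = cnj (f y) * ift K (x - y)" for y
    proof -
      have "(\<integral>\<omega>. K \<omega> * cnj (f y) * cis ((x - y) \<bullet> \<omega>) \<partial>lborel) =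
          (\<integral>\<omega>. cnj (f y) * (K \<omega> * cis ((x - y) \<bullet> \<omega>)) \<partial>lborel)"
        by (intro Bochner_Integration.integral_cong refl) simp
      then show ?thesis by (simp add: ift_def c_def)
    qed
    then show ?thesis by (simp flip: integral_scaleR_right)
  qed
  also have "\<dots> = (\<integral>y. cnj (f y) * complex_of_real (gaussian ((x - y) /\<^sub>R \<epsilon>) / \<epsilon> ^ DIM('a)) \<partial>lborel)"
    unfolding K_def ift_scaled_gaussian[OF \<open>\<epsilon> > 0\<close>] ..
  also have "\<dots> = \<epsilon> ^ DIM('a) *\<^sub>R (\<integral>z. cnj (f (x - \<epsilon> *\<^sub>R z)) * complex_of_real (gaussian z / \<epsilon> ^
      DIM('a)) \<partial>lborel)"
    using \<open>\<epsilon> > 0\<close> by (subst lborel_integral_affine[of "-\<epsilon>" _ x]) auto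
  also have "\<dots> = (\<integral>z. complex_of_real (gaussian z) * cnj (f (x - \<epsilon> *\<^sub>R z)) \<partial>lborel)"
    using \<open>\<epsilon> > 0\<close> by (subst integral_scaleR_right[symmetric])
      (simp add: scaleR_conv_of_real mult_ac)
  finally show ?thesis by (simp add: K_def c_def)
qed

text \<open>The energy of \<open>ift f\<close>, regularized by a Gaussian of width \<open>1/\<epsilon>\<close>, is a Gaussian mean of the
  autocorrelation of \<open>f\<close> over shifts of size \<open>\<epsilon>\<close>. As \<open>\<epsilon>\<close> tends to 0, the left side increases to
  the energy of \<open>ift f\<close>, and the right side tends to the autocorrelation at 0, which is the
  energy of \<open>f\<close>, by continuity of translations in \<open>L\<^sub>2\<close>.\<close>

lemma plancherel:
  fixes f :: "'a::euclidean_space \<Rightarrow> complex"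
  assumes f: "integrable lborel f" and f2: "square_integrable f"
  shows "square_integrable (ift f)"
    and "(\<integral>x. (cmod (ift f x))\<^sup>2 \<partial>lborel) = (\<integral>x. (cmod (f x))\<^sup>2 \<partial>lborel)"
proof -
  define c where "c = (2 * pi) powr (- real DIM('a) / 2)"
  define E where "E = (\<integral>x. (cmod (f x))\<^sup>2 \<partial>lborel)"
  define \<epsilon> where "\<epsilon> n = 1 / real (Suc n)" for n
  have \<epsilon>: "\<epsilon> n > 0" for n by (simp add: \<epsilon>_def)
  have fm[measurable]: "f \<in> borel_measurable borel" using f by auto
  note ift_measurable[OF f, measurable]
  \<comment> \<open>The autocorrelation of \<open>f\<close>; its value at 0 is the energy of \<open>f\<close>.\<close>
  define A where "A w = (\<integral>x. f x * cnj (f (x - w)) \<partial>lborel)" for w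
  have shift: "square_integrable (\<lambda>x. f (x - w))" for w
    using square_integrable_affine[OF f2, of 1 "-w"] by simp
  have shiftE: "(\<integral>x. (cmod (f (x - w)))\<^sup>2 \<partial>lborel) = E" for w
    using lborel_integral_affine[of 1 "\<lambda>x. (cmod (f x))\<^sup>2" "-w"] by (simp add: E_def)
  have E0: "E \<ge> 0" by (simp add: E_def)
  have A_bound: "cmod (A w) \<le> E" for w
  proof -
    have "(cmod (A w))\<^sup>2 \<le> E * E"
      using integral_cauchy_schwarz[OF f2 square_integrable_cnj[OF shift[of w]]]
      by (simp add: A_def shiftE) (simp add: E_def)
    then show ?thesis using E0 by (simp add: power2_eq_square abs_le_square_iff[symmetric] flip:
        power2_eq_square)
  qed
  have A0: "A 0 = complex_of_real E"
    unfolding A_def E_def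
    by (simp add: complex_norm_square[symmetric] del: of_real_power flip: integral_complex_of_real)
  have A_lim: "(\<lambda>n. A (w n)) \<longlonglongrightarrow> A 0" if w: "w \<longlonglongrightarrow> 0" for w
  proof -
    have "(cmod (A v - A 0))\<^sup>2 \<le> E * (\<integral>x. (cmod (f (x - v) - f x))\<^sup>2 \<partial>lborel)" for v
    proof -
      have i: "integrable lborel (\<lambda>x. f x * cnj (f (x - v)))" for v
        by (intro square_integrable_times_integrable f2 square_integrable_cnj shift)
      have "A v - A 0 = (\<integral>x. f x * cnj (f (x - v) - f x) \<partial>lborel)"
        unfolding A_def using i[of v] i[of 0]
        by (subst Bochner_Integration.integral_diff[symmetric]) (auto simp: algebra_simps)
      moreover have "(cmod (\<integral>x. f x * cnj (f (x - v) - f x) \<partial>lborel))\<^sup>2 \<le>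
          E * (\<integral>x. (cmod (cnj (f (x - v) - f x)))\<^sup>2 \<partial>lborel)"
        unfolding E_def
        by (intro integral_cauchy_schwarz f2 square_integrable_cnj square_integrable_diff shift)
      ultimately show ?thesis by (simp only: complex_mod_cnj)
    qed
    then have le: "\<forall>\<^sub>F n in sequentially. norm ((cmod (A (w n) - A 0))\<^sup>2)
        \<le> E * (\<integral>x. (cmod (f (x - w n) - f x))\<^sup>2 \<partial>lborel)"
      by simp
    have lim: "(\<lambda>n. E * (\<integral>x. (cmod (f (x - w n) - f x))\<^sup>2 \<partial>lborel)) \<longlonglongrightarrow> 0"
      using square_integrable_translate_tendsto[OF f2 w] by (rule tendsto_mult_right_zero)
    have "(\<lambda>n. (cmod (A (w n) - A 0))\<^sup>2) \<longlonglongrightarrow> 0"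
      by (rule Lim_null_comparison[OF le lim])
    then have "(\<lambda>n. cmod (A (w n) - A 0)) \<longlonglongrightarrow> 0"
      using tendsto_real_sqrt[of "\<lambda>n. (cmod (A (w n) - A 0))\<^sup>2" 0 sequentially] by simp
    then show ?thesis by (simp add: tendsto_norm_zero_iff LIM_zero_iff)
  qed
  have Am[measurable]: "A \<in> borel_measurable borel"
    unfolding A_def by measurable
  \<comment> \<open>The Gaussian mean of the autocorrelation, which tends to its value at 0.\<close>
  define I where "I n = c *\<^sub>R (\<integral>z. complex_of_real (gaussian z) * A (\<epsilon> n *\<^sub>R z) \<partial>lborel)" for n
  have lim0: "(\<lambda>n. \<integral>z. complex_of_real (gaussian z) * A (\<epsilon> n *\<^sub>R z) \<partial>lborel) \<longlonglongrightarrow>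
      (\<integral>z. complex_of_real (gaussian (z::'a)) * A 0 \<partial>lborel)"
  proof (rule integral_dominated_convergence)
    show "integrable lborel (\<lambda>z::'a. gaussian z * E)"
      by (intro integrable_mult_left gaussian_integrable)
    have "\<epsilon> \<longlonglongrightarrow> 0" unfolding \<epsilon>_def by (rule LIMSEQ_Suc[OF lim_1_over_n])
    then have "(\<lambda>n. \<epsilon> n *\<^sub>R z) \<longlonglongrightarrow> 0" for z :: 'a
      using tendsto_scaleR[of \<epsilon> 0 sequentially "\<lambda>_. z" z] by simp
    then show "AE z in lborel. (\<lambda>n. complex_of_real (gaussian z) * A (\<epsilon> n *\<^sub>R z))
        \<longlonglongrightarrow> complex_of_real (gaussian z) * A 0"
      by (intro AE_I2 tendsto_mult tendsto_const A_lim)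
    show "AE z in lborel. cmod (complex_of_real (gaussian z) * A (\<epsilon> n *\<^sub>R z)) \<le> gaussian z * E"
        for n
      using A_bound gaussian_bounds(1)[THEN less_imp_le]
      by (auto simp: norm_mult intro!: AE_I2 mult_mono)
  qed auto
  have lim0_eq: "c *\<^sub>R (\<integral>z. complex_of_real (gaussian (z::'a)) * A 0 \<partial>lborel) = complex_of_real E"
  proof -
    have "c *\<^sub>R (\<integral>z. complex_of_real (gaussian (z::'a)) \<partial>lborel) = 1"
      using gaussian_transform(2)[of "0::'a"] unfolding ift_def c_def by (simp add: gaussian_def)
    moreover have "c *\<^sub>R (\<integral>z. complex_of_real (gaussian (z::'a)) * A 0 \<partial>lborel) =
        (c *\<^sub>R (\<integral>z. complex_of_real (gaussian (z::'a)) \<partial>lborel)) * A 0"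
      by (subst integral_mult_left_zero) simp
    ultimately show ?thesis by (simp only: A0 mult_1)
  qed
  have I_lim: "I \<longlonglongrightarrow> complex_of_real E"
    using tendsto_scaleR[OF tendsto_const lim0, of c] unfolding I_def[abs_def] lim0_eq .
  \<comment> \<open>The regularized energy density of the transform, increasing in \<open>n\<close>.\<close>
  define J where "J n \<omega> = (cmod (ift f \<omega>))\<^sup>2 * gaussian (\<epsilon> n *\<^sub>R \<omega>)" for n \<omega>
  have K: "integrable lborel (\<lambda>\<omega>::'a. gaussian (\<epsilon> n *\<^sub>R \<omega>))" for n
    using lborel_integrable_affine_iff[of "\<epsilon> n" "gaussian :: 'a \<Rightarrow> real" 0] \<epsilon>[of n]
        gaussian_integrable by simp
  define B where "B = c * (\<integral>\<omega>. cmod (f \<omega>) \<partial>lborel)"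
  have B: "cmod (ift f x) \<le> B" for x unfolding B_def c_def by (rule ift_bound)
  have B0: "0 \<le> B" using B[of 0] norm_ge_zero[of "ift f 0"] by linarith
  have b: "integrable lborel (\<lambda>\<omega>. cnj (ift f \<omega>) * complex_of_real (gaussian (\<epsilon> n *\<^sub>R \<omega>)))" for n
  proof (rule Bochner_Integration.integrable_bound)
    show "integrable lborel (\<lambda>\<omega>::'a. B * gaussian (\<epsilon> n *\<^sub>R \<omega>))" using K by simp
    show "AE x in lborel. cmod (cnj (ift f x) * complex_of_real (gaussian (\<epsilon> n *\<^sub>R x)))
       \<le> norm (B * gaussian (\<epsilon> n *\<^sub>R x))"
      using B B0 gaussian_bounds(1)[THEN less_imp_le]
      by (auto simp: norm_mult abs_mult intro!: AE_I2 mult_right_mono)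
  qed auto
  have J_int: "integrable lborel (J n)" for n
  proof (rule Bochner_Integration.integrable_bound)
    show "integrable lborel (\<lambda>\<omega>::'a. B\<^sup>2 * gaussian (\<epsilon> n *\<^sub>R \<omega>))" using K by simp
    show "AE x in lborel. norm (J n x) \<le> norm (B\<^sup>2 * gaussian (\<epsilon> n *\<^sub>R x))"
      using B gaussian_bounds(1)[THEN less_imp_le]
      by (auto simp: J_def abs_mult intro!: AE_I2 mult_mono power_mono)
  qed (auto simp: J_def[abs_def])
  have J_eq: "complex_of_real (\<integral>\<omega>. J n \<omega> \<partial>lborel) = I n" for n
  proof -
    have "complex_of_real (\<integral>\<omega>. J n \<omega> \<partial>lborel) =
        (\<integral>\<omega>. ift f \<omega> * (cnj (ift f \<omega>) * complex_of_real (gaussian (\<epsilon> n *\<^sub>R \<omega>))) \<partial>lborel)"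
      unfolding J_def integral_complex_of_real[symmetric] of_real_mult complex_norm_square
          mult.assoc ..
    also have "\<dots> = (\<integral>x. f x * (c *\<^sub>R (\<integral>z. complex_of_real (gaussian z) * cnj (f (x
        - \<epsilon> n *\<^sub>R z)) \<partial>lborel)) \<partial>lborel)"
      unfolding ift_multiplication[OF f b] ift_regularized_energy[OF f \<epsilon>] c_def ..
    also have "\<dots> = (\<integral>x. c *\<^sub>R (\<integral>z. f x * (complex_of_real (gaussian z) * cnj (f (x
        - \<epsilon> n *\<^sub>R z))) \<partial>lborel) \<partial>lborel)"
      by simp
    also have "\<dots> = c *\<^sub>R (\<integral>x. (\<integral>z. complex_of_real (gaussian z) * (f x * cnj (f (x
        - \<epsilon> n *\<^sub>R z))) \<partial>lborel) \<partial>lborel)"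
      by (simp add: mult.left_commute del: integral_mult_right_zero)
    also have "(\<integral>x. (\<integral>z. complex_of_real (gaussian z) * (f x * cnj (f (x
        - \<epsilon> n *\<^sub>R z))) \<partial>lborel) \<partial>lborel)
       = (\<integral>z. (\<integral>x. complex_of_real (gaussian z) * (f x * cnj (f (x - \<epsilon> n *\<^sub>R z))) \<partial>lborel) \<partial>lborel)"
    proof (rule lborel_pair.Fubini_integral)
      have i: "integrable lborel (\<lambda>x. complex_of_real (gaussian z) * (f x * cnj (f (x
          - \<epsilon> n *\<^sub>R z))))" for z
        by (intro integrable_mult_right square_integrable_times_integrable f2
            square_integrable_cnj shift)
      show "integrable (lborel \<Otimes>\<^sub>M lborel)
         (\<lambda>(z, x). complex_of_real (gaussian z) * (f x * cnj (f (x - \<epsilon> n *\<^sub>R z))))"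
      proof (rule lborel_pair.Fubini_integrable)
        show "AE z in lborel. integrable lborel
            (\<lambda>x. case (z, x) of (z, x) \<Rightarrow> complex_of_real (gaussian z) * (f x * cnj (f (x
                - \<epsilon> n *\<^sub>R z))))"
          using i by simp
        show "integrable lborel (\<lambda>z. \<integral>x. cmod (case (z, x) of
            (z, x) \<Rightarrow> complex_of_real (gaussian z) * (f x * cnj (f (x - \<epsilon> n *\<^sub>R z)))) \<partial>lborel)"
        proof (rule Bochner_Integration.integrable_bound)
          show "integrable lborel (\<lambda>z::'a. gaussian z * (2 * E))"
            by (intro integrable_mult_left gaussian_integrable)
          have "(\<integral>x. cmod (complex_of_real (gaussian z) * (f x * cnj (f (x - \<epsilon> n *\<^sub>R z)))) \<partial>lborel)
             \<le> gaussian z * (2 * E)" for z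
          proof -
            have "(\<integral>x. cmod (complex_of_real (gaussian z) * (f x * cnj (f (x
                - \<epsilon> n *\<^sub>R z)))) \<partial>lborel) \<le>
              (\<integral>x. gaussian z * ((cmod (f x))\<^sup>2 + (cmod (f (x - \<epsilon> n *\<^sub>R z)))\<^sup>2) \<partial>lborel)"
            proof (rule integral_mono)
              show "integrable lborel (\<lambda>x. cmod (complex_of_real (gaussian z) * (f x * cnj (f (x
                  - \<epsilon> n *\<^sub>R z)))))"
                using i by (rule integrable_norm)
              show "integrable lborel (\<lambda>x. gaussian z * ((cmod (f x))\<^sup>2 + (cmod (f (x
                  - \<epsilon> n *\<^sub>R z)))\<^sup>2))"
                using f2 shift by (auto simp: square_integrable_def)
              fix x
              show "cmod (complex_of_real (gaussian z) * (f x * cnj (f (x - \<epsilon> n *\<^sub>R z))))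
                \<le> gaussian z * ((cmod (f x))\<^sup>2 + (cmod (f (x - \<epsilon> n *\<^sub>R z)))\<^sup>2)"
                using cmod_mult_le_squares[of "f x" "cnj (f (x
                    - \<epsilon> n *\<^sub>R z))"] gaussian_bounds(1)[of z]
                by (simp add: norm_mult)
            qed
            also have "\<dots> = gaussian z * (2 * E)"
              using f2 shift[of "\<epsilon> n *\<^sub>R z"] shiftE[of "\<epsilon> n *\<^sub>R z"]
              by (simp add: square_integrable_def E_def)
            finally show ?thesis .
          qed
          then show "AE z in lborel. norm (\<integral>x. cmod (case (z, x) of
            (z, x) \<Rightarrow> complex_of_real (gaussian z) * (f x * cnj (f (x - \<epsilon> n *\<^sub>R z)))) \<partial>lborel)
             \<le> norm (gaussian z * (2 * E))"
            using E0 by (intro AE_I2) (simp add: abs_mult)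
        qed measurable
      qed measurable
    qed
    also have "c *\<^sub>R \<dots> = I n" by (simp add: I_def A_def)
    finally show ?thesis .
  qed
  have J_lim: "(\<lambda>n. \<integral>\<omega>. J n \<omega> \<partial>lborel) \<longlonglongrightarrow> E"
    using I_lim unfolding J_eq[symmetric] by (simp add: tendsto_of_real_iff)
  have mono: "mono (\<lambda>n. J n \<omega>)" for \<omega>
  proof (rule monoI)
    fix m n :: nat assume "m \<le> n"
    then have "\<epsilon> n \<le> \<epsilon> m" by (simp add: \<epsilon>_def frac_le)
    then have "\<epsilon> n * norm \<omega> \<le> \<epsilon> m * norm \<omega>" by (intro mult_right_mono) auto
    then have "(norm (\<epsilon> n *\<^sub>R \<omega>))\<^sup>2 \<le> (norm (\<epsilon> m *\<^sub>R \<omega>))\<^sup>2"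
      using \<epsilon>[of n] \<epsilon>[of m] by (intro power_mono) auto
    then show "J m \<omega> \<le> J n \<omega>" unfolding J_def gaussian_def by (intro mult_left_mono) auto
  qed
  have lim: "(\<lambda>n. J n \<omega>) \<longlonglongrightarrow> (cmod (ift f \<omega>))\<^sup>2" for \<omega>
  proof -
    have "\<epsilon> \<longlonglongrightarrow> 0" unfolding \<epsilon>_def by (rule LIMSEQ_Suc[OF lim_1_over_n])
    then have "(\<lambda>n. (cmod (ift f \<omega>))\<^sup>2 * gaussian (\<epsilon> n *\<^sub>R \<omega>))
        \<longlonglongrightarrow> (cmod (ift f \<omega>))\<^sup>2 * exp (- (norm (0 *\<^sub>R \<omega>))\<^sup>2 / 2)"
      unfolding gaussian_def by (intro tendsto_intros) auto
    then show ?thesis by (simp add: J_def)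
  qed
  have m: "(\<lambda>\<omega>. (cmod (ift f \<omega>))\<^sup>2) \<in> borel_measurable lborel" by measurable
  show "square_integrable (ift f)"
    unfolding square_integrable_def
    using integrable_monotone_convergence[OF J_int _ _ J_lim m] mono lim by simp
  show "(\<integral>x. (cmod (ift f x))\<^sup>2 \<partial>lborel) = (\<integral>x. (cmod (f x))\<^sup>2 \<partial>lborel)"
    using integral_monotone_convergence[OF J_int _ _ J_lim m] mono lim by (simp add: E_def)
qed

section \<open>Fourier inversion for the Plancherel transform\<close>

definition cut :: "real \<Rightarrow> ('a::euclidean_space \<Rightarrow> complex) \<Rightarrow> 'a \<Rightarrow> complex" where
  "cut R u x = indicator (ball 0 R) x *\<^sub>R u x"

lemma cut_integrable:
  fixes u :: "'a::euclidean_space \<Rightarrow> complex"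
  assumes u: "square_integrable u"
  shows "integrable lborel (cut R u)" "square_integrable (cut R u)"
proof -
  note [measurable] = square_integrable_measurable[OF u]
  have "(\<lambda>x::'a. indicator (ball 0 R) x :: real) \<in> borel_measurable borel"
    by (intro borel_measurable_indicator) auto
  then have "(\<lambda>x::'a. complex_of_real (indicator (ball 0 R) x)) \<in> borel_measurable borel"
    by (rule measurable_compose[OF _ borel_measurable_of_real])
  then have "square_integrable (\<lambda>x. complex_of_real (indicator (ball 0 R) x) * u x)"
    by (rule square_integrable_mult_bounded[OF u, of _ 1]) (auto split: split_indicator)
  then show c2: "square_integrable (cut R u)"
    by (simp add: cut_def[abs_def] scaleR_conv_of_real)
  show "integrable lborel (cut R u)"
  proof (rule Bochner_Integration.integrable_bound)
    have "integrable lborel (\<lambda>x::'a. indicator (ball 0 R) x :: real)"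
      by (intro integrable_real_indicator emeasure_bounded_finite) auto
    then show "integrable lborel (\<lambda>x. indicator (ball 0 R) x + (cmod (u x))\<^sup>2)"
      using u by (auto simp: square_integrable_def)
    have "cmod (u x) \<le> 1 + (cmod (u x))\<^sup>2" for x
      using cmod_mult_le_squares[of 1 "u x"] by simp
    then show "AE x in lborel. cmod (cut R u x) \<le> norm (indicator (ball 0 R) x + (cmod (u x))\<^sup>2)"
      by (auto simp: cut_def split: split_indicator)
    show "cut R u \<in> borel_measurable lborel" using c2 by (simp add: square_integrable_def)
  qed
qed

lemma cut_energy_tendsto:
  fixes u :: "'a::euclidean_space \<Rightarrow> complex"
  assumes u: "square_integrable u"
  shows "((\<lambda>R. \<integral>x. (cmod (cut R u x))\<^sup>2 \<partial>lborel) \<longlongrightarrow> (\<integral>x. (cmod (u x))\<^sup>2 \<partial>lborel)) at_top"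
proof (rule integral_dominated_convergence_at_top)
  note [measurable] = square_integrable_measurable[OF u]
  show "integrable lborel (\<lambda>x. (cmod (u x))\<^sup>2)" using u by (simp add: square_integrable_def)
  show "AE x in lborel. ((\<lambda>R. (cmod (cut R u x))\<^sup>2) \<longlongrightarrow> (cmod (u x))\<^sup>2) at_top"
  proof (intro AE_I2 tendsto_eventually)
    fix x
    show "\<forall>\<^sub>F R in at_top. (cmod (cut R u x))\<^sup>2 = (cmod (u x))\<^sup>2"
      using eventually_gt_at_top[of "norm x"] by eventually_elim (auto simp: cut_def)
  qed
  show "\<forall>\<^sub>F R in at_top. AE x in lborel. norm ((cmod (cut R u x))\<^sup>2) \<le> (cmod (u x))\<^sup>2"
    by (auto simp: cut_def split: split_indicator)
  show "(\<lambda>x. (cmod (cut R u x))\<^sup>2) \<in> borel_measurable lborel" for R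
    using cut_integrable(2)[OF u, of R] by (auto simp: square_integrable_def)
  show "(\<lambda>x. (cmod (u x))\<^sup>2) \<in> borel_measurable lborel" by measurable
qed

lemma square_integrable_reflect:
  fixes h :: "'a::euclidean_space \<Rightarrow> complex"
  assumes "square_integrable h"
  shows "square_integrable (\<lambda>x. h (- x))"
    and "(\<integral>x. (cmod (h (- x)))\<^sup>2 \<partial>lborel) = (\<integral>x. (cmod (h x))\<^sup>2 \<partial>lborel)"
  using square_integrable_affine[OF assms, of "-1" 0] square_integrable_measurable[OF assms]
    lborel_integral_affine[of "-1" "\<lambda>x. (cmod (h x))\<^sup>2" 0] by simp_all

lemma energy_diff:
  assumes g: "square_integrable g" and h: "square_integrable h"
  shows "(\<integral>x. (cmod (g x - h x))\<^sup>2 \<partial>lborel) =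
    (\<integral>x. (cmod (g x))\<^sup>2 \<partial>lborel) + (\<integral>x. (cmod (h x))\<^sup>2 \<partial>lborel) - 2 * Re (\<integral>x. cnj (g x) * h
        x \<partial>lborel)"
proof -
  have i: "integrable lborel (\<lambda>x. cnj (g x) * h x)"
    by (intro square_integrable_times_integrable square_integrable_cnj g h)
  have "(cmod (a - b))\<^sup>2 = (cmod a)\<^sup>2 + (cmod b)\<^sup>2 - 2 * Re (cnj a * b)" for a b
    unfolding cmod_power2 by (simp add: power2_eq_square algebra_simps)
  then have "(\<integral>x. (cmod (g x - h x))\<^sup>2 \<partial>lborel) =
      (\<integral>x. (cmod (g x))\<^sup>2 + (cmod (h x))\<^sup>2 - 2 * Re (cnj (g x) * h x) \<partial>lborel)"
    by (simp only:)
  also have "\<dots> = (\<integral>x. (cmod (g x))\<^sup>2 \<partial>lborel) + (\<integral>x. (cmod (h x))\<^sup>2 \<partial>lborel)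
      - (\<integral>x. 2 * Re (cnj (g x) * h x) \<partial>lborel)"
    using g h i by (subst Bochner_Integration.integral_diff)
      (auto simp: square_integrable_def simp del: Re_complex_of_real times_complex.sel)
  also have "(\<integral>x. 2 * Re (cnj (g x) * h x) \<partial>lborel) = 2 * Re (\<integral>x. cnj (g x) * h x \<partial>lborel)"
    using i by (subst integral_mult_right_zero) (simp add: integral_Re del: times_complex.sel)
  finally show ?thesis .
qed

text \<open>By the multiplication formula the inner product of \<open>g\<close> with the transform of the truncated
  function is the energy of the truncated function. Expanding the square, the error is the
  energy of \<open>ift g\<close> outside the ball.\<close>

lemma transform_cut_tendsto:
  fixes g :: "'a::euclidean_space \<Rightarrow> complex"
  assumes g: "integrable lborel g" and g2: "square_integrable g"
  shows "((\<lambda>R. \<integral>\<omega>. (cmod (g \<omega> - ift (cut R (ift g)) (- \<omega>)))\<^sup>2 \<partial>lborel) \<longlongrightarrow> 0) at_top"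
proof -
  define u where "u = ift g"
  have u: "square_integrable u" unfolding u_def by (rule plancherel[OF g g2])
  define E where "E = (\<integral>x. (cmod (u x))\<^sup>2 \<partial>lborel)"
  have gm[measurable]: "g \<in> borel_measurable borel" using g by auto
  have "(\<integral>\<omega>. (cmod (g \<omega> - ift (cut R u) (- \<omega>)))\<^sup>2 \<partial>lborel)
      = E - (\<integral>x. (cmod (cut R u x))\<^sup>2 \<partial>lborel)" for R
  proof -
    note c = cut_integrable[OF u, of R]
    note p = plancherel[OF c]
    have "(\<integral>\<omega>. cnj (g \<omega>) * ift (cut R u) (- \<omega>) \<partial>lborel)
        = (\<integral>\<omega>. ift (cut R u) \<omega> * cnj (g (- \<omega>)) \<partial>lborel)"
      using ift_measurable[OF c(1)] by (subst lborel_integral_affine[of "-1" _ 0]) (auto simp: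
          mult.commute)
    also have "\<dots> = (\<integral>x. cut R u x * ift (\<lambda>\<omega>. cnj (g (- \<omega>))) x \<partial>lborel)"
      using lborel_integrable_affine_iff[of "-1" g 0] g by (intro ift_multiplication c) auto
    also have "\<dots> = (\<integral>x. complex_of_real ((cmod (cut R u x))\<^sup>2) \<partial>lborel)"
    proof (intro Bochner_Integration.integral_cong refl)
      fix x
      have "ift (\<lambda>\<omega>. cnj (g (- \<omega>))) x = cnj (u x)"
        using ift_reflect[of "\<lambda>\<omega>. cnj (g \<omega>)" x] by (simp add: u_def ift_cnj)
      then show "cut R u x * ift (\<lambda>\<omega>. cnj (g (- \<omega>))) x = complex_of_real ((cmod (cut R u x))\<^sup>2)"
        by (auto simp: cut_def complex_norm_square[symmetric] split: split_indicator)
    qed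
    finally have "Re (\<integral>\<omega>. cnj (g \<omega>) * ift (cut R u) (- \<omega>) \<partial>lborel)
        = (\<integral>x. (cmod (cut R u x))\<^sup>2 \<partial>lborel)"
      by (simp only: integral_complex_of_real Re_complex_of_real)
    then show ?thesis
      using energy_diff[OF g2 square_integrable_reflect(1)[OF p(1)]]
          square_integrable_reflect(2)[OF p(1)] p(2)
        plancherel(2)[OF g g2] by (simp add: E_def u_def)
  qed
  moreover have "((\<lambda>R. E - (\<integral>x. (cmod (cut R u x))\<^sup>2 \<partial>lborel)) \<longlongrightarrow> E - E) at_top"
    unfolding E_def by (intro tendsto_diff tendsto_const cut_energy_tendsto u)
  ultimately show ?thesis by (simp add: u_def)
qed

text \<open>The expression in the definition of \<^const>\<open>plancherel_transform\<close> in terms of \<^const>\<open>ift\<close>.\<close>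

lemma truncated_fourier_integral:
  fixes u :: "'a::euclidean_space \<Rightarrow> real"
  shows "(2 * pi) powr (- real DIM('a) / 2) *\<^sub>R
      (LINT x:ball 0 R|lborel. complex_of_real (u x) * cis (- (x \<bullet> \<omega>)))
    = ift (cut R (\<lambda>x. complex_of_real (u x))) (- \<omega>)"
  by (simp add: ift_def cut_def set_lebesgue_integral_def inner_commute)

lemma plancherel_transform_ift:
  fixes g :: "'a::euclidean_space \<Rightarrow> complex"
  assumes g: "integrable lborel g" and g2: "square_integrable g" and re: "\<And>x. ift g x \<in> \<real>"
  shows "plancherel_transform (\<lambda>x. Re (ift g x)) g"
proof -
  have u: "square_integrable (ift g)" by (rule plancherel[OF g g2])
  have e: "(\<lambda>x. complex_of_real (Re (ift g x))) = ift g" using re by auto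
  have sq: "square_integrable (\<lambda>\<omega>. g \<omega> - ift (cut R (ift g)) (- \<omega>))" for R
    by (intro square_integrable_diff g2 square_integrable_reflect plancherel cut_integrable u)
  have "((\<lambda>R. ennreal (\<integral>\<omega>. (cmod (g \<omega> - ift (cut R (ift g)) (- \<omega>)))\<^sup>2 \<partial>lborel)) \<longlongrightarrow> ennreal 0) at_top"
    by (intro tendsto_ennrealI transform_cut_tendsto g g2)
  moreover have "ennreal (\<integral>\<omega>. (cmod (g \<omega> - ift (cut R (ift g)) (- \<omega>)))\<^sup>2 \<partial>lborel) =
     (\<integral>\<^sup>+\<omega>. ennreal ((cmod (g \<omega> - ift (cut R (ift g)) (- \<omega>)))\<^sup>2) \<partial>lborel)" for R
    using sq[of R] by (intro nn_integral_eq_integral[symmetric]) (auto simp: square_integrable_def)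
  ultimately show ?thesis
    using g2 unfolding plancherel_transform_def truncated_fourier_integral e square_integrable_def
    by simp
qed

text \<open>Both \<open>U\<close> and \<open>ift g\<close> have the transform \<open>g\<close>, the latter by \<open>transform_cut_tendsto\<close>. By
  Plancherel's theorem the truncations of their difference have energies tending to 0.\<close>

lemma plancherel_transform_inversion:
  fixes U :: "'a::euclidean_space \<Rightarrow> real"
  assumes U: "U \<in> borel_measurable lborel" "integrable lborel (\<lambda>x. (U x)\<^sup>2)"
    and pt: "plancherel_transform U g" and g: "integrable lborel g"
  shows "AE x in lborel. complex_of_real (U x) = ift g x"
proof -
  define u where "u x = complex_of_real (U x)" for x
  define v where "v = ift g"
  define w where "w x = u x - v x" for x
  have u: "square_integrable u" using U by (simp add: square_integrable_def u_def[abs_def])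
  have g2: "square_integrable g" using pt by (simp add: plancherel_transform_def
      square_integrable_def)
  have v: "square_integrable v" unfolding v_def by (rule plancherel[OF g g2])
  have w: "square_integrable w" unfolding w_def by (intro square_integrable_diff u v)
  have sq: "square_integrable (\<lambda>\<omega>. g \<omega> - ift (cut R z) (- \<omega>))" if "square_integrable z" for R z
    by (intro square_integrable_diff g2 square_integrable_reflect plancherel cut_integrable that)
  define D where "D z R = (\<integral>\<omega>. (cmod (g \<omega> - ift (cut R z) (- \<omega>)))\<^sup>2 \<partial>lborel)" for z R
  have Dv: "(D v \<longlongrightarrow> 0) at_top"
    unfolding D_def v_def by (intro transform_cut_tendsto g g2)
  have "((\<lambda>R. \<integral>\<^sup>+\<omega>. ennreal ((cmod (g \<omega> - ift (cut R u) (- \<omega>)))\<^sup>2) \<partial>lborel) \<longlongrightarrow> ennreal 0) at_top"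
    using pt unfolding plancherel_transform_def truncated_fourier_integral u_def by simp
  also have "(\<lambda>R. \<integral>\<^sup>+\<omega>. ennreal ((cmod (g \<omega> - ift (cut R u) (- \<omega>)))\<^sup>2) \<partial>lborel)
      = (\<lambda>R. ennreal (D u R))"
    using sq[OF u] unfolding D_def by (intro ext nn_integral_eq_integral) (auto simp:
        square_integrable_def)
  finally have Du: "(D u \<longlongrightarrow> 0) at_top"
    by (subst (asm) tendsto_ennreal_iff) (auto simp: D_def)
  have "(\<integral>x. (cmod (cut R w x))\<^sup>2 \<partial>lborel) \<le> 2 * D v R + 2 * D u R" for R
  proof -
    note c = cut_integrable[OF w, of R]
    have e: "ift (cut R w) y = ift (cut R u) y - ift (cut R v) y" for y
      by (subst ift_diff[symmetric]) (auto simp: cut_integrable u v cut_def w_def scaleR_diff_right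
         intro!: arg_cong[of _ _ "\<lambda>f. ift f y"])
    have "(\<integral>x. (cmod (cut R w x))\<^sup>2 \<partial>lborel) = (\<integral>\<omega>. (cmod (ift (cut R w) (- \<omega>)))\<^sup>2 \<partial>lborel)"
      using plancherel[OF c] square_integrable_reflect(2) by metis
    also have "\<dots> \<le> (\<integral>\<omega>. 2 * (cmod (g \<omega> - ift (cut R v) (- \<omega>)))\<^sup>2 + 2 * (cmod (g \<omega>
        - ift (cut R u) (- \<omega>)))\<^sup>2 \<partial>lborel)"
    proof (rule integral_mono)
      show "integrable lborel (\<lambda>\<omega>. (cmod (ift (cut R w) (- \<omega>)))\<^sup>2)"
        using square_integrable_reflect(1)[OF plancherel(1)[OF c]]
        by (simp add: square_integrable_def)
      show "integrable lborel (\<lambda>\<omega>. 2 * (cmod (g \<omega> - ift (cut R v) (- \<omega>)))\<^sup>2 + 2 * (cmod (g \<omega>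
          - ift (cut R u) (- \<omega>)))\<^sup>2)"
        using sq[OF u, of R] sq[OF v, of R] by (auto simp: square_integrable_def)
      fix \<omega>
      show "(cmod (ift (cut R w) (- \<omega>)))\<^sup>2 \<le> 2 * (cmod (g \<omega> - ift (cut R v) (- \<omega>)))\<^sup>2
          + 2 * (cmod (g \<omega> - ift (cut R u) (- \<omega>)))\<^sup>2"
        using cmod_add_squares[of "g \<omega> - ift (cut R v) (- \<omega>)" "- (g \<omega> - ift (cut R u) (- \<omega>))"]
        by (simp add: e norm_minus_commute)
    qed
    also have "\<dots> = 2 * D v R + 2 * D u R"
      using sq[OF u, of R] sq[OF v, of R] unfolding D_def
      by (subst Bochner_Integration.integral_add) (auto simp: square_integrable_def)
    finally show ?thesis .
  qed
  moreover have "((\<lambda>R. 2 * D v R + 2 * D u R) \<longlongrightarrow> 2 * 0 + 2 * 0) at_top"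
    by (intro tendsto_add tendsto_mult tendsto_const Du Dv)
  ultimately have "(\<integral>x. (cmod (w x))\<^sup>2 \<partial>lborel) \<le> 2 * 0 + 2 * 0"
    using cut_energy_tendsto[OF w] by (intro tendsto_le[OF _ _ cut_energy_tendsto[OF w]]) auto
  then have "(\<integral>x. (cmod (w x))\<^sup>2 \<partial>lborel) = 0"
    by (intro antisym) auto
  then have "AE x in lborel. (cmod (w x))\<^sup>2 = 0"
    using w by (subst (asm) integral_nonneg_eq_0_iff_AE) (auto simp: square_integrable_def)
  then show ?thesis by eventually_elim (simp add: w_def u_def v_def)
qed

section \<open>Sobolev weights\<close>

definition weight :: "real \<Rightarrow> 'a::euclidean_space \<Rightarrow> real" where
  "weight s \<omega> = (1 + (norm \<omega>)\<^sup>2) powr s"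

lemma one_plus_norm_square [simp]: "0 < 1 + (norm \<omega>)\<^sup>2" "1 + (norm \<omega>)\<^sup>2 \<noteq> 0"
  using add_pos_nonneg[of 1 "(norm \<omega>)\<^sup>2"] by auto

lemma weight_pos [simp]: "0 < weight s \<omega>"
  by (simp add: weight_def)

lemma weight_nonneg [simp]: "0 \<le> weight s \<omega>"
  using weight_pos[of s \<omega>] by (rule less_imp_le)

lemma weight_measurable [measurable]: "weight s \<in> borel_measurable borel"
  unfolding weight_def by measurable

lemma weight_add: "weight (s + t) \<omega> = weight s \<omega> * weight t \<omega>"
  by (simp add: weight_def powr_add)

lemma weight_half_square: "(weight (s / 2) \<omega>)\<^sup>2 = weight s \<omega>"
  using weight_add[of "s / 2" "s / 2" \<omega>] by (simp add: power2_eq_square)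

lemma weight_mono: "s \<le> t \<Longrightarrow> weight s \<omega> \<le> weight t \<omega>"
  by (simp add: weight_def powr_mono)

lemma weight_ge_1: "0 \<le> s \<Longrightarrow> 1 \<le> weight s \<omega>"
  by (simp add: weight_def ge_one_powr_ge_zero)

lemma weight_0 [simp]: "weight 0 \<omega> = 1"
  using add_pos_nonneg[of 1 "(norm \<omega>)\<^sup>2"] by (simp add: weight_def)

lemma weight_1: "weight 1 \<omega> = 1 + (norm \<omega>)\<^sup>2"
  by (simp add: weight_def add_pos_nonneg)

lemma weight_integrable_1d:
  assumes a: "a > 1 / 2"
  shows "integrable lborel (\<lambda>x::real. (1 + x\<^sup>2) powr (- a))"
proof -
  define f where "f x = x powr (- 2 * a) * indicator {1..} x" for x :: real
  have f0: "0 \<le> f x" for x by (simp add: f_def)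
  have f[measurable]: "f \<in> borel_measurable borel" unfolding f_def by measurable
  have "(\<integral>\<^sup>+x. ennreal (x powr (- 2 * a)) * indicator {1..} x \<partial>lborel)
      = 0 - 1 powr (1 - 2 * a) / (1 - 2 * a)"
  proof (rule nn_integral_FTC_atLeast[where F = "\<lambda>x. x powr (1 - 2 * a) / (1 - 2 * a)"])
    show "DERIV (\<lambda>x. x powr (1 - 2 * a) / (1 - 2 * a)) x :> x powr (- 2 * a)" if "1 \<le> x" for x
      using a that DERIV_cdivide[OF has_real_derivative_powr[of x "1 - 2 * a"], of "1 - 2 * a"]
      by simp
    have "((\<lambda>x::real. x powr (1 - 2 * a)) \<longlongrightarrow> 0) at_top"
      using a by (intro tendsto_neg_powr filterlim_ident) auto
    then show "((\<lambda>x. x powr (1 - 2 * a) / (1 - 2 * a)) \<longlongrightarrow> 0) at_top"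
      by (rule tendsto_divide_zero)
  qed auto
  moreover have "ennreal (x powr (- 2 * a)) * indicator {1..} x = ennreal (f x)" for x
    by (simp add: f_def split: split_indicator)
  ultimately have fi: "integrable lborel f"
    by (intro integrableI_nonneg) (auto simp: f_def)
  have "integrable lborel (\<lambda>x. f (0 + (- 1) *\<^sub>R x))"
    by (subst lborel_integrable_affine_iff) (auto intro: fi)
  then have "integrable lborel (\<lambda>x. f x + f (- x) + indicator {-1..1} x)"
    using fi by (intro Bochner_Integration.integrable_add) auto
  then show ?thesis
  proof (rule Bochner_Integration.integrable_bound)
    have "(1 + x\<^sup>2) powr (- a) \<le> f x + f (- x) + indicator {-1..1} x" for x
    proof (cases "\<bar>x\<bar> \<le> 1")
      case True
      have "(1 + x\<^sup>2) powr (- a) \<le> (1 + x\<^sup>2) powr 0" using a by (intro powr_mono) auto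
      also have "\<dots> = 1" using add_pos_nonneg[of 1 "x\<^sup>2"] by simp
      finally show ?thesis using True f0[of x] f0[of "- x"] by (auto simp: abs_le_iff)
    next
      case False
      have "(1 + x\<^sup>2) powr (- a) \<le> (x\<^sup>2) powr (- a)"
        using a False by (intro powr_mono2') auto
      also have "\<dots> = \<bar>x\<bar> powr (- 2 * a)"
        using False by (simp add: powr_powr flip: powr_realpow)
          (metis abs_ge_zero powr_numeral powr_powr power2_abs mult_minus_right)
      also have "\<dots> \<le> f x + f (- x) + indicator {-1..1} x"
        using False by (auto simp: f_def abs_if split: split_indicator)
      finally show ?thesis .
    qed
    then show "AE x in lborel. norm ((1 + x\<^sup>2) powr (- a))
        \<le> norm (f x + f (- x) + indicator {-1..1} x)"
      by (intro AE_I2) (simp add: order_trans[OF _ abs_ge_self])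
  qed measurable
qed

text \<open>The weight is at most a product of one-dimensional weights of exponent \<open>s / n > 1/2\<close>, one
  for each coordinate.\<close>

lemma weight_integrable:
  assumes s: "s > real DIM('a) / 2"
  shows "integrable lborel (weight (- s) :: 'a::euclidean_space \<Rightarrow> real)"
proof (rule Bochner_Integration.integrable_bound)
  define a where "a = s / real DIM('a)"
  have D: "real DIM('a) > 0" by simp
  then have a: "a > 1 / 2" using s by (simp add: a_def field_simps)
  show "integrable lborel (\<lambda>\<omega>::'a. \<Prod>b\<in>Basis. (1 + (\<omega> \<bullet> b)\<^sup>2) powr (- a))"
    by (rule lborel_integral_prod_coordinates(1)) (rule weight_integrable_1d[OF a])
  have "weight (- s) \<omega> \<le> (\<Prod>b\<in>Basis. (1 + (\<omega> \<bullet> b)\<^sup>2) powr (- a))" for \<omega> :: 'a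
  proof -
    have "weight (- s) \<omega> = (\<Prod>b\<in>(Basis::'a set). (1 + (norm \<omega>)\<^sup>2) powr (- a))"
      using D by (simp add: weight_def powr_realpow[symmetric] powr_powr a_def add_pos_nonneg)
    also have "\<dots> \<le> (\<Prod>b\<in>Basis. (1 + (\<omega> \<bullet> b)\<^sup>2) powr (- a))"
    proof (rule prod_mono, safe)
      fix b :: 'a assume "b \<in> Basis"
      then have "\<bar>\<omega> \<bullet> b\<bar> \<le> norm \<omega>" by (rule Basis_le_norm)
      then have "(\<omega> \<bullet> b)\<^sup>2 \<le> (norm \<omega>)\<^sup>2" by (simp add: abs_le_square_iff[symmetric])
      then show "(1 + (norm \<omega>)\<^sup>2) powr (- a) \<le> (1 + (\<omega> \<bullet> b)\<^sup>2) powr (- a)"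
        using a by (intro powr_mono2') (auto simp: add_pos_nonneg)
    qed auto
    finally show ?thesis .
  qed
  then show "AE \<omega> in lborel. norm (weight (- s) (\<omega>::'a))
      \<le> norm (\<Prod>b\<in>Basis. (1 + (\<omega> \<bullet> b)\<^sup>2) powr (- a))"
    by (intro AE_I2) (simp add: abs_of_nonneg prod_nonneg)
qed measurable

section \<open>Weighted square integrable functions\<close>

definition sobolev_data :: "real \<Rightarrow> ('a::euclidean_space \<Rightarrow> complex) \<Rightarrow> bool" where
  "sobolev_data s g \<longleftrightarrow>
    g \<in> borel_measurable lborel \<and> integrable lborel (\<lambda>\<omega>. weight s \<omega> * (cmod (g \<omega>))\<^sup>2)"

text \<open>The norm of \<open>H\<^sup>s(\<real>\<^sup>n)\<close>, expressed through the Fourier transform \<open>g\<close>.\<close>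

definition data_norm :: "real \<Rightarrow> ('a::euclidean_space \<Rightarrow> complex) \<Rightarrow> real" where
  "data_norm s g = sqrt (\<integral>\<omega>. weight s \<omega> * (cmod (g \<omega>))\<^sup>2 \<partial>lborel)"

lemma data_norm_nonneg [simp]: "0 \<le> data_norm s g"
  by (simp add: data_norm_def)

lemma data_norm_square: "(data_norm s g)\<^sup>2 = (\<integral>\<omega>. weight s \<omega> * (cmod (g \<omega>))\<^sup>2 \<partial>lborel)"
  by (simp add: data_norm_def)

lemma data_norm_nn_integral:
  assumes "sobolev_data s g"
  shows "(\<integral>\<^sup>+\<omega>. ennreal (weight s \<omega> * (cmod (g \<omega>))\<^sup>2) \<partial>lborel) = ennreal ((data_norm s g)\<^sup>2)"
  using assms unfolding data_norm_square
  by (intro nn_integral_eq_integral) (auto simp: sobolev_data_def)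

lemma sobolev_data_measurable [measurable_dest]: "sobolev_data s g \<Longrightarrow> g \<in> borel_measurable borel"
  by (simp add: sobolev_data_def)

lemma sobolev_data_bound:
  assumes [measurable]: "k \<in> borel_measurable borel"
    and bound: "(\<integral>\<^sup>+\<omega>. ennreal (weight s \<omega> * (cmod (k \<omega>))\<^sup>2) \<partial>lborel) \<le> ennreal (B\<^sup>2)" and "0 \<le> B"
  shows "sobolev_data s k" and "data_norm s k \<le> B"
proof -
  have "integrable lborel (\<lambda>\<omega>. weight s \<omega> * (cmod (k \<omega>))\<^sup>2)"
    using order_le_less_trans[OF bound ennreal_less_top] by (intro integrableI_nonneg) auto
  then show sd: "sobolev_data s k" by (simp add: sobolev_data_def)
  have "(data_norm s k)\<^sup>2 \<le> B\<^sup>2" using bound unfolding data_norm_nn_integral[OF sd] by simp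
  then show "data_norm s k \<le> B" using \<open>0 \<le> B\<close> by (rule power2_le_imp_le)
qed

lemma sobolev_data_pointwise_bound:
  assumes g: "sobolev_data s g" and k: "k \<in> borel_measurable borel"
    and le: "\<And>\<omega>. weight t \<omega> * (cmod (k \<omega>))\<^sup>2 \<le> B\<^sup>2 * (weight s \<omega> * (cmod (g \<omega>))\<^sup>2)" and "0 \<le> B"
  shows "sobolev_data t k" and "data_norm t k \<le> B * data_norm s g"
proof -
  have "(\<integral>\<^sup>+\<omega>. ennreal (weight t \<omega> * (cmod (k \<omega>))\<^sup>2) \<partial>lborel) \<le>
     (\<integral>\<^sup>+\<omega>. ennreal (B\<^sup>2) * ennreal (weight s \<omega> * (cmod (g \<omega>))\<^sup>2) \<partial>lborel)"
    using le by (intro nn_integral_mono) (simp flip: ennreal_mult)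
  also have "\<dots> = ennreal (B\<^sup>2) * ennreal ((data_norm s g)\<^sup>2)"
    using sobolev_data_measurable[OF g] by (simp add: nn_integral_cmult data_norm_nn_integral[OF g])
  finally have "(\<integral>\<^sup>+\<omega>. ennreal (weight t \<omega> * (cmod (k \<omega>))\<^sup>2) \<partial>lborel)
      \<le> ennreal ((B * data_norm s g)\<^sup>2)"
    by (simp add: power_mult_distrib ennreal_mult)
  then show "sobolev_data t k" "data_norm t k \<le> B * data_norm s g"
    using sobolev_data_bound[OF k] \<open>0 \<le> B\<close> by auto
qed

lemma sobolev_data_weaken:
  assumes g: "sobolev_data s g" and "t \<le> s"
  shows "sobolev_data t g" and "data_norm t g \<le> data_norm s g"
proof -
  have "weight t \<omega> * (cmod (g \<omega>))\<^sup>2 \<le> 1\<^sup>2 * (weight s \<omega> * (cmod (g \<omega>))\<^sup>2)" for \<omega>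
    using mult_right_mono[OF weight_mono[OF \<open>t \<le> s\<close>, of \<omega>], of "(cmod (g \<omega>))\<^sup>2"] by simp
  from sobolev_data_pointwise_bound[OF g sobolev_data_measurable[OF g] this]
  show "sobolev_data t g" "data_norm t g \<le> data_norm s g" by simp_all
qed

lemma sobolev_data_square_integrable:
  assumes g: "sobolev_data s g" and "0 \<le> s"
  shows "square_integrable g"
  using sobolev_data_weaken(1)[OF g \<open>0 \<le> s\<close>] by (simp add: sobolev_data_def square_integrable_def)

lemma sobolev_data_cmult:
  assumes g: "sobolev_data s g"
  shows "sobolev_data s (\<lambda>\<omega>. c * g \<omega>)" and "data_norm s (\<lambda>\<omega>. c * g \<omega>) \<le> cmod c * data_norm s g"
  using sobolev_data_measurable[OF g]
    sobolev_data_pointwise_bound[OF g, of "\<lambda>\<omega>. c * g \<omega>" s "cmod c"]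
  by (auto simp: norm_mult power_mult_distrib)

lemma sobolev_data_add:
  assumes g: "sobolev_data s g" and k: "sobolev_data s k"
  shows "sobolev_data s (\<lambda>\<omega>. g \<omega> + k \<omega>)"
    and "data_norm s (\<lambda>\<omega>. g \<omega> + k \<omega>) \<le> 2 * (data_norm s g + data_norm s k)"
proof -
  note [measurable] = sobolev_data_measurable[OF g] sobolev_data_measurable[OF k]
  have "(\<integral>\<^sup>+\<omega>. ennreal (weight s \<omega> * (cmod (g \<omega> + k \<omega>))\<^sup>2) \<partial>lborel) \<le>
     (\<integral>\<^sup>+\<omega>. 2 * ennreal (weight s \<omega> * (cmod (g \<omega>))\<^sup>2) + 2 * ennreal (weight s \<omega> * (cmod (k
         \<omega>))\<^sup>2) \<partial>lborel)"
  proof (intro nn_integral_mono)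
    fix \<omega>
    have "weight s \<omega> * (cmod (g \<omega> + k \<omega>))\<^sup>2 \<le> weight s \<omega> * (2 * (cmod (g \<omega>))\<^sup>2
        + 2 * (cmod (k \<omega>))\<^sup>2)"
      by (intro mult_left_mono cmod_add_squares) auto
    also have "\<dots> = 2 * (weight s \<omega> * (cmod (g \<omega>))\<^sup>2) + 2 * (weight s \<omega> * (cmod (k \<omega>))\<^sup>2)"
      by (simp add: algebra_simps)
    also have "ennreal \<dots> = 2 * ennreal (weight s \<omega> * (cmod (g \<omega>))\<^sup>2) + 2 * ennreal (weight s
        \<omega> * (cmod (k \<omega>))\<^sup>2)"
      by (simp add: ennreal_mult')
    finally show "ennreal (weight s \<omega> * (cmod (g \<omega> + k \<omega>))\<^sup>2)
        \<le> 2 * ennreal (weight s \<omega> * (cmod (g \<omega>))\<^sup>2) + 2 * ennreal (weight s \<omega> * (cmod (k \<omega>))\<^sup>2)"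
      by (simp add: ennreal_leI)
  qed
  also have "\<dots> = 2 * ennreal ((data_norm s g)\<^sup>2) + 2 * ennreal ((data_norm s k)\<^sup>2)"
    by (simp add: nn_integral_add nn_integral_cmult data_norm_nn_integral[OF g]
        data_norm_nn_integral[OF k])
  also have "\<dots> = ennreal (2 * (data_norm s g)\<^sup>2 + 2 * (data_norm s k)\<^sup>2)"
    by (simp add: ennreal_mult')
  also have "\<dots> \<le> ennreal ((2 * (data_norm s g + data_norm s k))\<^sup>2)"
    by (intro ennreal_leI) (simp add: power2_sum power_mult_distrib)
  finally show "sobolev_data s (\<lambda>\<omega>. g \<omega> + k \<omega>)"
    "data_norm s (\<lambda>\<omega>. g \<omega> + k \<omega>) \<le> 2 * (data_norm s g + data_norm s k)"
    using sobolev_data_bound[of "\<lambda>\<omega>. g \<omega> + k \<omega>"] by (auto simp del: power_mult_distrib)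
qed

text \<open>The Cauchy-Schwarz inequality after distributing the weight over the two factors. The
  multiplier \<open>m\<close> is 1 in the Sobolev embedding, and a frequency cutoff in the sampling
  inequality.\<close>

lemma sobolev_data_multiplier_integrable:
  assumes g: "sobolev_data s g" and m[measurable]: "m \<in> borel_measurable borel"
    and i: "integrable lborel (\<lambda>\<omega>. (m \<omega>)\<^sup>2 * weight (- s) \<omega>)"
  shows "integrable lborel (\<lambda>\<omega>. complex_of_real (m \<omega>) * g \<omega>)"
    and "(\<integral>\<omega>. \<bar>m \<omega>\<bar> * cmod (g \<omega>) \<partial>lborel) \<le>
      sqrt (\<integral>\<omega>. (m \<omega>)\<^sup>2 * weight (- s) \<omega> \<partial>lborel) * data_norm s g"
proof -
  note [measurable] = sobolev_data_measurable[OF g]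
  define p where "p \<omega> = complex_of_real (m \<omega> * weight (- s / 2) \<omega>)" for \<omega>
  define q where "q \<omega> = complex_of_real (weight (s / 2) \<omega>) * g \<omega>" for \<omega>
  have p2: "(cmod (p \<omega>))\<^sup>2 = (m \<omega>)\<^sup>2 * weight (- s) \<omega>" for \<omega>
    using weight_half_square[of "- s" \<omega>] by (simp add: p_def norm_mult power_mult_distrib)
  have q2: "(cmod (q \<omega>))\<^sup>2 = weight s \<omega> * (cmod (g \<omega>))\<^sup>2" for \<omega>
    by (simp add: q_def norm_mult power_mult_distrib weight_half_square)
  have pq: "p \<omega> * q \<omega> = complex_of_real (m \<omega>) * g \<omega>" for \<omega>
    using weight_add[of "- s / 2" "s / 2" \<omega>] by (simp add: p_def q_def flip: of_real_mult)
  have p: "square_integrable p"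
    using i unfolding square_integrable_def p2 by (auto simp: p_def[abs_def])
  have q: "square_integrable q"
    using g unfolding square_integrable_def q2 by (auto simp: q_def[abs_def] sobolev_data_def)
  show "integrable lborel (\<lambda>\<omega>. complex_of_real (m \<omega>) * g \<omega>)"
    using square_integrable_times_integrable[OF p q] by (simp add: pq)
  define p' where "p' \<omega> = complex_of_real (cmod (p \<omega>))" for \<omega>
  define q' where "q' \<omega> = complex_of_real (cmod (q \<omega>))" for \<omega>
  have p': "square_integrable p'" and q': "square_integrable q'"
    using p q by (auto simp: square_integrable_def p'_def[abs_def] q'_def[abs_def])
  have "(\<integral>\<omega>. p' \<omega> * q' \<omega> \<partial>lborel) = complex_of_real (\<integral>\<omega>. \<bar>m \<omega>\<bar> * cmod (g \<omega>) \<partial>lborel)"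
  proof -
    have "p' \<omega> * q' \<omega> = complex_of_real (\<bar>m \<omega>\<bar> * cmod (g \<omega>))" for \<omega>
      unfolding p'_def q'_def of_real_mult[symmetric] norm_mult[symmetric] pq
      by (simp add: norm_mult)
    then show ?thesis by (simp only: integral_complex_of_real)
  qed
  then have "(\<integral>\<omega>. \<bar>m \<omega>\<bar> * cmod (g \<omega>) \<partial>lborel)\<^sup>2
      \<le> (\<integral>\<omega>. (m \<omega>)\<^sup>2 * weight (- s) \<omega> \<partial>lborel) * (data_norm s g)\<^sup>2"
    using integral_cauchy_schwarz[OF p' q'] unfolding data_norm_square
    by (simp add: p'_def q'_def p2 q2)
  then have "\<bar>\<integral>\<omega>. \<bar>m \<omega>\<bar> * cmod (g \<omega>) \<partial>lborel\<bar>
      \<le> sqrt ((\<integral>\<omega>. (m \<omega>)\<^sup>2 * weight (- s) \<omega> \<partial>lborel) * (data_norm s g)\<^sup>2)"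
    by (rule real_le_rsqrt[OF order_trans[OF eq_refl], rotated]) simp
  then show "(\<integral>\<omega>. \<bar>m \<omega>\<bar> * cmod (g \<omega>) \<partial>lborel) \<le>
      sqrt (\<integral>\<omega>. (m \<omega>)\<^sup>2 * weight (- s) \<omega> \<partial>lborel) * data_norm s g"
    by (simp add: real_sqrt_mult)
qed

text \<open>The type argument carries the dimension, on which the constant depends.\<close>

definition embedding_const :: "'a::euclidean_space itself \<Rightarrow> real \<Rightarrow> real" where
  "embedding_const _ s = sqrt (integral\<^sup>L lborel (weight (- s) :: 'a \<Rightarrow> real))"

lemma embedding_const_nonneg [simp]: "0 \<le> embedding_const T s"
  by (simp add: embedding_const_def)

lemma sobolev_data_integrable:
  fixes g :: "'a::euclidean_space \<Rightarrow> complex"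
  assumes g: "sobolev_data s g" and s: "s > real DIM('a) / 2"
  shows "integrable lborel g"
    and "(\<integral>\<omega>. cmod (g \<omega>) \<partial>lborel) \<le> embedding_const TYPE('a) s * data_norm s g"
  using sobolev_data_multiplier_integrable[OF g, of "\<lambda>_. 1"] weight_integrable[OF s]
  by (auto simp: embedding_const_def)

section \<open>Sobolev functions as Fourier integrals\<close>

text \<open>For \<open>s > n/2\<close> this says that \<open>g\<close> is the Fourier transform of an extension of \<open>u\<close> in
  \<open>H\<^sup>s(\<real>\<^sup>n)\<close>, where the extension is represented by its continuous version \<open>ift g\<close>.\<close>

definition fourier_rep :: "real \<Rightarrow> 'a::euclidean_space set \<Rightarrow> ('a \<Rightarrow> real) \<Rightarrow> ('a \<Rightarrow> complex) \<Rightarrow> bool"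
    where
  "fourier_rep s \<Omega> u g \<longleftrightarrow>
    sobolev_data s g \<and> (\<forall>x. ift g x \<in> \<real>) \<and> (\<forall>x\<in>\<Omega>. complex_of_real (u x) = ift g x)"

text \<open>The points where two continuous functions differ form an open set, and a nonempty open set is
  not negligible.\<close>

lemma AE_eq_continuous_imp_eq:
  fixes f h :: "'a::euclidean_space \<Rightarrow> 'b::{t2_space}"
  assumes "open S" and f: "continuous_on S f" and h: "continuous_on S h"
    and ae: "AE x in lborel. x \<in> S \<longrightarrow> f x = h x" and "x \<in> S"
  shows "f x = h x"
proof (rule ccontr)
  assume ne: "f x \<noteq> h x"
  then obtain A B where AB: "open A" "open B" "f x \<in> A" "h x \<in> B" "A \<inter> B = {}"
    using hausdorff[OF ne] by metis
  define T where "T = (f -` A \<inter> S) \<inter> (h -` B \<inter> S)"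
  have "open (f -` A \<inter> S)" "open (h -` B \<inter> S)"
    using f h AB(1,2) \<open>open S\<close> by (simp_all add: continuous_on_open_vimage)
  then have "open T" unfolding T_def by (rule open_Int)
  moreover have "x \<in> T" using AB \<open>x \<in> S\<close> by (auto simp: T_def)
  moreover have "AE y in lborel. y \<notin> T"
    using ae by eventually_elim (use AB in \<open>auto simp: T_def\<close>)
  then have "T \<in> null_sets lborel"
    using \<open>open T\<close> by (subst AE_iff_null_sets) auto
  then have "negligible T"
    by (simp add: negligible_iff_null_sets null_sets_completionI)
  ultimately show False using open_not_negligible by blast
qed

lemma fourier_rep_of_sobolev_fun:
  fixes \<Omega> :: "'a::euclidean_space set"
  assumes "open \<Omega>" and s: "s > real DIM('a) / 2" and u: "continuous_on \<Omega> u"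
    and ext: "(U, g) \<in> sobolev_extensions s \<Omega> u"
  shows "fourier_rep s \<Omega> u g"
proof -
  have sf: "sobolev_fun s U g" and ae: "AE x in lborel. x \<in> \<Omega> \<longrightarrow> U x = u x"
    using ext by (auto simp: sobolev_extensions_def)
  have sd: "sobolev_data s g"
    using sf by (simp add: sobolev_fun_def sobolev_data_def plancherel_transform_def weight_def)
  note gi = sobolev_data_integrable(1)[OF sd s]
  have inv: "AE x in lborel. complex_of_real (U x) = ift g x"
    using sf by (intro plancherel_transform_inversion gi) (auto simp: sobolev_fun_def)
  note c = ift_continuous[OF gi]
  have "complex_of_real (u x) = ift g x" if "x \<in> \<Omega>" for x
  proof (rule AE_eq_continuous_imp_eq[OF \<open>open \<Omega>\<close> _ _ _ that])
    show "continuous_on \<Omega> (\<lambda>x. complex_of_real (u x))" using u by (intro continuous_intros)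
    show "continuous_on \<Omega> (ift g)" using c by (rule continuous_on_subset) auto
    show "AE x in lborel. x \<in> \<Omega> \<longrightarrow> complex_of_real (u x) = ift g x"
      using ae inv by eventually_elim auto
  qed
  moreover have "ift g x \<in> \<real>" for x
  proof -
    have "Im (ift g x) = 0"
    proof (rule AE_eq_continuous_imp_eq[of UNIV "\<lambda>x. Im (ift g x)" "\<lambda>_. 0"])
      show "continuous_on UNIV (\<lambda>x. Im (ift g x))" using c by (intro continuous_intros)
      show "AE x in lborel. x \<in> UNIV \<longrightarrow> Im (ift g x) = 0"
        using inv by eventually_elim (metis Im_complex_of_real)
    qed auto
    then show ?thesis by (simp add: complex_is_Real_iff)
  qed
  ultimately show ?thesis using sd by (simp add: fourier_rep_def)
qed

lemma sobolev_extension_of_fourier_rep: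
  fixes \<Omega> :: "'a::euclidean_space set"
  assumes s: "s > real DIM('a) / 2" and rep: "fourier_rep s \<Omega> u g"
  shows "((\<lambda>x. Re (ift g x)), g) \<in> sobolev_extensions s \<Omega> u"
proof -
  have sd: "sobolev_data s g" and re: "\<And>x. ift g x \<in> \<real>" using rep by (auto simp: fourier_rep_def)
  note gi = sobolev_data_integrable(1)[OF sd s]
  have s0: "0 \<le> s" using s order_trans[of 0 "real DIM('a) / 2" s] by simp
  note g2 = sobolev_data_square_integrable[OF sd s0]
  have "(cmod (ift g x))\<^sup>2 = (Re (ift g x))\<^sup>2" for x
    using re[of x] by (simp add: cmod_power2 complex_is_Real_iff)
  then have "integrable lborel (\<lambda>x. (Re (ift g x))\<^sup>2)"
    using plancherel(1)[OF gi g2] by (simp add: square_integrable_def)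
  moreover have "(\<lambda>x. Re (ift g x)) \<in> borel_measurable lborel"
    using ift_measurable[OF gi] by simp
  ultimately have "sobolev_fun s (\<lambda>x. Re (ift g x)) g"
    using plancherel_transform_ift[OF gi g2 re] sd
    by (simp add: sobolev_fun_def sobolev_data_def weight_def)
  moreover have "Re (ift g x) = u x" if "x \<in> \<Omega>" for x
    using rep that by (metis Re_complex_of_real fourier_rep_def)
  ultimately show ?thesis by (simp add: sobolev_extensions_def)
qed

lemma fourier_rep_continuous:
  fixes \<Omega> :: "'a::euclidean_space set"
  assumes s: "s > real DIM('a) / 2" and rep: "fourier_rep s \<Omega> u g"
  shows "continuous_on \<Omega> u"
proof -
  have "continuous_on \<Omega> (ift g)"
    using rep by (auto simp: fourier_rep_def
      intro: continuous_on_subset[OF ift_continuous[OF sobolev_data_integrable(1)[OF _ s]]])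
  then have "continuous_on \<Omega> (\<lambda>x. Re (ift g x))" by (intro continuous_intros)
  then show ?thesis
    by (rule continuous_on_eq) (use rep in \<open>metis Re_complex_of_real fourier_rep_def\<close>)
qed

lemma sobolev_space_iff:
  fixes \<Omega> :: "'a::euclidean_space set"
  assumes "open \<Omega>" and s: "s > real DIM('a) / 2"
  shows "u \<in> sobolev_space s \<Omega> \<longleftrightarrow> (\<exists>g. fourier_rep s \<Omega> u g)"
proof
  assume "u \<in> sobolev_space s \<Omega>"
  then show "\<exists>g. fourier_rep s \<Omega> u g"
    using fourier_rep_of_sobolev_fun[OF assms] by (force simp: sobolev_space_def)
next
  assume "\<exists>g. fourier_rep s \<Omega> u g"
  then show "u \<in> sobolev_space s \<Omega>"
    using sobolev_extension_of_fourier_rep[OF s] fourier_rep_continuous[OF s]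
    unfolding sobolev_space_def by blast
qed

lemma sobolev_norm_le:
  fixes \<Omega> :: "'a::euclidean_space set"
  assumes s: "s > real DIM('a) / 2" and rep: "fourier_rep s \<Omega> u g"
  shows "sobolev_norm s \<Omega> u \<le> data_norm s g"
proof -
  have "sobolev_norm s \<Omega> u \<le>
     (case (\<lambda>x. Re (ift g x), g) of (U, g) \<Rightarrow> sqrt (LINT \<omega>|lborel. (1
         + (norm \<omega>)\<^sup>2) powr s * (cmod (g \<omega>))\<^sup>2))"
    unfolding sobolev_norm_def
    by (rule cINF_lower[OF _ sobolev_extension_of_fourier_rep[OF s rep]])
      (auto intro!: bdd_belowI2[of _ 0])
  then show ?thesis by (simp add: data_norm_def weight_def)
qed

lemma sobolev_norm_nonneg:
  assumes "u \<in> sobolev_space s \<Omega>"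
  shows "0 \<le> sobolev_norm s \<Omega> u"
  unfolding sobolev_norm_def using assms by (intro cINF_greatest) (auto simp: sobolev_space_def)

text \<open>How estimates for a transform \<open>g\<close> pass to the quotient norm.\<close>

lemma le_sobolev_normI:
  fixes \<Omega> :: "'a::euclidean_space set"
  assumes "open \<Omega>" and s: "s > real DIM('a) / 2" and u: "u \<in> sobolev_space s \<Omega>"
    and le: "\<And>g. fourier_rep s \<Omega> u g \<Longrightarrow> b \<le> K * data_norm s g" and "0 \<le> K"
  shows "b \<le> K * sobolev_norm s \<Omega> u"
proof (cases "K = 0")
  case True
  then show ?thesis using le u sobolev_space_iff[OF assms(1,2)] by auto
next
  case False
  then have K: "K > 0" using \<open>0 \<le> K\<close> by simp
  have ne: "sobolev_extensions s \<Omega> u \<noteq> {}" and c: "continuous_on \<Omega> u"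
    using u by (auto simp: sobolev_space_def)
  have "b / K \<le> sobolev_norm s \<Omega> u"
    unfolding sobolev_norm_def
  proof (rule cINF_greatest[OF ne], clarify)
    fix U g assume "(U, g) \<in> sobolev_extensions s \<Omega> u"
    then have "b \<le> K * data_norm s g"
      by (intro le fourier_rep_of_sobolev_fun[OF assms(1,2) c])
    then show "b / K \<le> sqrt (LINT \<omega>|lborel. (1 + (norm \<omega>)\<^sup>2) powr s * (cmod (g \<omega>))\<^sup>2)"
      using K by (simp add: data_norm_def weight_def field_simps)
  qed
  then show ?thesis using K by (simp add: field_simps)
qed

section \<open>Sums and products of Sobolev functions\<close>

lemma fourier_rep_weaken:
  assumes "fourier_rep s \<Omega> u g" "t \<le> s"
  shows "fourier_rep t \<Omega> u g"
  using assms by (auto simp: fourier_rep_def sobolev_data_weaken)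

lemma fourier_rep_add:
  fixes \<Omega> :: "'a::euclidean_space set"
  assumes s: "s > real DIM('a) / 2" and u: "fourier_rep s \<Omega> u g" and v: "fourier_rep s \<Omega> v k"
  shows "fourier_rep s \<Omega> (\<lambda>x. u x + v x) (\<lambda>\<omega>. g \<omega> + k \<omega>)"
  using u v sobolev_data_integrable(1)[OF _ s]
  by (auto simp: fourier_rep_def sobolev_data_add ift_add)

lemma fourier_rep_cmult:
  assumes "fourier_rep s \<Omega> u g"
  shows "fourier_rep s \<Omega> (\<lambda>x. c * u x) (\<lambda>\<omega>. complex_of_real c * g \<omega>)"
  using assms by (auto simp: fourier_rep_def sobolev_data_cmult ift_mult_left)

text \<open>Split \<open>b\<close> into two square roots, apply the Cauchy-Schwarz inequality to the inner integral,
  and exchange the integrations.\<close>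

lemma young_inequality:
  fixes a b :: "'a::euclidean_space \<Rightarrow> real"
  assumes [measurable]: "a \<in> borel_measurable borel" "b \<in> borel_measurable borel"
    and a: "\<And>x. 0 \<le> a x" and b: "\<And>x. 0 \<le> b x"
  shows "(\<integral>\<^sup>+\<omega>. (\<integral>\<^sup>+\<eta>. ennreal (a (\<omega> - \<eta>) * b \<eta>) \<partial>lborel)\<^sup>2 \<partial>lborel)
    \<le> (\<integral>\<^sup>+\<eta>. ennreal (b \<eta>) \<partial>lborel)\<^sup>2 * (\<integral>\<^sup>+\<omega>. ennreal ((a \<omega>)\<^sup>2) \<partial>lborel)"
proof -
  let ?B = "\<integral>\<^sup>+\<eta>. ennreal (b \<eta>) \<partial>lborel"
  have "(\<integral>\<^sup>+\<eta>. ennreal (a (\<omega> - \<eta>) * b \<eta>) \<partial>lborel)\<^sup>2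
      \<le> (\<integral>\<^sup>+\<eta>. ennreal ((a (\<omega> - \<eta>))\<^sup>2 * b \<eta>) \<partial>lborel) * ?B" for \<omega>
  proof -
    have "(\<integral>\<^sup>+\<eta>. ennreal (a (\<omega> - \<eta>) * b \<eta>) \<partial>lborel)\<^sup>2 =
        (\<integral>\<^sup>+\<eta>. ennreal (a (\<omega> - \<eta>) * sqrt (b \<eta>)) * ennreal (sqrt (b \<eta>)) \<partial>lborel)\<^sup>2"
      using a b by (simp add: ennreal_mult[symmetric] mult.assoc)
    also have "\<dots> \<le> (\<integral>\<^sup>+\<eta>. (ennreal (a (\<omega> - \<eta>) * sqrt (b \<eta>)))\<^sup>2 \<partial>lborel) * (\<integral>\<^sup>+\<eta>. (ennreal (sqrt (b
        \<eta>)))\<^sup>2 \<partial>lborel)"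
      by (intro Cauchy_Schwarz_nn_integral) auto
    also have "\<dots> = (\<integral>\<^sup>+\<eta>. ennreal ((a (\<omega> - \<eta>))\<^sup>2 * b \<eta>) \<partial>lborel) * ?B"
      using a b by (simp add: ennreal_power power_mult_distrib)
    finally show ?thesis .
  qed
  then have "(\<integral>\<^sup>+\<omega>. (\<integral>\<^sup>+\<eta>. ennreal (a (\<omega> - \<eta>) * b \<eta>) \<partial>lborel)\<^sup>2 \<partial>lborel)
     \<le> (\<integral>\<^sup>+\<omega>. (\<integral>\<^sup>+\<eta>. ennreal ((a (\<omega> - \<eta>))\<^sup>2 * b \<eta>) \<partial>lborel) * ?B \<partial>lborel)"
    by (intro nn_integral_mono)
  also have "\<dots> = (\<integral>\<^sup>+\<omega>. (\<integral>\<^sup>+\<eta>. ennreal ((a (\<omega> - \<eta>))\<^sup>2 * b \<eta>) \<partial>lborel) \<partial>lborel) * ?B"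
    by (rule nn_integral_multc) measurable
  also have "(\<integral>\<^sup>+\<omega>. (\<integral>\<^sup>+\<eta>. ennreal ((a (\<omega> - \<eta>))\<^sup>2 * b \<eta>) \<partial>lborel) \<partial>lborel) =
     (\<integral>\<^sup>+\<eta>. (\<integral>\<^sup>+\<omega>. ennreal ((a (\<omega> - \<eta>))\<^sup>2 * b \<eta>) \<partial>lborel) \<partial>lborel)"
    by (rule lborel_pair.Fubini') measurable
  also have "\<dots> = (\<integral>\<^sup>+\<eta>. (\<integral>\<^sup>+\<omega>. ennreal ((a \<omega>)\<^sup>2) \<partial>lborel) * ennreal (b \<eta>) \<partial>lborel)"
  proof (intro nn_integral_cong)
    fix \<eta>
    have "(\<integral>\<^sup>+\<omega>. ennreal ((a (\<omega> - \<eta>))\<^sup>2 * b \<eta>) \<partial>lborel) = (\<integral>\<^sup>+\<omega>. ennreal ((a (\<omega>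
        - \<eta>))\<^sup>2) \<partial>lborel) * ennreal (b \<eta>)"
      using b by (simp add: ennreal_mult nn_integral_multc)
    also have "(\<integral>\<^sup>+\<omega>. ennreal ((a (\<omega> - \<eta>))\<^sup>2) \<partial>lborel) = (\<integral>\<^sup>+\<omega>. ennreal ((a \<omega>)\<^sup>2) \<partial>lborel)"
      by (subst (2) lborel_affine[of 1 "- \<eta>"]) (simp_all add: nn_integral_density nn_integral_distr)
    finally show "(\<integral>\<^sup>+\<omega>. ennreal ((a (\<omega> - \<eta>))\<^sup>2 * b \<eta>) \<partial>lborel)
        = (\<integral>\<^sup>+\<omega>. ennreal ((a \<omega>)\<^sup>2) \<partial>lborel) * ennreal (b \<eta>)" .
  qed
  also have "\<dots> = (\<integral>\<^sup>+\<omega>. ennreal ((a \<omega>)\<^sup>2) \<partial>lborel) * ?B"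
    by (rule nn_integral_cmult) measurable
  finally show ?thesis by (simp add: power2_eq_square mult_ac)
qed

definition convolve :: "('a::euclidean_space \<Rightarrow> complex) \<Rightarrow> ('a \<Rightarrow> complex) \<Rightarrow> 'a \<Rightarrow> complex" where
  "convolve g k \<omega> = (\<integral>\<eta>. g (\<omega> - \<eta>) * k \<eta> \<partial>lborel)"

lemma convolve_measurable:
  assumes [measurable]: "g \<in> borel_measurable borel" "k \<in> borel_measurable borel"
  shows "convolve g k \<in> borel_measurable borel"
  unfolding convolve_def[abs_def] by measurable

text \<open>The normalization of \<^const>\<open>ift\<close> accounts for the factor.\<close>

lemma ift_convolve:
  fixes g k :: "'a::euclidean_space \<Rightarrow> complex"
  assumes g: "integrable lborel g" and k: "integrable lborel k"
  shows "ift (\<lambda>\<omega>. complex_of_real ((2 * pi) powr (- real DIM('a) / 2)) * convolve g k \<omega>) x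
      = ift g x * ift k x"
proof -
  define c where "c = complex_of_real ((2 * pi) powr (- real DIM('a) / 2))"
  have [measurable]: "g \<in> borel_measurable borel" "k \<in> borel_measurable borel" using g k by auto
  have shift: "integrable lborel (\<lambda>\<omega>. g (\<omega> - \<eta>))" for \<eta>
    using lborel_integrable_affine_iff[of 1 g "- \<eta>"] g by simp
  have "ift g x * ift k x = c * (c * ((\<integral>\<omega>. g \<omega> * cis (x \<bullet> \<omega>) \<partial>lborel) * (\<integral>\<eta>. k \<eta> * cis (x \<bullet>
      \<eta>) \<partial>lborel)))"
    by (simp add: ift_def c_def scaleR_conv_of_real)
  also have "(\<integral>\<omega>. g \<omega> * cis (x \<bullet> \<omega>) \<partial>lborel) * (\<integral>\<eta>. k \<eta> * cis (x \<bullet> \<eta>) \<partial>lborel) =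
     (\<integral>\<eta>. (\<integral>\<omega>. g \<omega> * cis (x \<bullet> \<omega>) \<partial>lborel) * (k \<eta> * cis (x \<bullet> \<eta>)) \<partial>lborel)"
    by (rule integral_mult_right_zero[symmetric])
  also have "\<dots> = (\<integral>\<eta>. (\<integral>\<omega>. g (\<omega> - \<eta>) * k \<eta> * cis (x \<bullet> \<omega>) \<partial>lborel) \<partial>lborel)"
  proof (intro Bochner_Integration.integral_cong refl)
    fix \<eta>
    have "(\<integral>\<omega>. g \<omega> * cis (x \<bullet> \<omega>) \<partial>lborel) = (\<integral>\<omega>. g (\<omega> - \<eta>) * cis (x \<bullet> (\<omega> - \<eta>)) \<partial>lborel)"
      by (subst lborel_integral_affine[of 1 _ "- \<eta>"]) auto
    then have "(\<integral>\<omega>. g \<omega> * cis (x \<bullet> \<omega>) \<partial>lborel) * (k \<eta> * cis (x \<bullet> \<eta>)) =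
        (\<integral>\<omega>. g (\<omega> - \<eta>) * cis (x \<bullet> (\<omega> - \<eta>)) * (k \<eta> * cis (x \<bullet> \<eta>)) \<partial>lborel)"
      by (simp only: integral_mult_left_zero)
    also have "\<dots> = (\<integral>\<omega>. g (\<omega> - \<eta>) * k \<eta> * cis (x \<bullet> \<omega>) \<partial>lborel)"
    proof (intro Bochner_Integration.integral_cong refl)
      fix \<omega>
      have "cis (x \<bullet> \<omega>) = cis (x \<bullet> (\<omega> - \<eta>)) * cis (x \<bullet> \<eta>)"
        by (simp add: cis_mult inner_diff_right)
      then show "g (\<omega> - \<eta>) * cis (x \<bullet> (\<omega> - \<eta>)) * (k \<eta> * cis (x \<bullet> \<eta>))
          = g (\<omega> - \<eta>) * k \<eta> * cis (x \<bullet> \<omega>)"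
        by simp
    qed
    finally show "(\<integral>\<omega>. g \<omega> * cis (x \<bullet> \<omega>) \<partial>lborel) * (k \<eta> * cis (x \<bullet> \<eta>)) =
        (\<integral>\<omega>. g (\<omega> - \<eta>) * k \<eta> * cis (x \<bullet> \<omega>) \<partial>lborel)" .
  qed
  also have "\<dots> = (\<integral>\<omega>. (\<integral>\<eta>. g (\<omega> - \<eta>) * k \<eta> * cis (x \<bullet> \<omega>) \<partial>lborel) \<partial>lborel)"
  proof (rule lborel_pair.Fubini_integral[symmetric], rule lborel_pair.Fubini_integrable)
    show "AE \<eta> in lborel. integrable lborel (\<lambda>\<omega>. case (\<eta>, \<omega>) of (\<eta>, \<omega>) \<Rightarrow> g (\<omega>
        - \<eta>) * k \<eta> * cis (x \<bullet> \<omega>))"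
      using shift by (auto intro!: AE_I2 integrable_mult_cis)
    have "(\<integral>\<omega>. cmod (g (\<omega> - \<eta>)) \<partial>lborel) = (\<integral>\<omega>. cmod (g \<omega>) \<partial>lborel)" for \<eta>
      by (subst (2) lborel_integral_affine[of 1 _ "- \<eta>"]) auto
    then show "integrable lborel (\<lambda>\<eta>. \<integral>\<omega>. cmod (case (\<eta>, \<omega>) of (\<eta>, \<omega>) \<Rightarrow> g (\<omega>
        - \<eta>) * k \<eta> * cis (x \<bullet> \<omega>)) \<partial>lborel)"
      using k by (simp add: norm_mult)
  qed measurable
  also have "\<dots> = (\<integral>\<omega>. convolve g k \<omega> * cis (x \<bullet> \<omega>) \<partial>lborel)"
    by (simp add: convolve_def)
  finally show ?thesis
    unfolding c_def[symmetric] ift_mult_left by (simp add: ift_def c_def scaleR_conv_of_real)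
qed

text \<open>Since \<open>\<bar>\<omega>\<bar> \<le> \<bar>\<omega> - \<eta>\<bar> + \<bar>\<eta>\<bar>\<close>, the larger of the two weights on the right dominates the
  weight at \<open>\<omega>\<close>.\<close>

lemma weight_submultiplicative:
  assumes "0 \<le> s"
  shows "weight (s / 2) \<omega> \<le> 2 powr s * (weight (s / 2) (\<omega> - \<eta>) + weight (s / 2) \<eta>)"
proof -
  let ?m = "max (1 + (norm (\<omega> - \<eta>))\<^sup>2) (1 + (norm \<eta>)\<^sup>2)"
  have "norm \<omega> \<le> norm (\<omega> - \<eta>) + norm \<eta>" by (metis diff_add_cancel norm_triangle_ineq)
  then have "(norm \<omega>)\<^sup>2 \<le> (norm (\<omega> - \<eta>) + norm \<eta>)\<^sup>2" by (intro power_mono) auto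
  also have "\<dots> \<le> 2 * (norm (\<omega> - \<eta>))\<^sup>2 + 2 * (norm \<eta>)\<^sup>2"
    using sum_squares_bound[of "norm (\<omega> - \<eta>)" "norm \<eta>"] by (simp add: power2_sum)
  finally have "1 + (norm \<omega>)\<^sup>2 \<le> 4 * ?m"
    using max.cobounded1[of "1 + (norm (\<omega> - \<eta>))\<^sup>2" "1 + (norm \<eta>)\<^sup>2"]
      max.cobounded2[of "1 + (norm \<eta>)\<^sup>2" "1 + (norm (\<omega> - \<eta>))\<^sup>2"]
      zero_le_power2[of "norm (\<omega> - \<eta>)"] zero_le_power2[of "norm \<eta>"]
        by (simp add: max_def split: if_splits)
  then have "weight (s / 2) \<omega> \<le> (4 * ?m) powr (s / 2)"
    unfolding weight_def using assms by (intro powr_mono2) auto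
  also have "\<dots> = 4 powr (s / 2) * ?m powr (s / 2)" by (rule powr_mult)
  also have "(4::real) powr (s / 2) = 2 powr s"
    using powr_powr[of 2 2 "s / 2"] by simp
  also have "?m powr (s / 2) \<le> weight (s / 2) (\<omega> - \<eta>) + weight (s / 2) \<eta>"
    using weight_nonneg[of "s / 2" \<eta>] weight_nonneg[of "s / 2" "\<omega> - \<eta>"]
    by (auto simp: max_def simp flip: weight_def)
  finally show ?thesis by (simp add: mult_left_mono)
qed

text \<open>Half of the weight at \<open>\<omega>\<close> is moved to one of the two factors by the preceding lemma. In each
  of the two resulting convolutions one factor is in \<open>L\<^sub>2\<close> with norm at most its Sobolev norm,
  and the other is in \<open>L\<^sub>1\<close> by the embedding, so Young's inequality applies.\<close>

lemma convolve_sobolev_data: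
  fixes g k :: "'a::euclidean_space \<Rightarrow> complex"
  assumes s: "s > real DIM('a) / 2" and g: "sobolev_data s g" and k: "sobolev_data s k"
  defines "B \<equiv> 2 * 2 powr s * embedding_const TYPE('a) s * data_norm s g * data_norm s k"
  shows "sobolev_data s (convolve g k)" and "data_norm s (convolve g k) \<le> B"
proof -
  note [measurable] = sobolev_data_measurable[OF g] sobolev_data_measurable[OF k]
  have s0: "0 \<le> s" using s order_trans[of 0 "real DIM('a) / 2" s] by simp
  define e where "e = embedding_const TYPE('a) s"
  define G where "G \<omega> = weight (s / 2) \<omega> * cmod (g \<omega>)" for \<omega>
  define K where "K \<omega> = weight (s / 2) \<omega> * cmod (k \<omega>)" for \<omega>
  have [measurable]: "G \<in> borel_measurable borel" "K \<in> borel_measurable borel"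
    unfolding G_def K_def by measurable
  have G2: "(G \<omega>)\<^sup>2 = weight s \<omega> * (cmod (g \<omega>))\<^sup>2" and K2: "(K \<omega>)\<^sup>2 = weight s \<omega> * (cmod (k \<omega>))\<^sup>2"
      for \<omega>
    by (simp_all add: G_def K_def power_mult_distrib weight_half_square)
  \<comment> \<open>The weight is moved to \<open>g\<close> in \<open>P\<close>, and to \<open>k\<close> in \<open>Q\<close>.\<close>
  define P where "P \<omega> = (\<integral>\<^sup>+\<eta>. ennreal (G (\<omega> - \<eta>) * cmod (k \<eta>)) \<partial>lborel)" for \<omega>
  define Q where "Q \<omega> = (\<integral>\<^sup>+\<eta>. ennreal (K (\<omega> - \<eta>) * cmod (g \<eta>)) \<partial>lborel)" for \<omega>
  have [measurable]: "P \<in> borel_measurable borel" "Q \<in> borel_measurable borel"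
    unfolding P_def Q_def by measurable
  have point: "ennreal (weight (s / 2) \<omega> * cmod (convolve g k \<omega>)) \<le> ennreal (2 powr s) * (P \<omega>
      + Q \<omega>)" for \<omega>
  proof -
    have "ennreal (weight (s / 2) \<omega> * cmod (convolve g k \<omega>)) =
        ennreal (weight (s / 2) \<omega>) * ennreal (cmod (convolve g k \<omega>))"
      by (rule ennreal_mult) auto
    also have "ennreal (cmod (convolve g k \<omega>)) \<le> (\<integral>\<^sup>+\<eta>. ennreal (cmod (g (\<omega> - \<eta>) * k \<eta>)) \<partial>lborel)"
      unfolding convolve_def
      by (cases "integrable lborel (\<lambda>\<eta>. g (\<omega> - \<eta>) * k \<eta>)")
        (auto simp: integral_norm_bound_ennreal not_integrable_integral_eq)
    also have "ennreal (weight (s / 2) \<omega>) * \<dots> = (\<integral>\<^sup>+\<eta>. ennreal (weight (s / 2) \<omega> * (cmod (g (\<omega>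
        - \<eta>)) * cmod (k \<eta>))) \<partial>lborel)"
      by (subst nn_integral_cmult[symmetric]) (auto simp: ennreal_mult norm_mult)
    also have "\<dots> \<le> (\<integral>\<^sup>+\<eta>. ennreal (2 powr s) * (ennreal (G (\<omega> - \<eta>) * cmod (k \<eta>))
        + ennreal (K \<eta> * cmod (g (\<omega> - \<eta>)))) \<partial>lborel)"
    proof (intro nn_integral_mono)
      fix \<eta>
      have "weight (s / 2) \<omega> * (cmod (g (\<omega> - \<eta>)) * cmod (k \<eta>)) \<le>
          2 powr s * (weight (s / 2) (\<omega> - \<eta>) + weight (s / 2) \<eta>) * (cmod (g (\<omega> - \<eta>)) * cmod (k \<eta>))"
        by (intro mult_right_mono weight_submultiplicative s0) auto
      also have "\<dots> = 2 powr s * (G (\<omega> - \<eta>) * cmod (k \<eta>) + K \<eta> * cmod (g (\<omega> - \<eta>)))"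
        by (simp add: G_def K_def algebra_simps)
      finally show "ennreal (weight (s / 2) \<omega> * (cmod (g (\<omega> - \<eta>)) * cmod (k \<eta>))) \<le>
          ennreal (2 powr s) * (ennreal (G (\<omega> - \<eta>) * cmod (k \<eta>)) + ennreal (K \<eta> * cmod (g (\<omega>
              - \<eta>))))"
        by (simp add: G_def K_def ennreal_leI flip: ennreal_mult ennreal_plus)
    qed
    also have "\<dots> = ennreal (2 powr s) * (P \<omega> + (\<integral>\<^sup>+\<eta>. ennreal (K \<eta> * cmod (g (\<omega> - \<eta>))) \<partial>lborel))"
      by (simp add: nn_integral_cmult nn_integral_add P_def)
    also have "(\<integral>\<^sup>+\<eta>. ennreal (K \<eta> * cmod (g (\<omega> - \<eta>))) \<partial>lborel) = Q \<omega>"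
      unfolding Q_def
      by (subst lborel_affine[of "-1" \<omega>]) (simp_all add: nn_integral_density nn_integral_distr)
    finally show ?thesis by (simp add: mult_left_mono)
  qed
  have young_P: "(\<integral>\<^sup>+\<omega>. (P \<omega>)\<^sup>2 \<partial>lborel) \<le> ennreal ((e * data_norm s g * data_norm s k)\<^sup>2)"
    and young_Q: "(\<integral>\<^sup>+\<omega>. (Q \<omega>)\<^sup>2 \<partial>lborel) \<le> ennreal ((e * data_norm s g * data_norm s k)\<^sup>2)"
  proof -
    have l1: "(\<integral>\<^sup>+\<eta>. ennreal (cmod (f \<eta>)) \<partial>lborel)\<^sup>2 \<le> ennreal ((e * data_norm s f)\<^sup>2)"
      if "sobolev_data s f" for f :: "'a \<Rightarrow> complex"
      using sobolev_data_integrable[OF that s]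
      by (simp add: nn_integral_eq_integral e_def ennreal_power ennreal_leI power_mono)
    have "(\<integral>\<^sup>+\<omega>. (P \<omega>)\<^sup>2 \<partial>lborel) \<le> (\<integral>\<^sup>+\<eta>. ennreal (cmod (k \<eta>)) \<partial>lborel)\<^sup>2 * (\<integral>\<^sup>+\<omega>. ennreal ((G
        \<omega>)\<^sup>2) \<partial>lborel)"
      unfolding P_def by (rule young_inequality) (auto simp: G_def)
    also have "\<dots> \<le> ennreal ((e * data_norm s k)\<^sup>2) * ennreal ((data_norm s g)\<^sup>2)"
      unfolding G2 data_norm_nn_integral[OF g] by (intro mult_right_mono l1 k) auto
    finally show "(\<integral>\<^sup>+\<omega>. (P \<omega>)\<^sup>2 \<partial>lborel) \<le> ennreal ((e * data_norm s g * data_norm s k)\<^sup>2)"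
      by (simp add: power_mult_distrib mult_ac flip: ennreal_mult)
    have "(\<integral>\<^sup>+\<omega>. (Q \<omega>)\<^sup>2 \<partial>lborel) \<le> (\<integral>\<^sup>+\<eta>. ennreal (cmod (g \<eta>)) \<partial>lborel)\<^sup>2 * (\<integral>\<^sup>+\<omega>. ennreal ((K
        \<omega>)\<^sup>2) \<partial>lborel)"
      unfolding Q_def by (rule young_inequality) (auto simp: K_def)
    also have "\<dots> \<le> ennreal ((e * data_norm s g)\<^sup>2) * ennreal ((data_norm s k)\<^sup>2)"
      unfolding K2 data_norm_nn_integral[OF k] by (intro mult_right_mono l1 g) auto
    finally show "(\<integral>\<^sup>+\<omega>. (Q \<omega>)\<^sup>2 \<partial>lborel) \<le> ennreal ((e * data_norm s g * data_norm s k)\<^sup>2)"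
      by (simp add: power_mult_distrib mult_ac flip: ennreal_mult)
  qed
  have square: "(p + q)\<^sup>2 \<le> 2 * p\<^sup>2 + 2 * q\<^sup>2" for p q :: ennreal
  proof (cases "p = top \<or> q = top")
    case True
    then show ?thesis by (auto simp: power2_eq_square ennreal_mult_eq_top_iff)
  next
    case False
    then obtain a b where "p = ennreal a" "q = ennreal b" "0 \<le> a" "0 \<le> b"
      by (metis ennreal_cases)
    moreover have "(a + b)\<^sup>2 \<le> 2 * a\<^sup>2 + 2 * b\<^sup>2"
      using sum_squares_bound[of a b] by (simp add: power2_sum)
    moreover have "2 * ennreal (a\<^sup>2) + 2 * ennreal (b\<^sup>2) = ennreal (2 * a\<^sup>2 + 2 * b\<^sup>2)"
      by (simp add: ennreal_mult')
    ultimately show ?thesis by (simp add: ennreal_power ennreal_leI flip: ennreal_plus)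
  qed
  have "(\<integral>\<^sup>+\<omega>. ennreal (weight s \<omega> * (cmod (convolve g k \<omega>))\<^sup>2) \<partial>lborel) \<le>
     (\<integral>\<^sup>+\<omega>. ennreal ((2 powr s)\<^sup>2) * (2 * (P \<omega>)\<^sup>2 + 2 * (Q \<omega>)\<^sup>2) \<partial>lborel)"
  proof (intro nn_integral_mono)
    fix \<omega>
    have "ennreal (weight s \<omega> * (cmod (convolve g k \<omega>))\<^sup>2)
        = (ennreal (weight (s / 2) \<omega> * cmod (convolve g k \<omega>)))\<^sup>2"
      by (simp add: ennreal_power power_mult_distrib weight_half_square)
    also have "\<dots> \<le> (ennreal (2 powr s) * (P \<omega> + Q \<omega>))\<^sup>2" by (intro power_mono point) auto
    also have "\<dots> \<le> ennreal ((2 powr s)\<^sup>2) * (2 * (P \<omega>)\<^sup>2 + 2 * (Q \<omega>)\<^sup>2)"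
      by (simp add: power_mult_distrib ennreal_power mult_left_mono square)
    finally show "ennreal (weight s \<omega> * (cmod (convolve g k \<omega>))\<^sup>2)
        \<le> ennreal ((2 powr s)\<^sup>2) * (2 * (P \<omega>)\<^sup>2 + 2 * (Q \<omega>)\<^sup>2)" .
  qed
  also have "\<dots> = ennreal ((2 powr s)\<^sup>2) * (2 * (\<integral>\<^sup>+\<omega>. (P \<omega>)\<^sup>2 \<partial>lborel)
      + 2 * (\<integral>\<^sup>+\<omega>. (Q \<omega>)\<^sup>2 \<partial>lborel))"
    by (simp add: nn_integral_cmult nn_integral_add)
  also have "\<dots> \<le> ennreal ((2 powr s)\<^sup>2) * (2 * ennreal ((e * data_norm s g * data_norm s k)\<^sup>2)
      + 2 * ennreal ((e * data_norm s g * data_norm s k)\<^sup>2))"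
    by (intro mult_left_mono add_mono young_P young_Q) auto
  also have "\<dots> = ennreal (B\<^sup>2)"
  proof -
    define z where "z = (e * data_norm s g * data_norm s k)\<^sup>2"
    have "2 * ennreal z + 2 * ennreal z = ennreal (2 * z) + ennreal (2 * z)"
      by (simp only: ennreal_mult' ennreal_numeral)
    also have "\<dots> = ennreal (2 * z + 2 * z)"
      by (rule ennreal_plus[symmetric]) (auto simp: z_def)
    finally have "2 * ennreal z + 2 * ennreal z = ennreal (2 * z + 2 * z)" .
    moreover have "(2 powr s)\<^sup>2 * (2 * z + 2 * z) = B\<^sup>2"
      by (simp add: z_def B_def e_def power_mult_distrib)
    moreover have "0 \<le> z" by (simp add: z_def)
    ultimately show ?thesis unfolding z_def[symmetric] by (simp flip: ennreal_mult)
  qed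
  finally have "(\<integral>\<^sup>+\<omega>. ennreal (weight s \<omega> * (cmod (convolve g k \<omega>))\<^sup>2) \<partial>lborel) \<le> ennreal (B\<^sup>2)" .
  moreover have "convolve g k \<in> borel_measurable borel"
    by (intro convolve_measurable) measurable
  moreover have "0 \<le> B" by (simp add: B_def)
  ultimately show "sobolev_data s (convolve g k)" "data_norm s (convolve g k) \<le> B"
    using sobolev_data_bound by auto
qed

lemma fourier_rep_mult:
  fixes \<Omega> :: "'a::euclidean_space set"
  assumes s: "s > real DIM('a) / 2"
  shows "\<exists>C\<ge>0. \<forall>u v g k. fourier_rep s \<Omega> u g \<longrightarrow> fourier_rep s \<Omega> v k \<longrightarrow>
    (\<exists>p. fourier_rep s \<Omega> (\<lambda>x. u x * v x) p \<and> data_norm s p \<le> C * data_norm s g * data_norm s k)"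
proof (intro exI conjI allI impI)
  define c where "c = (2 * pi) powr (- real DIM('a) / 2)"
  have c: "0 \<le> c" by (simp add: c_def)
  show "0 \<le> c * (2 * 2 powr s * embedding_const TYPE('a) s)" by (simp add: c)
  fix u v g k assume u: "fourier_rep s \<Omega> u g" and v: "fourier_rep s \<Omega> v k"
  have g: "sobolev_data s g" and k: "sobolev_data s k"
    using u v by (auto simp: fourier_rep_def)
  let ?p = "\<lambda>\<omega>. complex_of_real c * convolve g k \<omega>"
  note cd = convolve_sobolev_data[OF s g k]
  have p: "ift ?p x = ift g x * ift k x" for x
    unfolding c_def by (rule ift_convolve[OF sobolev_data_integrable(1)[OF g s]
        sobolev_data_integrable(1)[OF k s]])
  show "fourier_rep s \<Omega> (\<lambda>x. u x * v x) ?p"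
    using u v sobolev_data_cmult(1)[OF cd(1)] unfolding fourier_rep_def p by auto
  have "data_norm s ?p \<le> c * data_norm s (convolve g k)"
    using sobolev_data_cmult(2)[OF cd(1), of "complex_of_real c"] c by simp
  also have "\<dots> \<le> c * (2 * 2 powr s * embedding_const TYPE('a) s * data_norm s g * data_norm s k)"
    by (intro mult_left_mono cd(2) c)
  finally show "data_norm s ?p \<le> c * (2 * 2 powr s * embedding_const TYPE('a) s) * data_norm s g *
      data_norm s k"
    by (simp add: mult.assoc)
qed

section \<open>Derivatives of Sobolev functions\<close>

lemma sobolev_data_derivative:
  fixes g :: "'a::euclidean_space \<Rightarrow> complex"
  assumes g: "sobolev_data \<sigma> g" and "norm v \<le> 1"
  shows "sobolev_data (\<sigma> - 1) (\<lambda>\<omega>. \<i> * complex_of_real (v \<bullet> \<omega>) * g \<omega>)"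
    and "data_norm (\<sigma> - 1) (\<lambda>\<omega>. \<i> * complex_of_real (v \<bullet> \<omega>) * g \<omega>) \<le> data_norm \<sigma> g"
proof -
  note [measurable] = sobolev_data_measurable[OF g]
  have le: "weight (\<sigma> - 1) \<omega> * (cmod (\<i> * complex_of_real (v \<bullet> \<omega>) * g \<omega>))\<^sup>2
      \<le> 1\<^sup>2 * (weight \<sigma> \<omega> * (cmod (g \<omega>))\<^sup>2)" for \<omega>
  proof -
    have "\<bar>v \<bullet> \<omega>\<bar> \<le> norm v * norm \<omega>" by (rule Cauchy_Schwarz_ineq2)
    also have "\<dots> \<le> norm \<omega>" using \<open>norm v \<le> 1\<close> by (simp add: mult_left_le_one_le)
    finally have "(v \<bullet> \<omega>)\<^sup>2 \<le> (norm \<omega>)\<^sup>2" by (simp add: abs_le_square_iff[symmetric])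
    also have "\<dots> \<le> weight 1 \<omega>" by (simp add: weight_1)
    finally have "weight (\<sigma> - 1) \<omega> * (v \<bullet> \<omega>)\<^sup>2 \<le> weight (\<sigma> - 1) \<omega> * weight 1 \<omega>"
      by (intro mult_left_mono) auto
    also have "\<dots> = weight \<sigma> \<omega>" using weight_add[of "\<sigma> - 1" 1 \<omega>] by simp
    finally have "weight (\<sigma> - 1) \<omega> * (v \<bullet> \<omega>)\<^sup>2 * (cmod (g \<omega>))\<^sup>2 \<le> weight \<sigma> \<omega> * (cmod (g \<omega>))\<^sup>2"
      by (intro mult_right_mono) auto
    then show ?thesis by (simp add: norm_mult power_mult_distrib mult.assoc)
  qed
  have m: "(\<lambda>\<omega>. \<i> * complex_of_real (v \<bullet> \<omega>) * g \<omega>) \<in> borel_measurable borel"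
    by measurable
  show "sobolev_data (\<sigma> - 1) (\<lambda>\<omega>. \<i> * complex_of_real (v \<bullet> \<omega>) * g \<omega>)"
    "data_norm (\<sigma> - 1) (\<lambda>\<omega>. \<i> * complex_of_real (v \<bullet> \<omega>) * g \<omega>) \<le> data_norm \<sigma> g"
    using sobolev_data_pointwise_bound[OF g m le] by auto
qed

lemma cis_taylor: "cmod (cis t - (\<Sum>k\<le>m. (\<i> * complex_of_real t) ^ k / fact k))
    \<le> \<bar>t\<bar> ^ Suc m / fact (Suc m)"
  using iexp_approx1[of t m] by (simp add: cis_conv_exp)

text \<open>Differentiation under the integral sign, which \<open>\<sigma> - 1 > n/2\<close> justifies: the difference
  quotients of the exponential are dominated by \<open>2 \<bar>\<omega>\<bar> \<bar>g(\<omega>)\<bar>\<close>, an integrable function.\<close>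

lemma ift_has_derivative:
  fixes g :: "'a::euclidean_space \<Rightarrow> complex"
  assumes g: "sobolev_data \<sigma> g" and \<sigma>: "\<sigma> > real DIM('a) / 2 + 1"
  shows "(ift g has_derivative (\<lambda>v. ift (\<lambda>\<omega>. \<i> * complex_of_real (v \<bullet> \<omega>) * g \<omega>) x)) (at x)"
proof -
  note [measurable] = sobolev_data_measurable[OF g]
  define c where "c = (2 * pi) powr (- real DIM('a) / 2)"
  have c0: "0 \<le> c" by (simp add: c_def)
  define D where "D v = ift (\<lambda>\<omega>. \<i> * complex_of_real (v \<bullet> \<omega>) * g \<omega>) x" for v
  have gi: "integrable lborel g" by (rule sobolev_data_integrable[OF g]) (use \<sigma> in simp)
  have ni: "integrable lborel (\<lambda>\<omega>. norm \<omega> * cmod (g \<omega>))"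
  proof -
    have "sobolev_data (\<sigma> - 1) (\<lambda>\<omega>. complex_of_real (norm \<omega>) * g \<omega>)"
    proof (rule sobolev_data_pointwise_bound(1)[OF g, of _ _ 1])
      fix \<omega> :: 'a
      have "weight (\<sigma> - 1) \<omega> * (norm \<omega>)\<^sup>2 \<le> weight (\<sigma> - 1) \<omega> * weight 1 \<omega>"
        by (intro mult_left_mono) (auto simp: weight_1)
      also have "\<dots> = weight \<sigma> \<omega>" using weight_add[of "\<sigma> - 1" 1 \<omega>] by simp
      finally have "weight (\<sigma> - 1) \<omega> * (norm \<omega>)\<^sup>2 * (cmod (g \<omega>))\<^sup>2 \<le> weight \<sigma> \<omega> * (cmod (g \<omega>))\<^sup>2"
        by (intro mult_right_mono) auto
      then show "weight (\<sigma> - 1) \<omega> * (cmod (complex_of_real (norm \<omega>) * g \<omega>))\<^sup>2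
          \<le> 1\<^sup>2 * (weight \<sigma> \<omega> * (cmod (g \<omega>))\<^sup>2)"
        by (simp add: norm_mult power_mult_distrib mult.assoc)
    qed auto
    then have "integrable lborel (\<lambda>\<omega>. complex_of_real (norm \<omega>) * g \<omega>)"
      by (rule sobolev_data_integrable) (use \<sigma> in simp)
    then show ?thesis by (auto dest: integrable_norm simp: norm_mult)
  qed
  have inner_le: "cmod (\<i> * complex_of_real (v \<bullet> \<omega>) * g \<omega>) \<le> norm v * (norm \<omega> * cmod (g \<omega>))" for v \<omega>
    using mult_right_mono[OF Cauchy_Schwarz_ineq2[of v \<omega>], of "cmod (g \<omega>)"]
    by (simp add: norm_mult mult.assoc)
  have vi: "integrable lborel (\<lambda>\<omega>. \<i> * complex_of_real (v \<bullet> \<omega>) * g \<omega>)" for v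
    by (rule Bochner_Integration.integrable_bound[OF integrable_mult_right[OF ni, of "norm v"]])
      (use inner_le in auto)
  have "bounded_linear D"
  proof (rule bounded_linear_intro[where K = "c * (\<integral>\<omega>. norm \<omega> * cmod (g \<omega>) \<partial>lborel)"])
    fix v w :: 'a and r :: real
    show "D (v + w) = D v + D w"
      unfolding D_def by (subst ift_add[symmetric, OF vi vi])
        (simp add: inner_add_left distrib_left distrib_right)
    have "D (r *\<^sub>R v) = ift (\<lambda>\<omega>. complex_of_real r * (\<i> * complex_of_real (v \<bullet> \<omega>) * g \<omega>)) x"
      unfolding D_def by (rule arg_cong[where f = "\<lambda>f. ift f x"]) (auto simp: mult_ac)
    then show "D (r *\<^sub>R v) = r *\<^sub>R D v"
      unfolding ift_mult_left D_def by (simp add: scaleR_conv_of_real)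
    have "cmod (D v) \<le> c * (\<integral>\<omega>. cmod (\<i> * complex_of_real (v \<bullet> \<omega>) * g \<omega>) \<partial>lborel)"
      unfolding D_def c_def by (rule ift_bound)
    also have "\<dots> \<le> c * (\<integral>\<omega>. norm v * (norm \<omega> * cmod (g \<omega>)) \<partial>lborel)"
      by (intro mult_left_mono integral_mono c0 inner_le integrable_norm vi integrable_mult_right
          ni)
    also have "\<dots> = norm v * (c * (\<integral>\<omega>. norm \<omega> * cmod (g \<omega>) \<partial>lborel))"
    proof -
      have "(\<integral>\<omega>. norm v * (norm \<omega> * cmod (g \<omega>)) \<partial>lborel)
          = norm v * (\<integral>\<omega>. norm \<omega> * cmod (g \<omega>) \<partial>lborel)"
        by (rule integral_mult_right_zero)
      then show ?thesis by (simp only: mult.left_commute)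
    qed
    finally show "norm (D v) \<le> norm v * (c * (\<integral>\<omega>. norm \<omega> * cmod (g \<omega>) \<partial>lborel))" .
  qed
  moreover have "((\<lambda>h. norm (ift g (x + h) - ift g x - D h) / norm h) \<longlongrightarrow> 0) (at 0)"
    unfolding tendsto_at_iff_sequentially o_def
  proof (intro allI impI)
    fix h :: "nat \<Rightarrow> 'a" assume "\<forall>i. h i \<in> UNIV - {0}" and h: "h \<longlonglongrightarrow> 0"
    then have h0: "h n \<noteq> 0" for n by auto
    define r where "r n \<omega> = cmod (cis (h n \<bullet> \<omega>) - 1 - \<i> * complex_of_real (h n \<bullet> \<omega>)) / norm (h
        n) * cmod (g \<omega>)" for n \<omega>
    have r_le: "r n \<omega> \<le> norm (h n) * ((norm \<omega>)\<^sup>2 * cmod (g \<omega>))" for n \<omega>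
    proof -
      have "cmod (cis (h n \<bullet> \<omega>) - 1 - \<i> * complex_of_real (h n \<bullet> \<omega>)) \<le> \<bar>h n \<bullet> \<omega>\<bar>\<^sup>2 / 2"
        using cis_taylor[of "h n \<bullet> \<omega>" 1] by (simp add: diff_diff_eq power2_eq_square)
      also have "\<dots> \<le> \<bar>h n \<bullet> \<omega>\<bar>\<^sup>2" by simp
      also have "\<dots> \<le> (norm (h n) * norm \<omega>)\<^sup>2" by (intro power_mono Cauchy_Schwarz_ineq2) auto
      finally have "cmod (cis (h n \<bullet> \<omega>) - 1 - \<i> * complex_of_real (h n \<bullet> \<omega>)) / norm (h n)
          \<le> norm (h n) * (norm \<omega>)\<^sup>2"
        using h0[of n] by (simp add: divide_le_eq power2_eq_square mult_ac)
      then have "r n \<omega> \<le> norm (h n) * (norm \<omega>)\<^sup>2 * cmod (g \<omega>)"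
        unfolding r_def by (rule mult_right_mono) simp
      then show ?thesis by (simp add: mult.assoc)
    qed
    have r_le': "r n \<omega> \<le> 2 * (norm \<omega> * cmod (g \<omega>))" for n \<omega>
    proof -
      have "cmod (cis (h n \<bullet> \<omega>) - 1) \<le> \<bar>h n \<bullet> \<omega>\<bar>"
        using cis_taylor[of "h n \<bullet> \<omega>" 0] by simp
      then have "cmod (cis (h n \<bullet> \<omega>) - 1 - \<i> * complex_of_real (h n \<bullet> \<omega>)) \<le> 2 * \<bar>h n \<bullet> \<omega>\<bar>"
        using norm_triangle_ineq4[of "cis (h n \<bullet> \<omega>) - 1" "\<i> * complex_of_real (h n \<bullet> \<omega>)"]
        by (simp add: norm_mult)
      also have "\<dots> \<le> 2 * (norm (h n) * norm \<omega>)" by (intro mult_left_mono Cauchy_Schwarz_ineq2) auto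
      finally have "cmod (cis (h n \<bullet> \<omega>) - 1 - \<i> * complex_of_real (h n \<bullet> \<omega>)) / norm (h n)
          \<le> 2 * norm \<omega>"
        using h0[of n] by (simp add: divide_le_eq mult_ac)
      then have "r n \<omega> \<le> 2 * norm \<omega> * cmod (g \<omega>)"
        unfolding r_def by (rule mult_right_mono) simp
      then show ?thesis by simp
    qed
    have r0: "0 \<le> r n \<omega>" for n \<omega> by (simp add: r_def)
    have [measurable]: "r n \<in> borel_measurable borel" for n unfolding r_def[abs_def] by measurable
    have rlim: "(\<lambda>n. r n \<omega>) \<longlonglongrightarrow> 0" for \<omega>
    proof (rule Lim_null_comparison)
      show "\<forall>\<^sub>F n in sequentially. norm (r n \<omega>) \<le> norm (h n) * ((norm \<omega>)\<^sup>2 * cmod (g \<omega>))"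
        using r_le r0 by simp
      show "(\<lambda>n. norm (h n) * ((norm \<omega>)\<^sup>2 * cmod (g \<omega>))) \<longlonglongrightarrow> 0"
        using tendsto_mult_left_zero[OF tendsto_norm_zero[OF h]] .
    qed
    have "(\<lambda>n. \<integral>\<omega>. r n \<omega> \<partial>lborel) \<longlonglongrightarrow> integral\<^sup>L lborel (\<lambda>\<omega>::'a. 0::real)"
    proof (rule integral_dominated_convergence)
      show "integrable lborel (\<lambda>\<omega>. 2 * (norm \<omega> * cmod (g \<omega>)))" using ni by simp
      show "AE \<omega> in lborel. norm (r n \<omega>) \<le> 2 * (norm \<omega> * cmod (g \<omega>))" for n
        using r_le' r0 by simp
      show "AE \<omega> in lborel. (\<lambda>n. r n \<omega>) \<longlonglongrightarrow> 0" using rlim by simp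
    qed auto
    then have lim: "(\<lambda>n. c * (\<integral>\<omega>. r n \<omega> \<partial>lborel)) \<longlonglongrightarrow> 0"
      using tendsto_mult_right_zero by fastforce
    show "(\<lambda>n. norm (ift g (x + h n) - ift g x - D (h n)) / norm (h n)) \<longlonglongrightarrow> 0"
    proof (rule Lim_null_comparison[OF _ lim], intro always_eventually allI)
      fix n
      have i1: "integrable lborel (\<lambda>\<omega>. g \<omega> * cis ((x + h n) \<bullet> \<omega>))" "integrable lborel (\<lambda>\<omega>. g \<omega> *
          cis (x \<bullet> \<omega>))"
        by (intro integrable_mult_cis gi; measurable)+
      have i2: "integrable lborel (\<lambda>\<omega>. \<i> * complex_of_real (h n \<bullet> \<omega>) * g \<omega> * cis (x \<bullet> \<omega>))"
        by (intro integrable_mult_cis vi) measurable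
      have e: "ift g (x + h n) - ift g x - D (h n) = c *\<^sub>R (\<integral>\<omega>. g \<omega> * cis ((x + h n) \<bullet> \<omega>)
           - g \<omega> * cis (x \<bullet> \<omega>) - \<i> * complex_of_real (h n \<bullet> \<omega>) * g \<omega> * cis (x \<bullet> \<omega>) \<partial>lborel)"
        using i1 i2 by (simp add: ift_def D_def c_def scaleR_diff_right)
      have "cmod (ift g (x + h n) - ift g x - D (h n)) \<le> c * (\<integral>\<omega>. cmod (g \<omega> * cis ((x + h n) \<bullet> \<omega>)
           - g \<omega> * cis (x \<bullet> \<omega>) - \<i> * complex_of_real (h n \<bullet> \<omega>) * g \<omega> * cis (x \<bullet> \<omega>)) \<partial>lborel)"
        unfolding e norm_scaleR abs_of_nonneg[OF c0]
        by (intro mult_left_mono integral_norm_bound c0)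
      also have "\<dots> = c * (\<integral>\<omega>. norm (h n) * r n \<omega> \<partial>lborel)"
      proof -
        have "cmod (g \<omega> * cis ((x + h n) \<bullet> \<omega>) - g \<omega> * cis (x \<bullet> \<omega>) - \<i> * complex_of_real (h n \<bullet>
            \<omega>) * g \<omega> * cis (x \<bullet> \<omega>))
          = norm (h n) * r n \<omega>" for \<omega>
        proof -
          have "cis ((x + h n) \<bullet> \<omega>) = cis (x \<bullet> \<omega>) * cis (h n \<bullet> \<omega>)"
            by (simp add: cis_mult inner_add_left)
          then have "g \<omega> * cis ((x + h n) \<bullet> \<omega>) - g \<omega> * cis (x \<bullet> \<omega>) - \<i> * complex_of_real (h n \<bullet>
              \<omega>) * g \<omega> * cis (x \<bullet> \<omega>)
             = cis (x \<bullet> \<omega>) * ((cis (h n \<bullet> \<omega>) - 1 - \<i> * complex_of_real (h n \<bullet> \<omega>)) * g \<omega>)"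
            by (simp add: algebra_simps)
          then show ?thesis using h0[of n] by (simp add: r_def norm_mult)
        qed
        then show ?thesis by simp
      qed
      finally have "cmod (ift g (x + h n) - ift g x - D (h n))
          \<le> norm (h n) * (c * (\<integral>\<omega>. r n \<omega> \<partial>lborel))"
        by (simp add: mult_ac)
      then show "norm (norm (ift g (x + h n) - ift g x - D (h n)) / norm (h n))
          \<le> c * (\<integral>\<omega>. r n \<omega> \<partial>lborel)"
        using h0[of n] by (simp add: divide_le_eq mult_ac)
    qed
  qed
  ultimately show ?thesis unfolding has_derivative_at D_def by simp
qed

lemma fourier_rep_derivative:
  fixes \<Omega> :: "'a::euclidean_space set"
  assumes "open \<Omega>" and \<sigma>: "\<sigma> > real DIM('a) / 2 + 1" and u: "fourier_rep \<sigma> \<Omega> u g"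
  shows "x \<in> \<Omega> \<Longrightarrow> u differentiable (at x)"
    and "norm v \<le> 1 \<Longrightarrow> fourier_rep (\<sigma> - 1) \<Omega> (\<lambda>x. frechet_derivative u (at x) v)
      (\<lambda>\<omega>. \<i> * complex_of_real (v \<bullet> \<omega>) * g \<omega>)"
proof -
  have g: "sobolev_data \<sigma> g" and re: "\<And>x. ift g x \<in> \<real>"
    and ug: "\<And>x. x \<in> \<Omega> \<Longrightarrow> complex_of_real (u x) = ift g x"
    using u by (auto simp: fourier_rep_def)
  define D where "D v x = ift (\<lambda>\<omega>. \<i> * complex_of_real (v \<bullet> \<omega>) * g \<omega>) x" for v x
  have der: "(ift g has_derivative (\<lambda>v. D v x)) (at x)" for x
    unfolding D_def by (rule ift_has_derivative[OF g \<sigma>])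
  have Re_der: "((\<lambda>x. Re (ift g x)) has_derivative (\<lambda>v. Re (D v x))) (at x)" for x
    by (rule has_derivative_Re[OF der])
  have D_real: "D v x \<in> \<real>" for v x
  proof -
    have "((\<lambda>x. Im (ift g x)) has_derivative (\<lambda>v. Im (D v x))) (at x)"
      by (rule has_derivative_Im[OF der])
    moreover have "(\<lambda>x. Im (ift g x)) = (\<lambda>_. 0)" using re by (auto simp: complex_is_Real_iff)
    ultimately have "((\<lambda>_. 0) has_derivative (\<lambda>v. Im (D v x))) (at x)" by simp
    then have "(\<lambda>v. Im (D v x)) = (\<lambda>_. 0)"
      by (rule has_derivative_unique[OF _ has_derivative_const])
    then have "Im (D v x) = 0" by meson
    then show ?thesis by (simp add: complex_is_Real_iff)
  qed
  have u_der: "(u has_derivative (\<lambda>v. Re (D v x))) (at x)" if "x \<in> \<Omega>" for x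
  proof (rule has_derivative_transform_within_open[OF Re_der \<open>open \<Omega>\<close> that])
    fix y assume "y \<in> \<Omega>"
    then show "Re (ift g y) = u y" using ug by (metis Re_complex_of_real)
  qed
  show "u differentiable (at x)" if "x \<in> \<Omega>"
    using u_der[OF that] by (auto simp: differentiable_def)
  show "fourier_rep (\<sigma> - 1) \<Omega> (\<lambda>x. frechet_derivative u (at x) v) (\<lambda>\<omega>. \<i> * complex_of_real (v \<bullet>
      \<omega>) * g \<omega>)"
    if "norm v \<le> 1"
    unfolding fourier_rep_def
  proof (intro conjI ballI allI)
    show "sobolev_data (\<sigma> - 1) (\<lambda>\<omega>. \<i> * complex_of_real (v \<bullet> \<omega>) * g \<omega>)"
      by (rule sobolev_data_derivative[OF g that])
    show "ift (\<lambda>\<omega>. \<i> * complex_of_real (v \<bullet> \<omega>) * g \<omega>) x \<in> \<real>" for x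
      using D_real[of v x] by (simp add: D_def)
    fix x assume "x \<in> \<Omega>"
    then have "frechet_derivative u (at x) = (\<lambda>v. Re (D v x))"
      using frechet_derivative_at[OF u_der] by simp
    then show "complex_of_real (frechet_derivative u (at x) v)
        = ift (\<lambda>\<omega>. \<i> * complex_of_real (v \<bullet> \<omega>) * g \<omega>) x"
      using D_real[of v x] by (simp add: D_def)
  qed
qed

section \<open>Norming sets for polynomials\<close>

text \<open>By induction on the degree: \<open>p(t) - 2\<^sup>m\<^sup>+\<^sup>1 p(t/2)\<close> has lower degree than \<open>p\<close>, is bounded
  on the same interval, and its remaining coefficients are in modulus not smaller than those of
  \<open>p\<close>.\<close>

lemma polynomial_coefficient_bound:
  "\<exists>K\<ge>0. \<forall>B. \<forall>a::nat \<Rightarrow> complex. (\<forall>t\<in>{0..1::real}. cmod (\<Sum>k\<le>m. a k * complex_of_real t ^ k) \<le> B) \<longrightarrow>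
    (\<forall>k\<le>m. cmod (a k) \<le> K * B)"
proof (induction m)
  case 0
  show ?case by (rule exI[of _ 1]) force
next
  case (Suc m)
  then obtain K where K: "K \<ge> 0" and IH: "\<And>B a. (\<And>t. t \<in> {0..1::real}
      \<Longrightarrow> cmod (\<Sum>k\<le>m. a k * complex_of_real t ^ k) \<le> B)
      \<Longrightarrow> \<forall>k\<le>m. cmod (a k) \<le> K * B" by blast
  define E where "E = (2::real) ^ Suc m"
  have E1: "E \<ge> 1" unfolding E_def by (rule one_le_power) simp
  define K' where "K' = 1 + real (m + 2) * (K * (1 + E))"
  show ?case
  proof (intro exI[of _ K'] conjI allI impI)
    show "K' \<ge> 0" using K E1 by (simp add: K'_def)
    fix B and a :: "nat \<Rightarrow> complex" and j
    assume bd: "\<forall>t\<in>{0..1}. cmod (\<Sum>k\<le>Suc m. a k * complex_of_real t ^ k) \<le> B" and j: "j \<le> Suc m"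
    define p where "p t = (\<Sum>k\<le>Suc m. a k * complex_of_real t ^ k)" for t :: real
    have p: "cmod (p t) \<le> B" if "t \<in> {0..1}" for t using bd that by (simp add: p_def)
    have B0: "0 \<le> B" using p[of 0] norm_ge_zero[of "p 0"]
      by (meson atLeastAtMost_iff order_trans order_refl zero_le_one)
    \<comment> \<open>The coefficients of \<open>p(t) - 2\<^sup>m\<^sup>+\<^sup>1 p(t/2)\<close>, of which the leading one is 0.\<close>
    define b where "b k = a k * (1 - complex_of_real (2 ^ (Suc m - k)))" for k
    have q: "(\<Sum>k\<le>m. b k * complex_of_real t ^ k) = p t - complex_of_real E * p (t / 2)" for t
    proof -
      have "a k * complex_of_real t ^ k - complex_of_real E * (a k * complex_of_real (t / 2) ^ k)
          = b k * complex_of_real t ^ k"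
        if "k \<le> Suc m" for k
      proof -
        have "E = 2 ^ (Suc m - k) * 2 ^ k" using that by (simp add: E_def flip: power_add)
        then show ?thesis by (simp add: b_def power_divide algebra_simps)
      qed
      then have "p t - complex_of_real E * p (t / 2) = (\<Sum>k\<le>Suc m. b k * complex_of_real t ^ k)"
        unfolding p_def sum_distrib_left sum_subtractf[symmetric] by (intro sum.cong) auto
      also have "\<dots> = (\<Sum>k\<le>m. b k * complex_of_real t ^ k)" by (simp add: b_def)
      finally show ?thesis by simp
    qed
    have "cmod (\<Sum>k\<le>m. b k * complex_of_real t ^ k) \<le> (1 + E) * B" if t: "t \<in> {0..1}" for t
    proof -
      have "cmod (p t - complex_of_real E * p (t / 2)) \<le> cmod (p t) + E * cmod (p (t / 2))"
        using norm_triangle_ineq4[of "p t" "complex_of_real E * p (t / 2)"] E1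
        by (simp add: norm_mult)
      also have "\<dots> \<le> B + E * B" using p[of t] p[of "t / 2"] t E1
        by (intro add_mono mult_left_mono) auto
      finally show ?thesis unfolding q by (simp add: algebra_simps)
    qed
    then have bk: "\<forall>k\<le>m. cmod (b k) \<le> K * ((1 + E) * B)" by (rule IH)
    have ak: "cmod (a k) \<le> K * (1 + E) * B" if "k \<le> m" for k
    proof -
      have "(2::real) ^ 1 \<le> 2 ^ (Suc m - k)" using that by (intro power_increasing) auto
      then have "(2::real) \<le> 2 ^ (Suc m - k)" unfolding power_one_right .
      moreover have "cmod (1 - complex_of_real (2 ^ (Suc m - k))) = \<bar>1 - 2 ^ (Suc m - k)\<bar>"
        by (metis norm_of_real of_real_1 of_real_diff)
      ultimately have "1 \<le> cmod (1 - complex_of_real (2 ^ (Suc m - k)))" by linarith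
      then have "cmod (a k) * 1 \<le> cmod (b k)" unfolding b_def norm_mult
        by (rule mult_left_mono) (rule norm_ge_zero)
      also have "cmod (b k) \<le> K * ((1 + E) * B)" using bk that by blast
      finally show ?thesis by (simp only: mult.assoc mult_1_right)
    qed
    have KEB: "0 \<le> K * (1 + E) * B" using K E1 B0 by simp
    have K'B: "K' * B = B + real (m + 2) * (K * (1 + E) * B)" by (simp add: K'_def algebra_simps)
    show "cmod (a j) \<le> K' * B"
    proof (cases "j \<le> m")
      case True
      have "cmod (a j) \<le> 1 * (K * (1 + E) * B)" using ak[OF True] by simp
      also have "\<dots> \<le> real (m + 2) * (K * (1 + E) * B)" using KEB by (intro mult_right_mono) auto
      finally show ?thesis using B0 unfolding K'B by simp
    next
      case False
      then have "j = Suc m" using j by simp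
      have "p 1 = (\<Sum>k\<le>m. a k) + a (Suc m)" by (simp add: p_def)
      then have "a (Suc m) = p 1 - (\<Sum>k\<le>m. a k)" by simp
      then have "cmod (a (Suc m)) \<le> cmod (p 1) + cmod (\<Sum>k\<le>m. a k)" by (metis norm_triangle_ineq4)
      also have "cmod (\<Sum>k\<le>m. a k) \<le> (\<Sum>k\<le>m. K * (1 + E) * B)" by (rule sum_norm_le) (use ak in auto)
      also have "\<dots> = real (m + 1) * (K * (1 + E) * B)" by simp
      finally have "cmod (a (Suc m)) \<le> B + real (m + 1) * (K * (1 + E) * B)" using p[of 1] by simp
      also have "\<dots> \<le> K' * B" unfolding K'B using KEB by (intro add_left_mono mult_right_mono) auto
      finally show ?thesis by (simp add: \<open>j = Suc m\<close>)
    qed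
  qed
qed

text \<open>Polynomials of degree at most \<open>m\<close> in several variables enter only through their restrictions
  to lines, so this property takes their place, and all estimates are one-dimensional.\<close>

definition line_polynomial :: "nat \<Rightarrow> ('a::euclidean_space \<Rightarrow> complex) \<Rightarrow> bool" where
  "line_polynomial m p \<longleftrightarrow>
    (\<forall>x v. \<exists>a. \<forall>t::real. p (x + t *\<^sub>R v) = (\<Sum>k\<le>m. a k * complex_of_real t ^ k))"

text \<open>Restrict \<open>p\<close> to the line through the centre and \<open>y\<close>.\<close>

lemma line_polynomial_growth:
  "\<exists>G\<ge>0. \<forall>(p::'a::euclidean_space \<Rightarrow> complex) c r B y. line_polynomial m p \<longrightarrow> 0 < r \<longrightarrow>
    (\<forall>z\<in>cball c r. cmod (p z) \<le> B) \<longrightarrow> norm (y - c) \<le> T * r \<longrightarrow> cmod (p y) \<le> G * B"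
proof -
  obtain K where K: "K \<ge> 0" and coeff: "\<And>B a. (\<And>t. t \<in> {0..1::real}
      \<Longrightarrow> cmod (\<Sum>k\<le>m. a k * complex_of_real t ^ k) \<le> B)
      \<Longrightarrow> \<forall>k\<le>m. cmod (a k) \<le> K * B" using polynomial_coefficient_bound[of m] by blast
  define T' where "T' = max 1 T"
  show ?thesis
  proof (intro exI[of _ "real (m + 1) * (K * T' ^ m)"] conjI allI impI)
    show "0 \<le> real (m + 1) * (K * T' ^ m)" using K by (simp add: T'_def)
    fix p :: "'a \<Rightarrow> complex" and c r B y
    assume lp: "line_polynomial m p" and r: "0 < r" and B: "\<forall>z\<in>cball c r. cmod (p z) \<le> B"
      and y: "norm (y - c) \<le> T * r"
    define v where "v = r *\<^sub>R sgn (y - c)"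
    have v: "norm v \<le> r" using r by (simp add: v_def norm_sgn)
    have yv: "y = c + (norm (y - c) / r) *\<^sub>R v"
      using r by (cases "y = c") (auto simp: v_def sgn_div_norm)
    obtain a where a: "\<And>t. p (c + t *\<^sub>R v) = (\<Sum>k\<le>m. a k * complex_of_real t ^ k)"
      using lp unfolding line_polynomial_def by blast
    have "cmod (\<Sum>k\<le>m. a k * complex_of_real t ^ k) \<le> B" if "t \<in> {0..1}" for t
    proof -
      have "t * norm v \<le> 1 * r" using that v by (intro mult_mono) auto
      then have "c + t *\<^sub>R v \<in> cball c r" using that by (simp add: dist_norm)
      then show ?thesis using B a by metis
    qed
    then have ak: "\<forall>k\<le>m. cmod (a k) \<le> K * B" by (rule coeff)
    have "cmod (p c) \<le> B" using B r by auto
    then have B0: "0 \<le> B" using norm_ge_zero order_trans by blast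
    define \<theta> where "\<theta> = norm (y - c) / r"
    have t: "0 \<le> \<theta>" "\<theta> \<le> T'" using y r by (auto simp: \<theta>_def T'_def divide_le_eq le_max_iff_disj)
    have "cmod (p y) = cmod (\<Sum>k\<le>m. a k * complex_of_real \<theta> ^ k)"
      using a[of \<theta>] yv by (simp add: \<theta>_def)
    also have "\<dots> \<le> (\<Sum>k\<le>m. K * B * T' ^ m)"
    proof (rule sum_norm_le)
      fix k assume k: "k \<in> {..m}"
      have "\<theta> ^ k \<le> T' ^ k" using t by (intro power_mono) auto
      also have "\<dots> \<le> T' ^ m" using k by (intro power_increasing) (auto simp: T'_def)
      finally have "cmod (a k) * \<theta> ^ k \<le> K * B * T' ^ m"
        using ak k K B0 t by (intro mult_mono) auto
      then show "cmod (a k * complex_of_real \<theta> ^ k) \<le> K * B * T' ^ m"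
        using t(1) by (simp add: norm_mult norm_power del: of_real_divide)
    qed
    finally show "cmod (p y) \<le> real (m + 1) * (K * T' ^ m) * B" by (simp add: mult_ac)
  qed
qed

text \<open>A Markov inequality without the sharp constant: restrict \<open>p\<close> to the line through \<open>y\<close> and \<open>z\<close>.
  By the growth bound \<open>p\<close> is controlled on the ball of twice the radius, hence on a segment of
  length \<open>r\<close> that starts at \<open>y\<close>.\<close>

lemma line_polynomial_lipschitz:
  "\<exists>L\<ge>0. \<forall>(p::'a::euclidean_space \<Rightarrow> complex) c r B y z \<delta>. line_polynomial m p \<longrightarrow> 0 < r \<longrightarrow>
    (\<forall>z\<in>cball c r. cmod (p z) \<le> B) \<longrightarrow> y \<in> cball c r \<longrightarrow> norm (z - y) \<le> \<delta> * r \<longrightarrow> \<delta> \<le> 1 \<longrightarrow>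
    cmod (p z - p y) \<le> L * \<delta> * B"
proof -
  obtain K where K: "K \<ge> 0" and coeff: "\<And>B a. (\<And>t. t \<in> {0..1::real}
      \<Longrightarrow> cmod (\<Sum>k\<le>m. a k * complex_of_real t ^ k) \<le> B)
      \<Longrightarrow> \<forall>k\<le>m. cmod (a k) \<le> K * B" using polynomial_coefficient_bound[of m] by blast
  obtain G where G: "G \<ge> 0" and growth: "\<And>(p::'a \<Rightarrow> complex) c r B y. line_polynomial m p \<Longrightarrow> 0 < r \<Longrightarrow>
    (\<And>z. z\<in>cball c r \<Longrightarrow> cmod (p z) \<le> B) \<Longrightarrow> norm (y - c) \<le> 2 * r \<Longrightarrow> cmod (p y) \<le> G * B"
    using line_polynomial_growth[of m 2] by metis
  show ?thesis
  proof (intro exI[of _ "real (m + 1) * (K * G)"] conjI allI impI)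
    show "0 \<le> real (m + 1) * (K * G)" using K G by simp
    fix p :: "'a \<Rightarrow> complex" and c r B y z \<delta>
    assume lp: "line_polynomial m p" and r: "0 < r" and B: "\<forall>z\<in>cball c r. cmod (p z) \<le> B"
      and y: "y \<in> cball c r" and z: "norm (z - y) \<le> \<delta> * r" and \<delta>: "\<delta> \<le> 1"
    define v where "v = r *\<^sub>R sgn (z - y)"
    have v: "norm v \<le> r" using r by (simp add: v_def norm_sgn)
    have zv: "z = y + (norm (z - y) / r) *\<^sub>R v"
      using r by (cases "z = y") (auto simp: v_def sgn_div_norm)
    obtain a where a: "\<And>t. p (y + t *\<^sub>R v) = (\<Sum>k\<le>m. a k * complex_of_real t ^ k)"
      using lp unfolding line_polynomial_def by blast
    have "cmod (\<Sum>k\<le>m. a k * complex_of_real t ^ k) \<le> G * B" if "t \<in> {0..1}" for t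
    proof -
      have "t * norm v \<le> 1 * r" using that v by (intro mult_mono) auto
      then have "norm (y + t *\<^sub>R v - c) \<le> 2 * r"
        using norm_triangle_ineq[of "y - c" "t *\<^sub>R v"] y that
        by (simp add: dist_norm norm_minus_commute algebra_simps)
      then have "cmod (p (y + t *\<^sub>R v)) \<le> G * B"
        by (intro growth[OF lp r, of c]) (use B in auto)
      then show ?thesis using a by metis
    qed
    then have ak: "\<forall>k\<le>m. cmod (a k) \<le> K * (G * B)" by (rule coeff)
    have "cmod (p c) \<le> B" using B r by auto
    then have B0: "0 \<le> B" using norm_ge_zero order_trans by blast
    define \<theta> where "\<theta> = norm (z - y) / r"
    have t: "0 \<le> \<theta>" "\<theta> \<le> \<delta>" using z r by (auto simp: \<theta>_def divide_le_eq)
    then have \<delta>0: "0 \<le> \<delta>" by linarith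
    have "p z - p y = (\<Sum>k\<le>m. a k * complex_of_real \<theta> ^ k) - (\<Sum>k\<le>m. a k * complex_of_real 0 ^ k)"
      using a[of \<theta>] a[of 0] zv by (simp add: \<theta>_def)
    also have "\<dots> = (\<Sum>k\<le>m. a k * (complex_of_real \<theta> ^ k - 0 ^ k))"
      by (simp add: sum_subtractf right_diff_distrib)
    also have "cmod \<dots> \<le> (\<Sum>k\<le>m. K * (G * B) * \<delta>)"
    proof (rule sum_norm_le)
      fix k assume k: "k \<in> {..m}"
      have "cmod (complex_of_real \<theta> ^ k - 0 ^ k) \<le> \<delta>"
      proof (cases "k = 0")
        case True
        then show ?thesis using \<delta>0 by simp
      next
        case False
        then have "\<theta> ^ k \<le> \<theta> ^ 1" using t \<delta> by (intro power_decreasing) auto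
        then have "\<theta> ^ k \<le> \<delta>" using t by simp
        moreover have "cmod (complex_of_real \<theta> ^ k - 0 ^ k) = \<theta> ^ k"
          using False t(1) by (simp add: norm_power power_0_left)
        ultimately show ?thesis by simp
      qed
      then show "cmod (a k * (complex_of_real \<theta> ^ k - 0 ^ k)) \<le> K * (G * B) * \<delta>"
        unfolding norm_mult using ak k K G B0 by (intro mult_mono) auto
    qed
    finally show "cmod (p z - p y) \<le> real (m + 1) * (K * G) * \<delta> * B" by (simp add: mult_ac)
  qed
qed

text \<open>A set that is dense at scale \<open>\<delta> r\<close> in a ball of radius \<open>r\<close> determines the size of \<open>p\<close> on
  this ball: by the Lipschitz bound, the supremum of \<open>p\<close> exceeds its values on the set by at
  most half of the supremum. The growth bound then extends the estimate to points outside the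
  ball.\<close>

lemma line_polynomial_norming:
  "\<exists>\<delta>>0. \<exists>A\<ge>0. \<delta> \<le> 1 \<and> (\<forall>(p::'a::euclidean_space \<Rightarrow> complex) c r Z x \<eta>. line_polynomial m p \<longrightarrow> 0 < r \<longrightarrow>
    bounded (p ` cball c r) \<longrightarrow> (\<forall>y\<in>cball c r. \<exists>z\<in>Z. norm (z - y) \<le> \<delta> * r) \<longrightarrow>
    (\<forall>z\<in>Z. norm (z - c) \<le> 2 * r \<longrightarrow> cmod (p z) \<le> \<eta>) \<longrightarrow> norm (x - c) \<le> T * r \<longrightarrow> cmod (p x) \<le> A * \<eta>)"
proof -
  obtain L where L: "L \<ge> 0" and lip: "\<And>(p::'a \<Rightarrow> complex) c r B y z \<delta>. line_polynomial m p \<Longrightarrow> 0 < r \<Longrightarrow>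
    (\<And>z. z\<in>cball c r \<Longrightarrow> cmod (p z) \<le> B) \<Longrightarrow> y \<in> cball c r \<Longrightarrow> norm (z - y) \<le> \<delta> * r \<Longrightarrow> \<delta> \<le> 1 \<Longrightarrow>
    cmod (p z - p y) \<le> L * \<delta> * B"
    using line_polynomial_lipschitz[of m] by metis
  obtain G where G: "G \<ge> 0" and growth: "\<And>(p::'a \<Rightarrow> complex) c r B y. line_polynomial m p \<Longrightarrow> 0 < r \<Longrightarrow>
    (\<And>z. z\<in>cball c r \<Longrightarrow> cmod (p z) \<le> B) \<Longrightarrow> norm (y - c) \<le> T * r \<Longrightarrow> cmod (p y) \<le> G * B"
    using line_polynomial_growth[of m T] by metis
  \<comment> \<open>Moving by \<open>\<delta> r\<close> changes \<open>p\<close> by at most half of its supremum.\<close>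
  define \<delta> where "\<delta> = 1 / (2 * L + 1)"
  have \<delta>: "0 < \<delta>" "\<delta> \<le> 1" "L * \<delta> \<le> 1 / 2" using L by (auto simp: \<delta>_def field_simps)
  have main: "cmod (p x) \<le> 2 * G * \<eta>"
    if lp: "line_polynomial m p" and r: "0 < r" and bdd: "bounded (p ` cball c r)"
      and dense: "\<And>y. y\<in>cball c r \<Longrightarrow> \<exists>z\<in>Z. norm (z - y) \<le> \<delta> * r"
      and small: "\<And>z. z \<in> Z \<Longrightarrow> norm (z - c) \<le> 2 * r \<Longrightarrow> cmod (p z) \<le> \<eta>" and x: "norm (x - c) \<le> T * r"
    for p :: "'a \<Rightarrow> complex" and c r Z x \<eta>
  proof -
    define B where "B = (SUP y\<in>cball c r. cmod (p y))"
    have ba: "bdd_above ((\<lambda>y. cmod (p y)) ` cball c r)"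
      using bdd unfolding bounded_iff by (metis bdd_aboveI2 imageI)
    have pB: "cmod (p y) \<le> B" if "y \<in> cball c r" for y
      unfolding B_def by (rule cSUP_upper[OF that ba])
    have ne: "cball c r \<noteq> {}" using r by simp
    have B0: "0 \<le> B" using pB[of c] r norm_ge_zero[of "p c"]
      by (meson centre_in_cball less_imp_le order_trans)
    have "B \<le> \<eta> + B / 2"
      unfolding B_def
    proof (rule cSUP_least[OF ne], fold B_def)
      fix y assume y: "y \<in> cball c r"
      obtain z where z: "z \<in> Z" "norm (z - y) \<le> \<delta> * r" using dense[OF y] by blast
      have "\<delta> * r \<le> 1 * r" using \<delta> r by (intro mult_right_mono) auto
      then have "norm (z - c) \<le> 2 * r"
        using norm_triangle_ineq[of "z - y" "y - c"] z y by (simp add: dist_norm norm_minus_commute)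
      then have "cmod (p z) \<le> \<eta>" by (rule small[OF z(1)])
      moreover have "cmod (p z - p y) \<le> L * \<delta> * B"
        by (rule lip[OF lp r pB y z(2) \<delta>(2)])
      moreover have "L * \<delta> * B \<le> 1 / 2 * B" using \<delta>(3) B0 by (rule mult_right_mono)
      moreover have "cmod (p y) \<le> cmod (p z) + cmod (p z - p y)"
        using norm_triangle_ineq4[of "p z" "p z - p y"] by simp
      ultimately show "cmod (p y) \<le> \<eta> + B / 2" by linarith
    qed
    then have B: "B \<le> 2 * \<eta>" by simp
    have "cmod (p x) \<le> G * B" by (rule growth[OF lp r pB x])
    also have "\<dots> \<le> G * (2 * \<eta>)" by (rule mult_left_mono[OF B G])
    finally show ?thesis by simp
  qed
  show ?thesis
  proof (rule exI[of _ \<delta>], rule conjI[OF \<delta>(1)], rule exI[of _ "2 * G"], intro conjI \<delta>(2) allI impI)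
    show "0 \<le> 2 * G" using G by simp
    fix p :: "'a \<Rightarrow> complex" and c r Z x \<eta>
    assume "line_polynomial m p" "0 < r" "bounded (p ` cball c r)" "\<forall>y\<in>cball c r. \<exists>z\<in>Z. norm (z
        - y) \<le> \<delta> * r"
      "\<forall>z\<in>Z. norm (z - c) \<le> 2 * r \<longrightarrow> cmod (p z) \<le> \<eta>" "norm (x - c) \<le> T * r"
    then show "cmod (p x) \<le> 2 * G * \<eta>"
      by (intro main[where p = p and c = c and r = r and Z = Z and x = x and \<eta> = \<eta>]) auto
  qed
qed

section \<open>Interior cones\<close>

text \<open>Near a boundary point the centre of the ball is found by moving from \<open>x\<close> into the domain
  along \<open>- \<nu>\<close>, the direction away from the graph.\<close>

lemma lipschitz_domain_local_cone:
  fixes \<Omega> :: "'a::euclidean_space set"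
  assumes "bounded_lipschitz_domain \<Omega>" and p: "p \<in> closure \<Omega>"
  shows "\<exists>\<rho> \<kappa> \<tau>. 0 < \<rho> \<and> 0 < \<kappa> \<and> \<kappa> \<le> 1 \<and> 0 < \<tau> \<and>
    (\<forall>x\<in>\<Omega> \<inter> ball p \<rho>. \<forall>t. 0 < t \<and> t \<le> \<tau> \<longrightarrow> (\<exists>c. norm (x - c) \<le> t \<and> cball c (\<kappa> * t) \<subseteq> \<Omega>))"
proof -
  have "open \<Omega>" and lip: "lipschitz_boundary \<Omega>"
    using assms(1) by (auto simp: bounded_lipschitz_domain_def)
  show ?thesis
  proof (cases "p \<in> \<Omega>")
    case True
    then obtain e where e: "e > 0" "ball p e \<subseteq> \<Omega>" using \<open>open \<Omega>\<close> open_contains_ball by blast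
    have "cball x t \<subseteq> \<Omega>" if "x \<in> ball p (e / 2)" "t \<le> e / 4" for x t
    proof
      fix y assume "y \<in> cball x t"
      then have "dist p y < e" using that dist_triangle[of p y x] e(1) by (auto simp: dist_commute)
      then show "y \<in> \<Omega>" using e(2) by auto
    qed
    then have "\<exists>c. norm (x - c) \<le> t \<and> cball c (1 * t) \<subseteq> \<Omega>"
      if "x \<in> \<Omega> \<inter> ball p (e / 2)" "0 < t \<and> t \<le> e / 4" for x t
      using that by (intro exI[of _ x]) auto
    then show ?thesis using e(1)
      by (rule_tac exI[of _ "e / 2"], rule_tac exI[of _ 1], rule_tac exI[of _ "e / 4"]) simp
  next
    case False
    then have "p \<in> frontier \<Omega>" using p \<open>open \<Omega>\<close> by (simp add: frontier_def interior_open)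
    then obtain \<nu> r L \<gamma> where \<nu>: "norm \<nu> = 1" and r: "0 < r" and L: "L-lipschitz_on {z. z \<bullet> \<nu>
        = 0} \<gamma>"
      and eq: "\<Omega> \<inter> ball p r = {y \<in> ball p r. y \<bullet> \<nu> < \<gamma> (y - (y \<bullet> \<nu>) *\<^sub>R \<nu>)}"
      using lip unfolding lipschitz_boundary_def by blast
    have L0: "0 \<le> L" using L by (rule lipschitz_on_nonneg)
    \<comment> \<open>A displacement by \<open>\<kappa> t\<close> changes \<open>y \<bullet> \<nu>\<close> and \<open>\<gamma>\<close> by less than \<open>t\<close> together.\<close>
    define \<kappa> where "\<kappa> = 1 / (2 + L)"
    have \<kappa>: "0 < \<kappa>" "\<kappa> \<le> 1" "\<kappa> * (1 + L) < 1" using L0 by (auto simp: \<kappa>_def field_simps)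
    have \<nu>\<nu>: "\<nu> \<bullet> \<nu> = 1" using \<nu> by (simp add: norm_eq_1)
    \<comment> \<open>The bound \<open>t \<le> r / 8\<close> keeps the small ball inside \<open>ball p r\<close>.\<close>
    have "cball (x - t *\<^sub>R \<nu>) (\<kappa> * t) \<subseteq> \<Omega>" if x: "x \<in> \<Omega>" "x \<in> ball p (r / 2)" and t: "0 < t" "t
        \<le> r / 8" for x t
    proof
      fix y assume y: "y \<in> cball (x - t *\<^sub>R \<nu>) (\<kappa> * t)"
      define w where "w = y - (x - t *\<^sub>R \<nu>)"
      have w: "norm w \<le> \<kappa> * t" using y by (simp add: w_def dist_norm norm_minus_commute)
      have "\<kappa> * t \<le> 1 * t" using \<kappa> t by (intro mult_right_mono) auto
      then have wt: "norm w \<le> t" using w by simp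
      have yw: "y = x - t *\<^sub>R \<nu> + w" by (simp add: w_def)
      have "norm (w - t *\<^sub>R \<nu>) \<le> norm w + t"
        using norm_triangle_ineq4[of w "t *\<^sub>R \<nu>"] \<nu> t by simp
      then have "dist x y \<le> 2 * t" using wt by (simp add: yw dist_norm norm_minus_commute)
      then have yp: "y \<in> ball p r" using x(2) t dist_triangle[of p y x] r
        by (simp add: dist_commute)
      have xp: "x \<in> \<Omega> \<inter> ball p r" using x r by auto
      let ?P = "\<lambda>z. z - (z \<bullet> \<nu>) *\<^sub>R \<nu>"
      have Pin: "?P z \<in> {z. z \<bullet> \<nu> = 0}" for z by (simp add: inner_diff_left \<nu>\<nu>)
      have "?P y = ?P x + ?P w" by (simp add: yw inner_add_left inner_diff_left \<nu>\<nu> algebra_simps)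
      moreover have "norm (?P w) \<le> norm w"
      proof -
        have "(norm (?P w))\<^sup>2 = (norm w)\<^sup>2 - (w \<bullet> \<nu>)\<^sup>2"
          unfolding power2_norm_eq_inner
          by (simp add: inner_diff_left inner_diff_right \<nu>\<nu> inner_commute power2_eq_square
              algebra_simps)
        then have "(norm (?P w))\<^sup>2 \<le> (norm w)\<^sup>2" by simp
        then show ?thesis by (rule power2_le_imp_le) simp
      qed
      ultimately have "dist (?P x) (?P y) \<le> \<kappa> * t" using w
        by (simp add: dist_norm norm_minus_commute)
      moreover have "dist (\<gamma> (?P x)) (\<gamma> (?P y)) \<le> L * dist (?P x) (?P y)"
        by (rule lipschitz_onD[OF L Pin Pin])
      ultimately have "\<bar>\<gamma> (?P x) - \<gamma> (?P y)\<bar> \<le> L * (\<kappa> * t)"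
        using L0 by (metis dist_real_def mult_left_mono order_trans)
      moreover have "x \<bullet> \<nu> < \<gamma> (?P x)" using xp unfolding eq by simp
      moreover have "y \<bullet> \<nu> = x \<bullet> \<nu> - t + w \<bullet> \<nu>" by (simp add: yw inner_add_left inner_diff_left \<nu>\<nu>)
      moreover have "w \<bullet> \<nu> \<le> \<kappa> * t"
        using Cauchy_Schwarz_ineq2[of w \<nu>] w \<nu> by simp
      moreover have "\<kappa> * t + L * (\<kappa> * t) < t"
        using mult_strict_right_mono[OF \<kappa>(3) t(1)] by (simp add: algebra_simps)
      ultimately have "y \<bullet> \<nu> < \<gamma> (?P y)" by linarith
      then have "y \<in> \<Omega> \<inter> ball p r" unfolding eq using yp by simp
      then show "y \<in> \<Omega>" by simp
    qed
    moreover have "norm (x - (x - t *\<^sub>R \<nu>)) \<le> t" if "0 < t" for x t using \<nu> that by simp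
    ultimately have "\<exists>c. norm (x - c) \<le> t \<and> cball c (\<kappa> * t) \<subseteq> \<Omega>"
      if "x \<in> \<Omega> \<inter> ball p (r / 2)" "0 < t \<and> t \<le> r / 8" for x t
      using that by (intro exI[of _ "x - t *\<^sub>R \<nu>"]) auto
    then show ?thesis using r \<kappa>(1,2)
      by (rule_tac exI[of _ "r / 2"], rule_tac exI[of _ \<kappa>], rule_tac exI[of _ "r / 8"]) simp
  qed
qed

text \<open>The interior cone property in the form in which it is used: at every scale \<open>t\<close> there is a
  ball in the domain whose radius and whose distance from \<open>x\<close> are comparable to \<open>t\<close>. Constants
  that work for all \<open>x\<close> result from compactness of the closure.\<close>

lemma lipschitz_domain_cone:
  fixes \<Omega> :: "'a::euclidean_space set"
  assumes dom: "bounded_lipschitz_domain \<Omega>"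
  shows "\<exists>\<kappa> \<tau>. 0 < \<kappa> \<and> \<kappa> \<le> 1 \<and> 0 < \<tau> \<and>
    (\<forall>x\<in>\<Omega>. \<forall>t. 0 < t \<and> t \<le> \<tau> \<longrightarrow> (\<exists>c. norm (x - c) \<le> t \<and> cball c (\<kappa> * t) \<subseteq> \<Omega>))"
proof -
  obtain \<rho> \<kappa> \<tau> where loc: "\<And>p. p \<in> closure \<Omega> \<Longrightarrow> 0 < \<rho> p \<and> 0 < \<kappa> p \<and> \<kappa> p \<le> 1 \<and> 0 < \<tau> p \<and>
    (\<forall>x\<in>\<Omega> \<inter> ball p (\<rho> p). \<forall>t. 0 < t \<and> t \<le> \<tau> p \<longrightarrow> (\<exists>c. norm (x - c) \<le> t \<and> cball c (\<kappa> p * t) \<subseteq> \<Omega>))"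
    using lipschitz_domain_local_cone[OF dom] by metis
  have "compact (closure \<Omega>)" using dom by (simp add: bounded_lipschitz_domain_def compact_closure)
  moreover have "closure \<Omega> \<subseteq> (\<Union>p\<in>closure \<Omega>. ball p (\<rho> p))" using loc by force
  ultimately obtain F where F: "F \<subseteq> closure \<Omega>" "finite F" "closure \<Omega> \<subseteq> (\<Union>p\<in>F. ball p (\<rho> p))"
    using compactE_image[of "closure \<Omega>" "closure \<Omega>" "\<lambda>p. ball p (\<rho> p)"] that by (metis open_ball)
  have "\<Omega> \<noteq> {}" using dom by (simp add: bounded_lipschitz_domain_def)
  then have "F \<noteq> {}" using F(3) closure_subset by fastforce
  define k where "k = Min (\<kappa> ` F)"
  define T where "T = Min (\<tau> ` F)"
  have k: "0 < k" "k \<le> 1" "\<And>p. p \<in> F \<Longrightarrow> k \<le> \<kappa> p" and T: "0 < T" "\<And>p. p \<in> F \<Longrightarrow> T \<le> \<tau> p"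
    using F \<open>F \<noteq> {}\<close> loc unfolding k_def T_def by (auto simp: Min_le_iff subset_iff)
  have "\<exists>c. norm (x - c) \<le> t \<and> cball c (k * t) \<subseteq> \<Omega>" if x: "x \<in> \<Omega>" and t: "0 < t" "t \<le> T" for x t
  proof -
    obtain p where p: "p \<in> F" "x \<in> ball p (\<rho> p)" using F(3) x closure_subset by blast
    then have "t \<le> \<tau> p" using t T(2)[OF p(1)] by linarith
    then obtain c where c: "norm (x - c) \<le> t" "cball c (\<kappa> p * t) \<subseteq> \<Omega>" using loc[of p] F(1) p x t
      by blast
    have "k * t \<le> \<kappa> p * t" using k(3)[OF p(1)] t by (intro mult_right_mono) auto
    then show ?thesis using c by (meson cball_subset_cball_iff order_trans subset_cball)
  qed
  then show ?thesis using k T by blast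
qed

section \<open>The sampling inequality\<close>

text \<open>The rescaled weight integrates to \<open>h\<^sup>-\<^sup>n\<close> times the integral of the weight, so that the
  Cauchy-Schwarz inequality produces \<open>h\<close> to the power \<open>s - n/2\<close>. This is the only source of
  the convergence order.\<close>

lemma scaled_multiplier_bound:
  fixes g :: "'a::euclidean_space \<Rightarrow> complex"
  assumes g: "sobolev_data s g" and s: "s > real DIM('a) / 2" and h: "0 < h"
    and m[measurable]: "\<mu> \<in> borel_measurable borel" and "0 \<le> A"
    and le: "\<And>\<omega>. (\<mu> \<omega>)\<^sup>2 * weight (- s) \<omega> \<le> A * h powr (2 * s) * weight (- s) (h *\<^sub>R \<omega>)"
  shows "integrable lborel (\<lambda>\<omega>. complex_of_real (\<mu> \<omega>) * g \<omega>)"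
    and "(\<integral>\<omega>. \<bar>\<mu> \<omega>\<bar> * cmod (g \<omega>) \<partial>lborel) \<le>
      sqrt A * embedding_const TYPE('a) s * h powr (s - real DIM('a) / 2) * data_norm s g"
proof -
  let ?n = "real DIM('a)"
  have wi: "integrable lborel (\<lambda>\<omega>::'a. weight (- s) (h *\<^sub>R \<omega>))"
    using lborel_integrable_affine_iff[of h "weight (- s) :: 'a \<Rightarrow> real" 0] h weight_integrable[OF
        s] by simp
  have w: "(\<integral>\<omega>. weight (- s) \<omega> \<partial>(lborel :: 'a measure))
      = h ^ DIM('a) * (\<integral>\<omega>. weight (- s) (h *\<^sub>R \<omega>) \<partial>(lborel :: 'a measure))"
    using lborel_integral_affine[of h "weight (- s) :: 'a \<Rightarrow> real" 0] h by simp
  have i: "integrable lborel (\<lambda>\<omega>::'a. (\<mu> \<omega>)\<^sup>2 * weight (- s) \<omega>)"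
  proof (rule Bochner_Integration.integrable_bound)
    show "integrable lborel (\<lambda>\<omega>::'a. A * h powr (2 * s) * weight (- s) (h *\<^sub>R \<omega>))" using wi by simp
    show "AE \<omega> in lborel. norm ((\<mu> \<omega>)\<^sup>2 * weight (- s) \<omega>)
        \<le> norm (A * h powr (2 * s) * weight (- s) (h *\<^sub>R \<omega>))"
      using le \<open>0 \<le> A\<close> by (intro AE_I2) (simp add: abs_mult)
  qed measurable
  note r = sobolev_data_multiplier_integrable[OF g m i]
  show "integrable lborel (\<lambda>\<omega>. complex_of_real (\<mu> \<omega>) * g \<omega>)" by (rule r(1))
  have "(\<integral>\<omega>. (\<mu> \<omega>)\<^sup>2 * weight (- s) \<omega> \<partial>lborel) \<le> (\<integral>\<omega>. A * h powr (2 * s) * weight (- s) (h *\<^sub>R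
      \<omega>) \<partial>(lborel :: 'a measure))"
  proof (rule integral_mono[OF i])
    show "integrable lborel (\<lambda>\<omega>::'a. A * h powr (2 * s) * weight (- s) (h *\<^sub>R \<omega>))" using wi by simp
  qed (rule le)
  also have "\<dots> = A * h powr (2 * s) * (\<integral>\<omega>. weight (- s) (h *\<^sub>R \<omega>) \<partial>(lborel :: 'a measure))" by simp
  also have "\<dots> = A * (h powr (s - ?n / 2))\<^sup>2 * (embedding_const TYPE('a) s)\<^sup>2"
  proof -
    have "0 \<le> integral\<^sup>L lborel (weight (- s) :: 'a \<Rightarrow> real)" by simp
    then have "(embedding_const TYPE('a) s)\<^sup>2 = h ^ DIM('a) * (\<integral>\<omega>. weight (- s) (h *\<^sub>R \<omega>) \<partial>(lborel
        :: 'a measure))"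
      using w by (simp add: embedding_const_def)
    moreover have "(h powr (s - ?n / 2))\<^sup>2 * h ^ DIM('a) = h powr (2 * s)"
      using h by (simp add: powr_realpow[symmetric] powr_powr powr_add[symmetric] algebra_simps)
    ultimately show ?thesis by (metis mult.assoc)
  qed
  finally have "sqrt (\<integral>\<omega>. (\<mu> \<omega>)\<^sup>2 * weight (- s) \<omega> \<partial>lborel)
      \<le> sqrt A * h powr (s - ?n / 2) * embedding_const TYPE('a) s"
    by (intro real_le_lsqrt) (auto simp: power_mult_distrib \<open>0 \<le> A\<close>)
  then have "sqrt (\<integral>\<omega>. (\<mu> \<omega>)\<^sup>2 * weight (- s) \<omega> \<partial>lborel) * data_norm s g
     \<le> sqrt A * h powr (s - ?n / 2) * embedding_const TYPE('a) s * data_norm s g"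
    by (rule mult_right_mono) simp
  with r(2) show "(\<integral>\<omega>. \<bar>\<mu> \<omega>\<bar> * cmod (g \<omega>) \<partial>lborel) \<le>
      sqrt A * embedding_const TYPE('a) s * h powr (s - ?n / 2) * data_norm s g"
    by (simp add: mult_ac)
qed

text \<open>The factor \<open>h powr (2 * s) * weight (- s) (h *\<^sub>R \<omega>)\<close> equals
  \<open>(1 / h\<^sup>2 + (norm \<omega>)\<^sup>2) powr (- s)\<close>.\<close>

lemma scaled_weight_lower_bound:
  fixes \<omega> :: "'a::euclidean_space"
  assumes h: "0 < h" and s: "0 \<le> s" and q: "1 / h\<^sup>2 + (norm \<omega>)\<^sup>2 \<le> 2 * q"
  shows "q powr (- s) \<le> 2 powr s * h powr (2 * s) * weight (- s) (h *\<^sub>R \<omega>)"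
proof -
  have p: "0 < 1 / h\<^sup>2 + (norm \<omega>)\<^sup>2" using h by (intro add_pos_nonneg) auto
  have "h\<^sup>2 * (1 / h\<^sup>2 + (norm \<omega>)\<^sup>2) = 1 + (norm (h *\<^sub>R \<omega>))\<^sup>2"
    using h by (simp add: power_mult_distrib field_simps)
  then have "weight (- s) (h *\<^sub>R \<omega>) = (h\<^sup>2) powr (- s) * (1 / h\<^sup>2 + (norm \<omega>)\<^sup>2) powr (- s)"
    unfolding weight_def by (metis powr_mult)
  also have "(h\<^sup>2) powr (- s) = h powr (- (2 * s))"
    using h powr_powr[of h 2 "- s"] by simp
  finally have "h powr (2 * s) * weight (- s) (h *\<^sub>R \<omega>) = (1 / h\<^sup>2 + (norm \<omega>)\<^sup>2) powr (- s)"
    using h by (simp add: powr_minus)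
  moreover have "(2 * q) powr (- s) \<le> (1 / h\<^sup>2 + (norm \<omega>)\<^sup>2) powr (- s)"
    using p q s by (intro powr_mono2') auto
  moreover have "2 powr s * (2 * q) powr (- s) = q powr (- s)"
    by (simp add: powr_mult powr_minus)
  ultimately show ?thesis
    by (metis mult.assoc mult_left_mono powr_ge_zero)
qed

text \<open>For \<open>h \<bar>\<omega>\<bar> > 1\<close> the term \<open>1 / h\<^sup>2\<close> in the rescaled weight is at most \<open>\<bar>\<omega>\<bar>\<^sup>2\<close>.\<close>

lemma high_frequency_multiplier:
  fixes \<omega> :: "'a::euclidean_space"
  assumes h: "0 < h" and s: "0 \<le> s"
  defines "\<mu> \<equiv> if h * norm \<omega> \<le> 1 then 0 else 1"
  shows "\<mu>\<^sup>2 * weight (- s) \<omega> \<le> 2 powr s * h powr (2 * s) * weight (- s) (h *\<^sub>R \<omega>)"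
proof (cases "h * norm \<omega> \<le> 1")
  case True
  then show ?thesis by (simp add: \<mu>_def)
next
  case False
  then have "1 / h \<le> norm \<omega>" using h by (simp add: field_simps)
  then have "(1 / h)\<^sup>2 \<le> (norm \<omega>)\<^sup>2" using h by (intro power_mono) auto
  then have "1 / h\<^sup>2 + (norm \<omega>)\<^sup>2 \<le> 2 * (1 + (norm \<omega>)\<^sup>2)" by (simp add: power_divide)
  from scaled_weight_lower_bound[OF h s this] show ?thesis
    using False by (simp add: \<mu>_def) (simp add: weight_def)
qed

text \<open>For \<open>h \<bar>\<omega>\<bar> \<le> 1\<close> the power \<open>(h \<bar>\<omega>\<bar>)\<^sup>m\<^sup>+\<^sup>1\<close> from the Taylor remainder compensates the
  growth of the weight relative to its rescaled version, because \<open>m + 1 \<ge> s\<close>.\<close>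

lemma low_frequency_multiplier:
  fixes \<omega> :: "'a::euclidean_space"
  assumes h: "0 < h" and s: "0 < s" and m: "s \<le> real (Suc m)"
  defines "\<mu> \<equiv> if h * norm \<omega> \<le> 1 then (h * norm \<omega>) ^ Suc m else 0"
  shows "\<mu>\<^sup>2 * weight (- s) \<omega> \<le> 2 powr s * h powr (2 * s) * weight (- s) (h *\<^sub>R \<omega>)"
proof (cases "h * norm \<omega> \<le> 1 \<and> \<omega> \<noteq> 0")
  case False
  then show ?thesis using s by (auto simp: \<mu>_def)
next
  case True
  define \<tau> where "\<tau> = h * norm \<omega>"
  have \<tau>: "0 < \<tau>" "\<tau> \<le> 1" using True h by (auto simp: \<tau>_def)
  have n: "0 < norm \<omega>" using True by simp
  have "norm \<omega> \<le> 1 / h" using \<tau> h by (simp add: \<tau>_def field_simps)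
  then have "(norm \<omega>)\<^sup>2 \<le> (1 / h)\<^sup>2" by (intro power_mono) auto
  then have le: "1 / h\<^sup>2 + (norm \<omega>)\<^sup>2 \<le> 2 * (1 / h\<^sup>2)" by (simp add: power_divide)
  have "weight (- s) \<omega> \<le> ((norm \<omega>)\<^sup>2) powr (- s)"
    unfolding weight_def using n s by (intro powr_mono2') auto
  also have "((norm \<omega>)\<^sup>2) powr (- s) = norm \<omega> powr (- (2 * s))"
    using n powr_powr[of "norm \<omega>" 2 "- s"] by simp
  finally have w: "weight (- s) \<omega> \<le> norm \<omega> powr (- (2 * s))" .
  have "\<mu>\<^sup>2 = \<tau> powr (2 * real (Suc m))"
  proof -
    have "\<mu>\<^sup>2 = \<tau> ^ (2 * Suc m)"
      using True by (simp add: \<mu>_def \<tau>_def power_mult[symmetric] mult.commute[of 2] del: power_Suc)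
    also have "\<dots> = \<tau> powr real (2 * Suc m)" using \<tau> by (intro powr_realpow[symmetric])
    finally show ?thesis by (simp only: of_nat_mult of_nat_numeral)
  qed
  also have "\<dots> \<le> \<tau> powr (2 * s)" using \<tau> m by (intro powr_mono') auto
  also have "\<dots> = h powr (2 * s) * norm \<omega> powr (2 * s)"
    unfolding \<tau>_def using h by (simp add: powr_mult)
  finally have "\<mu>\<^sup>2 * weight (- s) \<omega> \<le> h powr (2 * s) * norm \<omega> powr (2 * s) * norm \<omega> powr (- (2 *
      s))"
    using w by (intro mult_mono) auto
  also have "\<dots> = h powr (2 * s)" using n by (simp add: powr_minus)
  also have "\<dots> = (1 / h\<^sup>2) powr (- s)"
  proof -
    have "(1 / h\<^sup>2) powr (- s) = (h\<^sup>2) powr s" using h by (simp add: powr_minus powr_divide)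
    also have "\<dots> = h powr (2 * s)" using h powr_powr[of h 2 s] by simp
    finally show ?thesis ..
  qed
  also have "\<dots> \<le> 2 powr s * h powr (2 * s) * weight (- s) (h *\<^sub>R \<omega>)"
    using scaled_weight_lower_bound[OF h _ le] s by simp
  finally show ?thesis .
qed

definition low_pass :: "real \<Rightarrow> ('a::euclidean_space \<Rightarrow> complex) \<Rightarrow> 'a \<Rightarrow> complex" where
  "low_pass h g \<omega> = (if h * norm \<omega> \<le> 1 then g \<omega> else 0)"

text \<open>The Taylor polynomial at \<open>x\<close> of the low-frequency part of \<open>ift g\<close>, obtained by expanding the
  exponential under the integral.\<close>

definition taylor_low_pass :: "nat \<Rightarrow> real \<Rightarrow> ('a::euclidean_space \<Rightarrow> complex) \<Rightarrow> 'a \<Rightarrow> 'a \<Rightarrow> complex"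
    where
  "taylor_low_pass m h g x y = ift (\<lambda>\<omega>. low_pass h g \<omega> *
     (\<Sum>k\<le>m. (\<i> * complex_of_real ((y - x) \<bullet> \<omega>)) ^ k / fact k)) x"

lemma low_pass_mult_integrable:
  fixes g :: "'a::euclidean_space \<Rightarrow> complex"
  assumes g: "integrable lborel g" and h: "0 < h" and Q: "continuous_on UNIV Q"
  shows "integrable lborel (\<lambda>\<omega>. low_pass h g \<omega> * Q \<omega>)"
proof -
  have [measurable]: "g \<in> borel_measurable borel" using g by auto
  have [measurable]: "Q \<in> borel_measurable borel" by (rule borel_measurable_continuous_onI[OF Q])
  have "compact (Q ` cball 0 (1 / h))"
    by (intro compact_continuous_image continuous_on_subset[OF Q]) auto
  then have "bounded (Q ` cball 0 (1 / h))" by (rule compact_imp_bounded)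
  then obtain B where "\<forall>z\<in>Q ` cball 0 (1 / h). cmod z \<le> B" unfolding bounded_iff by (rule exE)
  then have B: "\<And>\<omega>. \<omega> \<in> cball 0 (1 / h) \<Longrightarrow> cmod (Q \<omega>) \<le> B" by blast
  show ?thesis
  proof (rule Bochner_Integration.integrable_bound)
    show "integrable lborel (\<lambda>\<omega>. B * cmod (g \<omega>))" using g by auto
    show "(\<lambda>\<omega>. low_pass h g \<omega> * Q \<omega>) \<in> borel_measurable lborel" unfolding low_pass_def by measurable
    have "cmod (low_pass h g \<omega> * Q \<omega>) \<le> norm (B * cmod (g \<omega>))" for \<omega>
    proof (cases "h * norm \<omega> \<le> 1")
      case True
      then have "\<omega> \<in> cball 0 (1 / h)" using h by (simp add: field_simps)
      then have "cmod (Q \<omega>) \<le> \<bar>B\<bar>" using B by fastforce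
      then show ?thesis using True by (simp add: low_pass_def norm_mult abs_mult mult.commute
          mult_right_mono)
    qed (simp add: low_pass_def)
    then show "AE \<omega> in lborel. cmod (low_pass h g \<omega> * Q \<omega>) \<le> norm (B * cmod (g \<omega>))" by simp
  qed
qed

text \<open>By the binomial theorem the integrand is a polynomial in the parameter of the line, with
  coefficients that are integrable because frequencies are bounded by \<open>1 / h\<close>.\<close>

lemma line_polynomial_taylor_low_pass:
  fixes g :: "'a::euclidean_space \<Rightarrow> complex"
  assumes g: "integrable lborel g" and h: "0 < h"
  shows "line_polynomial m (taylor_low_pass m h g x)"
  unfolding line_polynomial_def
proof (intro allI)
  fix x0 v :: 'a
  define \<alpha> where "\<alpha> \<omega> = \<i> * complex_of_real ((x0 - x) \<bullet> \<omega>)" for \<omega>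
  define \<beta> where "\<beta> \<omega> = \<i> * complex_of_real (v \<bullet> \<omega>)" for \<omega>
  define Q where "Q j \<omega> = (\<Sum>k\<le>m. of_nat (k choose j) * \<beta> \<omega> ^ j * \<alpha> \<omega> ^ (k - j) / fact k)" for j \<omega>
  define a where "a j = ift (\<lambda>\<omega>. low_pass h g \<omega> * Q j \<omega>) x" for j
  have Q: "continuous_on UNIV (Q j)" for j
    unfolding Q_def \<alpha>_def \<beta>_def by (intro continuous_intros) auto
  have i: "integrable lborel (\<lambda>\<omega>. low_pass h g \<omega> * Q j \<omega> * cis (x \<bullet> \<omega>))" for j
    by (intro integrable_mult_cis low_pass_mult_integrable g h Q) measurable
  have expand: "(\<Sum>k\<le>m. (\<i> * complex_of_real ((x0 + t *\<^sub>R v - x) \<bullet> \<omega>)) ^ k / fact k) =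
      (\<Sum>j\<le>m. Q j \<omega> * complex_of_real t ^ j)" for t \<omega>
  proof -
    have e: "\<i> * complex_of_real ((x0 + t *\<^sub>R v - x) \<bullet> \<omega>) = complex_of_real t * \<beta> \<omega> + \<alpha> \<omega>"
      by (simp add: \<alpha>_def \<beta>_def inner_add_left inner_diff_left algebra_simps)
    have "(complex_of_real t * \<beta> \<omega> + \<alpha> \<omega>) ^ k / fact k =
        (\<Sum>j\<le>m. of_nat (k choose j) * \<beta> \<omega> ^ j * \<alpha> \<omega> ^ (k - j) / fact k * complex_of_real t ^ j)"
            if "k \<le> m" for k
    proof -
      have "(complex_of_real t * \<beta> \<omega> + \<alpha> \<omega>) ^ k =
          (\<Sum>j\<le>k. of_nat (k choose j) * (complex_of_real t * \<beta> \<omega>) ^ j * \<alpha> \<omega> ^ (k - j))"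
        by (rule binomial_ring)
      also have "\<dots> = (\<Sum>j\<le>m. of_nat (k choose j) * (complex_of_real t * \<beta> \<omega>) ^ j * \<alpha> \<omega> ^ (k - j))"
        by (rule sum.mono_neutral_left) (use that in \<open>auto simp: not_le binomial_eq_0\<close>)
      finally show ?thesis
        by (simp add: sum_divide_distrib power_mult_distrib mult_ac)
    qed
    then have "(\<Sum>k\<le>m. (complex_of_real t * \<beta> \<omega> + \<alpha> \<omega>) ^ k / fact k) =
        (\<Sum>k\<le>m. \<Sum>j\<le>m. of_nat (k choose j) * \<beta> \<omega> ^ j * \<alpha> \<omega> ^ (k - j) / fact k * complex_of_real t ^
            j)"
      by (intro sum.cong) auto
    also have "\<dots> = (\<Sum>j\<le>m. Q j \<omega> * complex_of_real t ^ j)"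
      unfolding Q_def by (subst sum.swap) (simp add: sum_distrib_right)
    finally show ?thesis unfolding e .
  qed
  have "taylor_low_pass m h g x (x0 + t *\<^sub>R v) = (\<Sum>j\<le>m. a j * complex_of_real t ^ j)" for t
  proof -
    have "(\<integral>\<omega>. low_pass h g \<omega> * (\<Sum>j\<le>m. Q j \<omega> * complex_of_real t ^ j) * cis (x \<bullet> \<omega>) \<partial>lborel) =
        (\<integral>\<omega>. (\<Sum>j\<le>m. low_pass h g \<omega> * Q j \<omega> * cis (x \<bullet> \<omega>) * complex_of_real t ^ j) \<partial>lborel)"
      by (simp add: sum_distrib_left sum_distrib_right mult_ac)
    also have "\<dots> = (\<Sum>j\<le>m. \<integral>\<omega>. low_pass h g \<omega> * Q j \<omega> * cis (x \<bullet> \<omega>) * complex_of_real t ^ j \<partial>lborel)"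
      by (intro Bochner_Integration.integral_sum integrable_mult_left i)
    also have "\<dots> = (\<Sum>j\<le>m. (\<integral>\<omega>. low_pass h g \<omega> * Q j \<omega> * cis (x \<bullet> \<omega>) \<partial>lborel) * complex_of_real t ^
        j)"
      by simp
    finally show ?thesis
      unfolding taylor_low_pass_def expand by (simp add: ift_def a_def scaleR_sum_right)
  qed
  then show "\<exists>a. \<forall>t. taylor_low_pass m h g x (x0 + t *\<^sub>R v) = (\<Sum>k\<le>m. a k * complex_of_real t ^ k)"
    by blast
qed

text \<open>Both errors are integrals of \<open>\<bar>g\<bar>\<close> against a multiplier of the kind treated above: the Taylor
  remainder of the exponential below the frequency \<open>1 / h\<close>, and the constant 1 beyond it.\<close>

lemma taylor_low_pass_error:
  fixes g :: "'a::euclidean_space \<Rightarrow> complex"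
  assumes g: "sobolev_data s g" and s: "s > real DIM('a) / 2" and h: "0 < h"
      and m: "s \<le> real (Suc m)"
  defines "\<epsilon> \<equiv> (2 * pi) powr (- real DIM('a) / 2) *
    (sqrt (2 powr s) * embedding_const TYPE('a) s * h powr (s - real DIM('a) / 2) * data_norm s g)"
  shows "cmod (ift (low_pass h g) y - taylor_low_pass m h g x y) \<le> (norm (y - x) / h) ^ Suc m * \<epsilon>"
    and "cmod (ift g y - ift (low_pass h g) y) \<le> \<epsilon>"
proof -
  let ?c = "(2 * pi) powr (- real DIM('a) / 2)"
  have s0: "0 < s" using s order_le_less_trans[of 0 "real DIM('a) / 2" s] by simp
  note [measurable] = sobolev_data_measurable[OF g]
  have gi: "integrable lborel g" by (rule sobolev_data_integrable[OF g s])
  have li: "integrable lborel (low_pass h g)"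
    using low_pass_mult_integrable[OF gi h continuous_on_const[of UNIV 1]] by simp
  define mu where "mu \<omega> = (if h * norm \<omega> \<le> 1 then (h * norm \<omega>) ^ Suc m else 0)" for \<omega> :: 'a
  define nu where "nu \<omega> = (if h * norm \<omega> \<le> 1 then 0 else 1 :: real)" for \<omega> :: 'a
  have [measurable]: "mu \<in> borel_measurable borel" "nu \<in> borel_measurable borel"
    unfolding mu_def nu_def by measurable
  have mu0: "0 \<le> mu \<omega>" for \<omega> using h by (simp add: mu_def)
  have mu_le: "(mu \<omega>)\<^sup>2 * weight (- s) \<omega> \<le> 2 powr s * h powr (2 * s) * weight (- s) (h *\<^sub>R \<omega>)"
      for \<omega> :: 'a
    unfolding mu_def by (rule low_frequency_multiplier[OF h s0 m])
  have nu_le: "(nu \<omega>)\<^sup>2 * weight (- s) \<omega> \<le> 2 powr s * h powr (2 * s) * weight (- s) (h *\<^sub>R \<omega>)"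
      for \<omega> :: 'a
    unfolding nu_def by (rule high_frequency_multiplier[OF h less_imp_le[OF s0]])
  have mu_b: "integrable lborel (\<lambda>\<omega>. complex_of_real (mu \<omega>) * g \<omega>)"
    "?c * (\<integral>\<omega>. \<bar>mu \<omega>\<bar> * cmod (g \<omega>) \<partial>lborel) \<le> \<epsilon>"
    using scaled_multiplier_bound[OF g s h _ _ mu_le] by (auto simp: \<epsilon>_def intro!: mult_left_mono)
  have nu_b: "?c * (\<integral>\<omega>. \<bar>nu \<omega>\<bar> * cmod (g \<omega>) \<partial>lborel) \<le> \<epsilon>"
    using scaled_multiplier_bound[OF g s h _ _ nu_le] by (auto simp: \<epsilon>_def intro!: mult_left_mono)
  have mu_i: "integrable lborel (\<lambda>\<omega>. mu \<omega> * cmod (g \<omega>))"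
    using integrable_norm[OF mu_b(1)] mu0 by (simp add: norm_mult)
  have "ift g y - ift (low_pass h g) y = ift (\<lambda>\<omega>. g \<omega> - low_pass h g \<omega>) y"
    by (rule ift_diff[OF gi li, symmetric])
  moreover have "cmod (g \<omega> - low_pass h g \<omega>) = \<bar>nu \<omega>\<bar> * cmod (g \<omega>)" for \<omega>
    by (simp add: low_pass_def nu_def)
  ultimately show "cmod (ift g y - ift (low_pass h g) y) \<le> \<epsilon>"
    using ift_bound[of "\<lambda>\<omega>. g \<omega> - low_pass h g \<omega>" y] nu_b by simp
  define P where "P \<omega> = (\<Sum>k\<le>m. (\<i> * complex_of_real ((y - x) \<bullet> \<omega>)) ^ k / fact k)" for \<omega>
  have Pc: "continuous_on UNIV P" unfolding P_def by (intro continuous_intros) auto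
  have i1: "integrable lborel (\<lambda>\<omega>. low_pass h g \<omega> * cis (y \<bullet> \<omega>))"
    by (intro integrable_mult_cis li) measurable
  have i2: "integrable lborel (\<lambda>\<omega>. low_pass h g \<omega> * P \<omega> * cis (x \<bullet> \<omega>))"
    by (intro integrable_mult_cis low_pass_mult_integrable gi h Pc) measurable
  let ?q = "(norm (y - x) / h) ^ Suc m"
  have bound: "cmod (low_pass h g \<omega> * cis (y \<bullet> \<omega>) - low_pass h g \<omega> * P \<omega> * cis (x \<bullet> \<omega>))
      \<le> ?q * (mu \<omega> * cmod (g \<omega>))" for \<omega>
  proof (cases "h * norm \<omega> \<le> 1")
    case False
    then show ?thesis by (simp add: low_pass_def mu_def)
  next
    case True
    have "cis (y \<bullet> \<omega>) = cis (x \<bullet> \<omega>) * cis ((y - x) \<bullet> \<omega>)" by (simp add: cis_mult inner_diff_left)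
    then have "low_pass h g \<omega> * cis (y \<bullet> \<omega>) - low_pass h g \<omega> * P \<omega> * cis (x \<bullet> \<omega>) =
        cis (x \<bullet> \<omega>) * (g \<omega> * (cis ((y - x) \<bullet> \<omega>) - P \<omega>))"
      using True by (simp add: low_pass_def algebra_simps)
    then have "cmod (low_pass h g \<omega> * cis (y \<bullet> \<omega>) - low_pass h g \<omega> * P \<omega> * cis (x \<bullet> \<omega>)) =
        cmod (cis ((y - x) \<bullet> \<omega>) - P \<omega>) * cmod (g \<omega>)" by (simp add: norm_mult)
    also have "cmod (cis ((y - x) \<bullet> \<omega>) - P \<omega>) \<le> \<bar>(y - x) \<bullet> \<omega>\<bar> ^ Suc m / fact (Suc m)"
      unfolding P_def by (rule cis_taylor)
    also have "\<dots> \<le> \<bar>(y - x) \<bullet> \<omega>\<bar> ^ Suc m / 1"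
      by (intro divide_left_mono) (auto simp: fact_ge_1 simp del: fact_Suc)
    also have "\<dots> \<le> (norm (y - x) * norm \<omega>) ^ Suc m" using Cauchy_Schwarz_ineq2[of "y - x" \<omega>]
      unfolding div_by_1 by (intro power_mono) auto
    also have "\<dots> = ?q * mu \<omega>"
      using True h by (simp add: mu_def power_mult_distrib[symmetric] del: power_Suc)
    finally show ?thesis by (simp add: mult_right_mono mult.assoc)
  qed
  have "ift (low_pass h g) y - taylor_low_pass m h g x y =
      ?c *\<^sub>R (\<integral>\<omega>. low_pass h g \<omega> * cis (y \<bullet> \<omega>) - low_pass h g \<omega> * P \<omega> * cis (x \<bullet> \<omega>) \<partial>lborel)"
    unfolding taylor_low_pass_def P_def[symmetric] ift_def
    using i1 i2 by (simp add: scaleR_diff_right)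
  then have "cmod (ift (low_pass h g) y - taylor_low_pass m h g x y) \<le>
      ?c * (\<integral>\<omega>. cmod (low_pass h g \<omega> * cis (y \<bullet> \<omega>) - low_pass h g \<omega> * P \<omega> * cis (x \<bullet> \<omega>)) \<partial>lborel)"
    using mult_left_mono[OF integral_norm_bound[of lborel "\<lambda>\<omega>. low_pass h g \<omega> * cis (y \<bullet> \<omega>)
        - low_pass h g \<omega> * P \<omega> * cis (x \<bullet> \<omega>)"], of ?c]
    by simp
  also have "\<dots> \<le> ?c * (\<integral>\<omega>. ?q * (mu \<omega> * cmod (g \<omega>)) \<partial>lborel)"
    using i1 i2 bound mu_i
    by (intro mult_left_mono integral_mono integrable_norm Bochner_Integration.integrable_diff
        integrable_mult_right) auto
  also have "\<dots> = ?q * (?c * (\<integral>\<omega>. \<bar>mu \<omega>\<bar> * cmod (g \<omega>) \<partial>lborel))"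
    using mu0 by simp
  also have "\<dots> \<le> ?q * \<epsilon>" using h by (intro mult_left_mono mu_b) auto
  finally show "cmod (ift (low_pass h g) y - taylor_low_pass m h g x y) \<le> ?q * \<epsilon>" .
qed

text \<open>At points of \<open>Z\<close> near the ball the Taylor polynomial of the low-frequency part differs from
  \<open>ift g = 0\<close> by the two errors of the preceding lemma. The norming property carries this
  bound to \<open>x\<close>, where the polynomial agrees with the low-frequency part.\<close>

lemma ball_sampling_inequality:
  assumes s: "s > real DIM('a) / 2"
  shows "\<exists>\<delta>>0. \<exists>C\<ge>0. \<delta> \<le> 1 \<and> (\<forall>(g::'a::euclidean_space \<Rightarrow> complex) h c Z x. sobolev_data s g
      \<longrightarrow> 0 < h \<longrightarrow>
    (\<forall>y\<in>cball c (h / \<delta>). \<exists>z\<in>Z. norm (z - y) \<le> h) \<longrightarrow> (\<forall>z\<in>Z. ift g z = 0) \<longrightarrow>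
    norm (x - c) \<le> T * (h / \<delta>) \<longrightarrow> cmod (ift g x) \<le> C * h powr (s - real DIM('a) / 2) * data_norm s
        g)"
proof -
  have s0: "0 < s" using s order_le_less_trans[of 0 "real DIM('a) / 2" s] by simp
  define m where "m = nat \<lceil>s\<rceil>"
  have m: "s \<le> real (Suc m)" using real_nat_ceiling_ge[of s] by (simp add: m_def)
  obtain \<delta> A where \<delta>: "0 < \<delta>" "\<delta> \<le> 1" and A: "0 \<le> A" and norming:
    "\<forall>(p::'a \<Rightarrow> complex) c r Z x \<eta>. line_polynomial m p \<longrightarrow> 0 < r \<longrightarrow>
    bounded (p ` cball c r) \<longrightarrow> (\<forall>y\<in>cball c r. \<exists>z\<in>Z. norm (z - y) \<le> \<delta> * r) \<longrightarrow>
    (\<forall>z\<in>Z. norm (z - c) \<le> 2 * r \<longrightarrow> cmod (p z) \<le> \<eta>) \<longrightarrow> norm (x - c) \<le> T * r \<longrightarrow> cmod (p x) \<le> A * \<eta>"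
    using line_polynomial_norming[of m T, where 'a = 'a]
    by (elim exE conjE) (rule that, assumption+)
  define E where "E = (2 * pi) powr (- real DIM('a) / 2) * (sqrt (2 powr s) * embedding_const
      TYPE('a) s)"
  \<comment> \<open>Points of \<open>Z\<close> that are used have distance at most \<open>\<rho> h\<close> from \<open>x\<close>.\<close>
  define \<rho> where "\<rho> = (\<bar>T\<bar> + 2) / \<delta>"
  define C where "C = (A * (\<rho> ^ Suc m + 1) + 1) * E"
  have E: "0 \<le> E" by (simp add: E_def)
  have \<rho>: "0 \<le> \<rho>" using \<delta> by (simp add: \<rho>_def)
  have C: "0 \<le> C" unfolding C_def using A E \<rho> by (intro mult_nonneg_nonneg add_nonneg_nonneg) auto
  have main: "cmod (ift g x) \<le> C * h powr (s - real DIM('a) / 2) * data_norm s g"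
    if g: "sobolev_data s g" and h: "0 < h" and dense: "\<forall>y\<in>cball c (h / \<delta>). \<exists>z\<in>Z. norm (z - y) \<le> h"
      and zero: "\<forall>z\<in>Z. ift g z = 0" and x: "norm (x - c) \<le> T * (h / \<delta>)"
    for g :: "'a \<Rightarrow> complex" and h c Z x
  proof -
    define r where "r = h / \<delta>"
    have r: "0 < r" "\<delta> * r = h" using h \<delta> by (auto simp: r_def)
    define \<epsilon> where "\<epsilon> = E * h powr (s - real DIM('a) / 2) * data_norm s g"
    have \<epsilon>0: "0 \<le> \<epsilon>" using E by (simp add: \<epsilon>_def)
    define p where "p = taylor_low_pass m h g x"
    have low: "cmod (ift (low_pass h g) y - p y) \<le> (norm (y - x) / h) ^ Suc m * \<epsilon>"
      and high: "cmod (ift g y - ift (low_pass h g) y) \<le> \<epsilon>" for y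
      using taylor_low_pass_error(1)[OF g s h m, of y x] taylor_low_pass_error(2)[OF g s h m, of y]
      by (simp_all add: \<epsilon>_def E_def p_def mult_ac)
    have gi: "integrable lborel g" by (rule sobolev_data_integrable[OF g s])
    have lp: "line_polynomial m p" unfolding p_def
      by (rule line_polynomial_taylor_low_pass[OF gi h])
    have near: "cmod (ift (low_pass h g) y - p y) \<le> \<rho> ^ Suc m * \<epsilon>" if "norm (y - c) \<le> 2 * r" for y
    proof -
      have "norm (y - x) \<le> norm (y - c) + norm (x - c)"
        using norm_triangle_ineq4[of "y - c" "x - c"] by simp
      also have "\<dots> \<le> 2 * r + \<bar>T\<bar> * r"
        using that x r mult_right_mono[OF abs_ge_self[of T], of r] by (simp add: r_def)
      finally have "norm (y - x) \<le> (\<bar>T\<bar> + 2) * (h / \<delta>)"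
        by (simp add: r_def algebra_simps)
      then have "norm (y - x) / h \<le> \<rho>" using h \<delta> by (simp add: \<rho>_def field_simps)
      then have "(norm (y - x) / h) ^ Suc m \<le> \<rho> ^ Suc m" using h by (intro power_mono) auto
      then show ?thesis using low[of y] \<epsilon>0 by (meson mult_right_mono order_trans)
    qed
    have bdd: "bounded (p ` cball c r)"
      unfolding bounded_iff
    proof (intro exI ballI)
      fix q assume "q \<in> p ` cball c r"
      then obtain y where y: "y \<in> cball c r" "q = p y" by blast
      then have "norm (y - c) \<le> 2 * r" using r by (simp add: dist_norm norm_minus_commute)
      note near[OF this]
      moreover have "cmod (p y) \<le> cmod (ift (low_pass h g) y) + cmod (ift (low_pass h g) y - p y)"
        using norm_triangle_ineq4[of "ift (low_pass h g) y" "ift (low_pass h g) y - p y"] by simp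
      moreover have "cmod (ift (low_pass h g) y) \<le>
          (2 * pi) powr (- real DIM('a) / 2) * (\<integral>\<omega>. cmod (low_pass h g \<omega>) \<partial>lborel)"
            by (rule ift_bound)
      ultimately show "cmod q \<le> (2 * pi) powr (- real DIM('a) / 2) * (\<integral>\<omega>. cmod (low_pass h g
          \<omega>) \<partial>lborel) + \<rho> ^ Suc m * \<epsilon>"
        unfolding y(2) by linarith
    qed
    have small: "\<forall>z\<in>Z. norm (z - c) \<le> 2 * r \<longrightarrow> cmod (p z) \<le> (\<rho> ^ Suc m + 1) * \<epsilon>"
    proof (intro ballI impI)
      fix z assume z: "z \<in> Z" "norm (z - c) \<le> 2 * r"
      have "cmod (ift (low_pass h g) z) \<le> \<epsilon>" using high[of z] zero z by simp
      moreover have "cmod (p z) \<le> cmod (ift (low_pass h g) z) + cmod (ift (low_pass h g) z - p z)"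
        using norm_triangle_ineq4[of "ift (low_pass h g) z" "ift (low_pass h g) z - p z"] by simp
      ultimately show "cmod (p z) \<le> (\<rho> ^ Suc m + 1) * \<epsilon>"
        using near[OF z(2)] by (simp add: distrib_right)
    qed
    have d: "\<forall>y\<in>cball c r. \<exists>z\<in>Z. norm (z - y) \<le> \<delta> * r" using dense unfolding r(2)
      by (simp add: r_def)
    have xr: "norm (x - c) \<le> T * r" using x by (simp add: r_def)
    have "cmod (p x) \<le> A * ((\<rho> ^ Suc m + 1) * \<epsilon>)"
      by (rule norming[THEN spec, THEN spec, THEN spec, THEN spec, THEN spec, THEN spec, THEN mp,
          THEN mp,
           THEN mp, THEN mp, THEN mp, THEN mp, OF lp r(1) bdd d small xr])
    moreover have "ift (low_pass h g) x = p x" using low[of x] by simp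
    moreover have "cmod (ift g x) \<le> cmod (ift g x - ift (low_pass h g) x) + cmod (ift (low_pass h
        g) x)"
      using norm_triangle_ineq[of "ift g x - ift (low_pass h g) x" "ift (low_pass h g) x"] by simp
    ultimately have "cmod (ift g x) \<le> \<epsilon> + A * ((\<rho> ^ Suc m + 1) * \<epsilon>)" using high[of x] by simp
    also have "\<dots> = C * h powr (s - real DIM('a) / 2) * data_norm s g"
      by (simp add: C_def \<epsilon>_def algebra_simps)
    finally show ?thesis .
  qed
  show ?thesis
  proof (rule exI[of _ \<delta>], rule conjI[OF \<delta>(1)], rule exI[of _ C], intro conjI \<delta>(2) C allI impI)
    fix g :: "'a \<Rightarrow> complex" and h c Z x
    assume "sobolev_data s g" "0 < h" "\<forall>y\<in>cball c (h / \<delta>). \<exists>z\<in>Z. norm (z - y) \<le> h"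
      "\<forall>z\<in>Z. ift g z = 0" "norm (x - c) \<le> T * (h / \<delta>)"
    then show "cmod (ift g x) \<le> C * h powr (s - real DIM('a) / 2) * data_norm s g" by (rule main)
  qed
qed

lemma fourier_rep_bound:
  fixes \<Omega> :: "'a::euclidean_space set"
  assumes s: "s > real DIM('a) / 2" and u: "fourier_rep s \<Omega> u g" and "x \<in> \<Omega>"
  shows "\<bar>u x\<bar> \<le> (2 * pi) powr (- real DIM('a) / 2) * embedding_const TYPE('a) s * data_norm s g"
proof -
  have g: "sobolev_data s g" using u by (simp add: fourier_rep_def)
  have "\<bar>u x\<bar> = cmod (ift g x)" using u \<open>x \<in> \<Omega>\<close> by (metis fourier_rep_def norm_of_real)
  also have "\<dots> \<le> (2 * pi) powr (- real DIM('a) / 2) * (\<integral>\<omega>. cmod (g \<omega>) \<partial>lborel)" by (rule ift_bound)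
  also have "\<dots> \<le> (2 * pi) powr (- real DIM('a) / 2) * (embedding_const TYPE('a) s * data_norm s g)"
    by (intro mult_left_mono sobolev_data_integrable(2)[OF g s]) auto
  finally show ?thesis by (simp add: mult.assoc)
qed

lemma fill_distance_attained:
  fixes \<Omega> :: "'a::euclidean_space set"
  assumes "bounded \<Omega>" "finite X" "X \<noteq> {}" "y \<in> \<Omega>"
  shows "\<exists>z\<in>X. norm (z - y) \<le> fill_distance X \<Omega>"
proof -
  obtain R where R: "\<And>y. y \<in> \<Omega> \<Longrightarrow> norm y \<le> R" using \<open>bounded \<Omega>\<close> by (auto simp: bounded_iff)
  obtain a where a: "a \<in> X" using \<open>X \<noteq> {}\<close> by blast
  have "bdd_above ((\<lambda>x. MIN z\<in>X. norm (x - z)) ` \<Omega>)"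
  proof (rule bdd_aboveI2)
    fix x assume "x \<in> \<Omega>"
    have "(MIN z\<in>X. norm (x - z)) \<le> norm (x - a)" using a \<open>finite X\<close> by (intro Min_le) auto
    also have "\<dots> \<le> R + norm a" using norm_triangle_ineq4[of x a] R[OF \<open>x \<in> \<Omega>\<close>] by linarith
    finally show "(MIN z\<in>X. norm (x - z)) \<le> R + norm a" .
  qed
  then have le: "(MIN z\<in>X. norm (y - z)) \<le> fill_distance X \<Omega>"
    unfolding fill_distance_def using \<open>y \<in> \<Omega>\<close> by (rule cSUP_upper[rotated])
  have "(MIN z\<in>X. norm (y - z)) \<in> (\<lambda>z. norm (y - z)) ` X"
    using assms by (intro Min_in) auto
  then obtain z where "z \<in> X" "(MIN z\<in>X. norm (y - z)) = norm (y - z)" by auto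
  then show ?thesis using le by (auto simp: norm_minus_commute)
qed

text \<open>A nonempty open set is not contained in a finite set.\<close>

lemma fill_distance_pos:
  fixes \<Omega> :: "'a::euclidean_space set"
  assumes "open \<Omega>" "\<Omega> \<noteq> {}" "bounded \<Omega>" "finite X" "X \<noteq> {}"
  shows "0 < fill_distance X \<Omega>"
proof -
  have "\<not> \<Omega> \<subseteq> X"
    using \<open>open \<Omega>\<close> \<open>\<Omega> \<noteq> {}\<close> \<open>finite X\<close> finite_subset finite_imp_not_open by blast
  then obtain y where y: "y \<in> \<Omega>" "y \<notin> X" by blast
  then obtain z where "z \<in> X" "norm (z - y) \<le> fill_distance X \<Omega>"
    using fill_distance_attained assms by blast
  moreover have "0 < norm (z - y)" using y \<open>z \<in> X\<close> by auto
  ultimately show ?thesis by linarith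
qed

text \<open>For small fill distance the interior cone property supplies a ball near \<open>x\<close> to which the
  preceding estimate applies. For large fill distance the claim is the Sobolev embedding.\<close>

theorem sampling_inequality:
  fixes \<Omega> :: "'a::euclidean_space set"
  assumes dom: "bounded_lipschitz_domain \<Omega>" and s: "s > real DIM('a) / 2"
  shows "\<exists>C\<ge>0. \<forall>X u g. finite X \<longrightarrow> X \<noteq> {} \<longrightarrow> X \<subseteq> \<Omega> \<longrightarrow> fourier_rep s \<Omega> u g \<longrightarrow>
    (\<forall>z\<in>X. u z = 0) \<longrightarrow>
    (\<forall>x\<in>\<Omega>. \<bar>u x\<bar> \<le> C * fill_distance X \<Omega> powr (s - real DIM('a) / 2) * data_norm s g)"
proof -
  let ?e = "s - real DIM('a) / 2"
  have \<Omega>: "open \<Omega>" "\<Omega> \<noteq> {}" "bounded \<Omega>" using dom by (auto simp: bounded_lipschitz_domain_def)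
  obtain \<kappa> \<tau> where \<kappa>: "0 < \<kappa>" "\<kappa> \<le> 1" and \<tau>: "0 < \<tau>" and cone:
    "\<And>x t. x \<in> \<Omega> \<Longrightarrow> 0 < t \<Longrightarrow> t \<le> \<tau> \<Longrightarrow> \<exists>c. norm (x - c) \<le> t \<and> cball c (\<kappa> * t) \<subseteq> \<Omega>"
    using lipschitz_domain_cone[OF dom] by blast
  obtain \<delta> C1 where \<delta>: "0 < \<delta>" and C1: "0 \<le> C1"
      and ball: "\<forall>(g::'a \<Rightarrow> complex) h c Z x. sobolev_data s g \<longrightarrow> 0 < h \<longrightarrow>
    (\<forall>y\<in>cball c (h / \<delta>). \<exists>z\<in>Z. norm (z - y) \<le> h) \<longrightarrow> (\<forall>z\<in>Z. ift g z = 0) \<longrightarrow>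
    norm (x - c) \<le> 1 / \<kappa> * (h / \<delta>) \<longrightarrow> cmod (ift g x) \<le> C1 * h powr ?e * data_norm s g"
    using ball_sampling_inequality[OF s, of "1 / \<kappa>"] by (elim exE conjE) (rule that, assumption+)
  define h0 where "h0 = \<tau> * \<kappa> * \<delta>"
  have h0: "0 < h0" using \<tau> \<kappa> \<delta> by (simp add: h0_def)
  define C2 where "C2 = (2 * pi) powr (- real DIM('a) / 2) * embedding_const TYPE('a) s"
  have C2: "0 \<le> C2" by (simp add: C2_def)
  define C where "C = C1 + C2 / h0 powr ?e"
  have "\<bar>u x\<bar> \<le> C * fill_distance X \<Omega> powr ?e * data_norm s g"
    if X: "finite X" "X \<noteq> {}" "X \<subseteq> \<Omega>" and u: "fourier_rep s \<Omega> u g" and zero: "\<forall>z\<in>X. u z = 0"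
        and x: "x \<in> \<Omega>"
    for X u g x
  proof -
    define h where "h = fill_distance X \<Omega>"
    have h: "0 < h" unfolding h_def by (rule fill_distance_pos[OF \<Omega> X(1,2)])
    have g: "sobolev_data s g" and ug: "\<And>x. x \<in> \<Omega> \<Longrightarrow> complex_of_real (u x) = ift g x"
      using u by (auto simp: fourier_rep_def)
    show ?thesis
    proof (cases "h \<le> h0")
      case True
      \<comment> \<open>The ball of radius \<open>\<kappa> t = h / \<delta>\<close> is dense enough, and \<open>h \<le> h0\<close> means \<open>t \<le> \<tau>\<close>.\<close>
      define t where "t = h / (\<delta> * \<kappa>)"
      have "t \<le> \<tau>" using True \<kappa> \<delta> by (simp add: t_def h0_def field_simps)
      moreover have "0 < t" using h \<kappa> \<delta> by (simp add: t_def)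
      ultimately obtain c where c: "norm (x - c) \<le> t" "cball c (\<kappa> * t) \<subseteq> \<Omega>" using cone[OF x]
        by blast
      have "\<kappa> * t = h / \<delta>" using \<kappa> \<delta> by (simp add: t_def)
      then have "\<forall>y\<in>cball c (h / \<delta>). \<exists>z\<in>X. norm (z - y) \<le> h"
        using fill_distance_attained[OF \<Omega>(3) X(1,2)] subsetD[OF c(2)] unfolding h_def by metis
      moreover have "\<forall>z\<in>X. ift g z = 0" using zero ug X(3) by (metis of_real_0 subsetD)
      moreover have "norm (x - c) \<le> 1 / \<kappa> * (h / \<delta>)" using c(1) by (simp add: t_def mult.commute)
      ultimately have "cmod (ift g x) \<le> C1 * h powr ?e * data_norm s g"
        by (intro ball[THEN spec, THEN spec, THEN spec, THEN spec, THEN spec, THEN mp, THEN mp,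
           THEN mp, THEN mp, THEN mp, OF g h])
      moreover have "cmod (ift g x) = \<bar>u x\<bar>" using ug[OF x] by (metis norm_of_real)
      moreover have "C1 * (h powr ?e * data_norm s g) \<le> C * (h powr ?e * data_norm s g)"
        unfolding C_def using C2 by (intro mult_right_mono) auto
      ultimately show ?thesis by (simp add: h_def mult.assoc)
    next
      case False
      then have "h0 powr ?e \<le> h powr ?e" using h0 s by (intro powr_mono2) auto
      then have "1 \<le> h powr ?e / h0 powr ?e" using h0 by simp
      then have "C2 * data_norm s g * 1 \<le> C2 * data_norm s g * (h powr ?e / h0 powr ?e)"
        using C2 by (intro mult_left_mono) auto
      also have "\<dots> = C2 / h0 powr ?e * (h powr ?e * data_norm s g)" by simp
      also have "\<dots> \<le> C * (h powr ?e * data_norm s g)"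
        unfolding C_def using C1 by (intro mult_right_mono) auto
      finally show ?thesis using fourier_rep_bound[OF s u x] by (simp add: h_def C2_def mult.assoc)
    qed
  qed
  moreover have "0 \<le> C" using C1 C2 by (simp add: C_def)
  ultimately show ?thesis by blast
qed

section \<open>The Lyapunov equation\<close>

definition matrix_eigenvalue :: "complex^'n^'n \<Rightarrow> complex \<Rightarrow> bool" where
  "matrix_eigenvalue A \<mu> \<longleftrightarrow> (\<exists>v. v \<noteq> 0 \<and> A *v v = \<mu> *s v)"

text \<open>The value of the polynomial \<open>p\<close> in the matrix \<open>A\<close>, applied to the vector \<open>v\<close>.\<close>

definition poly_apply :: "complex^'n^'n \<Rightarrow> complex poly \<Rightarrow> complex^'n \<Rightarrow> complex^'n" where
  "poly_apply A p v = (\<Sum>i\<le>degree p. coeff p i *s (((*v) A ^^ i) v))"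

lemma poly_apply_altdef:
  assumes "degree p \<le> n"
  shows "poly_apply A p v = (\<Sum>i\<le>n. coeff p i *s (((*v) A ^^ i) v))"
  unfolding poly_apply_def using assms
  by (intro sum.mono_neutral_left) (auto simp: coeff_eq_0)

lemma poly_apply_add: "poly_apply A (p + q) v = poly_apply A p v + poly_apply A q v"
  using poly_apply_altdef[of p "max (degree p) (degree q)" A v] poly_apply_altdef[of q
      "max (degree p) (degree q)" A v]
    poly_apply_altdef[of "p + q" "max (degree p) (degree q)" A v] degree_add_le_max[of p q]
  by (simp add: vec.scale_left_distrib sum.distrib)

lemma poly_apply_smult: "poly_apply A (smult c p) v = c *s poly_apply A p v"
  using poly_apply_altdef[of "smult c p" "degree p" A v]
  by (simp add: poly_apply_def vec.scale_sum_right degree_smult_le)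

lemma poly_apply_pCons_0: "poly_apply A (pCons 0 p) v = A *v poly_apply A p v"
proof -
  have "poly_apply A (pCons 0 p) v = (\<Sum>i\<le>Suc (degree p). coeff (pCons 0 p) i *s (((*v) A ^^ i) v))"
    by (rule poly_apply_altdef) (rule degree_pCons_le)
  also have "\<dots> = (\<Sum>i\<le>degree p. coeff p i *s (A *v (((*v) A ^^ i) v)))"
    by (subst sum.atMost_Suc_shift) simp
  also have "\<dots> = A *v poly_apply A p v"
    by (simp add: poly_apply_def vec.linear_sum[OF matrix_vector_mul_linear_gen]
        vector_scalar_commute)
  finally show ?thesis .
qed

lemma poly_apply_linear_factor:
  "poly_apply A ([:- r, 1:] * q) v = A *v poly_apply A q v - r *s poly_apply A q v"
proof -
  have "[:- r, 1:] * q = smult (- r) q + pCons 0 q" by simp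
  then show ?thesis
    by (simp only: poly_apply_add poly_apply_smult poly_apply_pCons_0) simp
qed

lemma poly_apply_const: "degree p = 0 \<Longrightarrow> poly_apply A p v = coeff p 0 *s v"
  by (simp add: poly_apply_def)

text \<open>The vectors \<open>A\<^sup>i v\<close> with \<open>i \<le> n\<close> are \<open>n + 1\<close> vectors in an \<open>n\<close>-dimensional space.\<close>

lemma annihilating_polynomial:
  fixes A :: "complex^'n^'n"
  shows "\<exists>p. p \<noteq> 0 \<and> poly_apply A p v = 0"
proof -
  let ?w = "\<lambda>i. ((*v) A ^^ i) v"
  let ?N = "CARD('n)"
  have "\<exists>a. (\<exists>i\<le>?N. a i \<noteq> 0) \<and> (\<Sum>i\<le>?N. a i *s ?w i) = 0"
  proof (cases "inj_on ?w {..?N}")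
    case True
    have "vec.dependent (?w ` {..?N})"
    proof (rule ccontr)
      assume "\<not> vec.dependent (?w ` {..?N})"
      then have "card (?w ` {..?N}) \<le> vec.dim (UNIV :: (complex^'n) set)"
        by (intro vec.independent_card_le_dim) auto
      then show False using True by (simp add: card_image vec.dim_UNIV card_cart_basis)
    qed
    then obtain u y where u: "y \<in> ?w ` {..?N}" "u y \<noteq> 0" "(\<Sum>z\<in>?w ` {..?N}. u z *s z) = 0"
      using vec.dependent_finite[of "?w ` {..?N}"] by auto
    then have "(\<Sum>i\<le>?N. u (?w i) *s ?w i) = 0" using True by (simp add: sum.reindex)
    then show ?thesis using u(1,2) by (intro exI[of _ "\<lambda>i. u (?w i)"]) auto
  next
    case False
    then obtain i j where ij: "i \<le> ?N" "j \<le> ?N" "i \<noteq> j" "?w i = ?w j" by (auto simp: inj_on_def)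
    define a where "a l = (if l = i then 1 else if l = j then - 1 else 0 :: complex)" for l
    have "(\<Sum>l\<le>?N. a l *s ?w l) = (\<Sum>l\<in>{i, j}. a l *s ?w l)"
      by (rule sum.mono_neutral_right) (use ij in \<open>auto simp: a_def\<close>)
    also have "\<dots> = 0" using ij by (simp add: a_def)
    finally show ?thesis using ij by (intro exI[of _ a]) (auto simp: a_def)
  qed
  then obtain a i where a: "i \<le> ?N" "a i \<noteq> 0" "(\<Sum>i\<le>?N. a i *s ?w i) = 0" by blast
  define p where "p = (\<Sum>i\<le>?N. monom (a i) i)"
  have coeff: "coeff p j = (if j \<le> ?N then a j else 0)" for j
    by (simp add: p_def coeff_sum if_distrib cong: if_cong)
  have "degree p \<le> ?N" by (rule degree_le) (simp add: coeff)
  then have "poly_apply A p v = 0"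
    using a(3) by (subst poly_apply_altdef) (auto simp: coeff)
  moreover have "p \<noteq> 0" using a coeff[of i] by auto
  ultimately show ?thesis by blast
qed

text \<open>Choose \<open>v\<close> with \<open>M v \<noteq> 0\<close>, and let \<open>p\<close> be a polynomial of minimal degree with
  \<open>p(D) v = 0\<close>; by minimality every root of \<open>p\<close> is an eigenvalue of \<open>D\<close>. Among the divisors
  \<open>q\<close> of \<open>p\<close> with \<open>M q(D) v = 0\<close> take one of minimal degree, and a root \<open>r\<close> of it. With
  \<open>q = (X - r) q'\<close> the vector \<open>M q'(D) v\<close> is nonzero, and \<open>B M = M D\<close> shows that it
  is an eigenvector of \<open>B\<close> for \<open>r\<close>.\<close>

lemma sylvester_common_eigenvalue:
  fixes B D M :: "complex^'n^'n"
  assumes BM: "B ** M = M ** D" and "M \<noteq> 0"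
  shows "\<exists>r. matrix_eigenvalue B r \<and> matrix_eigenvalue D r"
proof -
  obtain v where v: "M *v v \<noteq> 0"
    using \<open>M \<noteq> 0\<close> by (metis matrix_eq matrix_vector_mult_0)
  define P where "P p \<longleftrightarrow> p \<noteq> 0 \<and> poly_apply D p v = 0" for p
  obtain p0 where "P p0" using annihilating_polynomial[of D v] by (auto simp: P_def)
  then obtain p where p: "P p" and pmin: "\<And>q. P q \<Longrightarrow> degree p \<le> degree q"
    using ex_has_least_nat[of P p0 degree] by blast
  define Q where "Q q \<longleftrightarrow> q \<noteq> 0 \<and> q dvd p \<and> M *v poly_apply D q v = 0" for q
  have "Q p" using p by (simp add: Q_def P_def)
  then obtain q where q: "Q q" and qmin: "\<And>q'. Q q' \<Longrightarrow> degree q \<le> degree q'"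
    using ex_has_least_nat[of Q p degree] by blast
  have "degree q \<noteq> 0"
  proof
    assume d: "degree q = 0"
    then have "coeff q 0 \<noteq> 0" using q by (auto simp: Q_def) (metis leading_coeff_0_iff)
    moreover have "coeff q 0 *s (M *v v) = 0"
      using q d by (simp add: Q_def poly_apply_const vector_scalar_commute)
    ultimately show False using v by simp
  qed
  then have "\<not> constant (poly q)" by (simp add: constant_degree)
  then obtain r where r: "poly q r = 0" using fundamental_theorem_of_algebra by blast
  then obtain q' where q': "q = [:- r, 1:] * q'" by (auto simp: poly_eq_0_iff_dvd elim: dvdE)
  have "poly p r = 0" using q r unfolding Q_def by (auto elim!: dvdE)
  then obtain p' where p': "p = [:- r, 1:] * p'" by (auto simp: poly_eq_0_iff_dvd elim: dvdE)
  have deg: "degree ([:- r, 1:] * t) = Suc (degree t)" if "t \<noteq> 0" for t :: "complex poly"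
    using that by (subst degree_mult_eq) auto
  have p'0: "p' \<noteq> 0" and q'0: "q' \<noteq> 0" using p q by (auto simp: P_def Q_def p' q')
  have "poly_apply D p' v \<noteq> 0"
    using pmin[of p'] deg[OF p'0] p'0 by (auto simp: P_def p')
  moreover have "D *v poly_apply D p' v = r *s poly_apply D p' v"
    using p unfolding P_def p' poly_apply_linear_factor by simp
  ultimately have D: "matrix_eigenvalue D r" unfolding matrix_eigenvalue_def by blast
  have "q' dvd p" using q unfolding Q_def q' by (metis dvd_mult_right)
  then have "M *v poly_apply D q' v \<noteq> 0"
    using qmin[of q'] deg[OF q'0] q'0 by (auto simp: Q_def q')
  moreover have "B *v (M *v poly_apply D q' v) = r *s (M *v poly_apply D q' v)"
  proof -
    have "M *v (D *v poly_apply D q' v - r *s poly_apply D q' v) = 0"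
      using q unfolding Q_def q' poly_apply_linear_factor by simp
    then have "M *v (D *v poly_apply D q' v) = r *s (M *v poly_apply D q' v)"
      by (simp add: matrix_vector_mult_diff_distrib vector_scalar_commute)
    then show ?thesis by (simp add: matrix_vector_mul_assoc BM)
  qed
  ultimately have "matrix_eigenvalue B r" unfolding matrix_eigenvalue_def by blast
  with D show ?thesis by blast
qed

text \<open>A square matrix with a left inverse has a right inverse, whose transpose is a left inverse of
  the transposed matrix.\<close>

lemma matrix_eigenvalue_transpose:
  assumes "matrix_eigenvalue (transpose A) \<mu>"
  shows "matrix_eigenvalue A \<mu>"
proof (rule ccontr)
  assume n: "\<not> matrix_eigenvalue A \<mu>"
  define N where "N = A - mat \<mu>"
  have mat: "mat \<mu> *v x = \<mu> *s x" for x :: "complex^'a"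
    by (simp add: matrix_vector_mult_def mat_def vec_eq_iff if_distrib if_distribR cong: if_cong)
  have "\<forall>x. N *v x = 0 \<longrightarrow> x = 0"
    using n by (auto simp: matrix_eigenvalue_def N_def matrix_vector_mult_diff_rdistrib mat)
  then obtain N' where "N' ** N = mat 1" using matrix_left_invertible_ker[of N] by blast
  then have "N ** N' = mat 1" by (simp add: matrix_left_right_inverse)
  then have N't: "transpose N' ** transpose N = mat 1"
    by (metis matrix_transpose_mul transpose_mat)
  obtain v where v: "v \<noteq> 0" "transpose A *v v = \<mu> *s v"
    using assms by (auto simp: matrix_eigenvalue_def)
  have "transpose N = transpose A - mat \<mu>"
    by (simp add: N_def transpose_def mat_def vec_eq_iff)
  then have "transpose N *v v = 0" by (simp add: matrix_vector_mult_diff_rdistrib mat v del: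
      transpose_matrix_vector)
  then have "v = 0" using N't by (metis matrix_vector_mul_assoc matrix_vector_mul_lid
      matrix_vector_mult_0_right)
  then show False using v by simp
qed

definition complexify :: "real^'n^'n \<Rightarrow> complex^'n^'n" where
  "complexify A = (\<chi> i j. complex_of_real (A $ i $ j))"

lemma complex_eigenvalue_iff: "complex_eigenvalue A \<mu> \<longleftrightarrow> matrix_eigenvalue (complexify A) \<mu>"
  by (simp add: complex_eigenvalue_def matrix_eigenvalue_def complexify_def)

text \<open>A nonzero solution of the homogeneous equation intertwines the transpose of \<open>A\<close> with \<open>- A\<close>.
  A common eigenvalue \<open>r\<close> of these makes \<open>r\<close> and \<open>- r\<close> eigenvalues of \<open>A\<close>, which cannot both
  lie in the same open half plane.\<close>

lemma lyapunov_injective: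
  fixes A M :: "real^'n^'n"
  assumes spec: "(\<forall>\<mu>. complex_eigenvalue A \<mu> \<longrightarrow> Re \<mu> < 0) \<or> (\<forall>\<mu>. complex_eigenvalue A \<mu> \<longrightarrow> Re \<mu> > 0)"
    and eq: "transpose A ** M + M ** A = 0"
  shows "M = 0"
proof (rule ccontr)
  assume "M \<noteq> 0"
  then have "complexify M \<noteq> 0" by (simp add: complexify_def vec_eq_iff)
  moreover have "transpose (complexify A) ** complexify M = complexify M ** (- complexify A)"
  proof -
    have "(\<Sum>k\<in>UNIV. A $ k $ i * M $ k $ j) = - (\<Sum>k\<in>UNIV. M $ i $ k * A $ k $ j)" for i j
      using eq by (simp add: vec_eq_iff matrix_matrix_mult_def transpose_def eq_neg_iff_add_eq_0)
    then have "complex_of_real (\<Sum>k\<in>UNIV. A $ k $ i * M $ k $ j)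
        = complex_of_real (- (\<Sum>k\<in>UNIV. M $ i $ k * A $ k $ j))" for i j
      by (simp only:)
    then show ?thesis
      by (simp add: complexify_def vec_eq_iff matrix_matrix_mult_def transpose_def sum_negf)
  qed
  ultimately obtain r where r: "matrix_eigenvalue (transpose (complexify A)) r"
      "matrix_eigenvalue (- complexify A) r"
    using sylvester_common_eigenvalue by blast
  have e1: "complex_eigenvalue A r"
    unfolding complex_eigenvalue_iff by (rule matrix_eigenvalue_transpose[OF r(1)])
  have e2: "complex_eigenvalue A (- r)"
  proof -
    obtain v where v: "v \<noteq> 0" "(- complexify A) *v v = r *s v"
      using r(2) by (auto simp: matrix_eigenvalue_def)
    have "(- complexify A) *v v = - (complexify A *v v)"
      by (simp add: matrix_vector_mult_def vec_eq_iff sum_negf)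
    then have "complexify A *v v = (- r) *s v" using v(2)
      by (metis minus_minus vec.scale_minus_left)
    then show ?thesis using v(1) unfolding complex_eigenvalue_iff matrix_eigenvalue_def by blast
  qed
  from spec show False
  proof
    assume "\<forall>\<mu>. complex_eigenvalue A \<mu> \<longrightarrow> Re \<mu> < 0"
    then have "Re r < 0" "Re (- r) < 0" using e1 e2 by blast+
    then show False by simp
  next
    assume "\<forall>\<mu>. complex_eigenvalue A \<mu> \<longrightarrow> Re \<mu> > 0"
    then have "Re r > 0" "Re (- r) > 0" using e1 e2 by blast+
    then show False by simp
  qed
qed

text \<open>An injective linear map of a finite-dimensional space is surjective, and for symmetric \<open>E\<close>
  the symmetric part of a solution is a solution.\<close>

lemma lyapunov_solvable:
  fixes A E :: "real^'n^'n"
  assumes spec: "(\<forall>\<mu>. complex_eigenvalue A \<mu> \<longrightarrow> Re \<mu> < 0) \<or> (\<forall>\<mu>. complex_eigenvalue A \<mu> \<longrightarrow> Re \<mu> > 0)"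
    and sym: "transpose E = E"
  shows "\<exists>M. transpose M = M \<and> transpose A ** M + M ** A = E"
proof -
  define T where "T M = transpose A ** M + M ** A" for M
  have T_add: "T (M + N) = T M + T N" for M N
    by (simp add: T_def vec_eq_iff matrix_matrix_mult_def sum.distrib distrib_left distrib_right)
  have T_scale: "T (c *\<^sub>R M) = c *\<^sub>R T M" for c M
    by (simp add: T_def vec_eq_iff matrix_matrix_mult_def sum_distrib_left distrib_left mult_ac)
  have lin: "linear T" by (rule linearI) (simp_all add: T_add T_scale)
  moreover have "inj T"
    unfolding linear_injective_0[OF lin] T_def using lyapunov_injective[OF spec] by blast
  ultimately have "surj T" by (rule linear_injective_imp_surjective) (rule refl)
  then obtain N where N: "T N = E" by (metis surjD)
  have T_transpose: "T (transpose M) = transpose (T M)" for M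
    by (simp add: T_def vec_eq_iff transpose_def matrix_matrix_mult_def mult.commute add.commute)
  let ?M = "(1 / 2) *\<^sub>R (N + transpose N)"
  have "T ?M = (1 / 2) *\<^sub>R (E + transpose E)" by (simp only: T_scale T_add T_transpose N)
  also have "\<dots> = E" unfolding sym by (simp add: vec_eq_iff)
  finally have "T ?M = E" .
  moreover have "transpose ?M = ?M" by (simp add: transpose_def vec_eq_iff add.commute)
  ultimately show ?thesis unfolding T_def by blast
qed

section \<open>Interpolating Sobolev functions\<close>

lemma sobolev_data_shift:
  fixes g :: "'a::euclidean_space \<Rightarrow> complex"
  assumes g: "sobolev_data s g" and s: "0 \<le> s"
  shows "sobolev_data s (\<lambda>\<omega>. g (\<omega> - a))"
proof -
  note [measurable] = sobolev_data_measurable[OF g]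
  define C where "C = 2 powr s * (1 + weight (s / 2) a)"
  have C: "weight s \<omega> \<le> C\<^sup>2 * weight s (\<omega> - a)" for \<omega>
  proof -
    have "weight (s / 2) \<omega> \<le> 2 powr s * (weight (s / 2) (\<omega> - a) + weight (s / 2) a)"
      by (rule weight_submultiplicative[OF s])
    also have "\<dots> \<le> 2 powr s * (weight (s / 2) (\<omega> - a) + weight (s / 2) a * weight (s / 2) (\<omega> - a))"
      using mult_left_mono[OF weight_ge_1[of "s / 2" "\<omega> - a"], of "weight (s / 2) a"] s
      by (intro mult_left_mono add_left_mono) auto
    also have "\<dots> = C * weight (s / 2) (\<omega> - a)" by (simp add: C_def algebra_simps)
    finally have "(weight (s / 2) \<omega>)\<^sup>2 \<le> (C * weight (s / 2) (\<omega> - a))\<^sup>2" by (intro power_mono) auto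
    then show ?thesis by (simp add: weight_half_square power_mult_distrib)
  qed
  have "integrable lborel (\<lambda>\<omega>. weight s (- a + 1 *\<^sub>R \<omega>) * (cmod (g (- a + 1 *\<^sub>R \<omega>)))\<^sup>2)"
    using g by (subst lborel_integrable_affine_iff) (auto simp: sobolev_data_def)
  then have i: "integrable lborel (\<lambda>\<omega>. C\<^sup>2 * (weight s (\<omega> - a) * (cmod (g (\<omega> - a)))\<^sup>2))"
    by simp
  have "integrable lborel (\<lambda>\<omega>. weight s \<omega> * (cmod (g (\<omega> - a)))\<^sup>2)"
  proof (rule Bochner_Integration.integrable_bound[OF i])
    have "weight s \<omega> * (cmod (g (\<omega> - a)))\<^sup>2 \<le> C\<^sup>2 * (weight s (\<omega> - a) * (cmod (g (\<omega> - a)))\<^sup>2)" for \<omega>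
      using mult_right_mono[OF C[of \<omega>], of "(cmod (g (\<omega> - a)))\<^sup>2"] by (simp add: mult.assoc)
    then show "AE \<omega> in lborel. norm (weight s \<omega> * (cmod (g (\<omega> - a)))\<^sup>2) \<le> norm (C\<^sup>2 * (weight s (\<omega>
        - a) * (cmod (g (\<omega> - a)))\<^sup>2))"
      by (intro AE_I2) (simp add: abs_mult)
  qed measurable
  then show ?thesis by (simp add: sobolev_data_def)
qed

lemma ift_shift:
  fixes g :: "'a::euclidean_space \<Rightarrow> complex"
  assumes [measurable]: "g \<in> borel_measurable borel"
  shows "ift (\<lambda>\<omega>. g (\<omega> - a)) x = cis (x \<bullet> a) * ift g x"
proof -
  have "(\<integral>\<omega>. g (\<omega> - a) * cis (x \<bullet> \<omega>) \<partial>lborel) = (\<integral>\<omega>. g \<omega> * cis (x \<bullet> (\<omega> + a)) \<partial>lborel)"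
    by (subst lborel_integral_affine[of 1 _ a]) (auto simp: add.commute)
  also have "\<dots> = (\<integral>\<omega>. cis (x \<bullet> a) * (g \<omega> * cis (x \<bullet> \<omega>)) \<partial>lborel)"
    by (intro Bochner_Integration.integral_cong refl) (simp add: inner_add_right
        cis_mult[symmetric])
  finally show ?thesis by (simp add: ift_def)
qed

lemma sobolev_space_cmult:
  fixes \<Omega> :: "'a::euclidean_space set"
  assumes "open \<Omega>" "s > real DIM('a) / 2" "u \<in> sobolev_space s \<Omega>"
  shows "(\<lambda>x. c * u x) \<in> sobolev_space s \<Omega>"
  using assms fourier_rep_cmult by (metis sobolev_space_iff)

lemma sobolev_space_add:
  fixes \<Omega> :: "'a::euclidean_space set"
  assumes "open \<Omega>" "s > real DIM('a) / 2" "u \<in> sobolev_space s \<Omega>" "v \<in> sobolev_space s \<Omega>"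
  shows "(\<lambda>x. u x + v x) \<in> sobolev_space s \<Omega>"
  using assms fourier_rep_add[OF assms(2)] by (metis sobolev_space_iff)

lemma cos_cis: "(cis t + cis (- t)) / 2 = complex_of_real (cos t)"
  by (simp add: complex_eq_iff)

text \<open>Multiplication by \<open>cis\<close> of a linear function is a shift of the transform.\<close>

lemma sobolev_space_mult_cos:
  fixes \<Omega> :: "'a::euclidean_space set"
  assumes "open \<Omega>" and s: "s > real DIM('a) / 2" and u: "u \<in> sobolev_space s \<Omega>"
  shows "(\<lambda>x. cos (a \<bullet> x + b) * u x) \<in> sobolev_space s \<Omega>"
proof -
  have s0: "0 \<le> s" using s order_trans[of 0 "real DIM('a) / 2" s] by simp
  obtain g where "fourier_rep s \<Omega> u g" using u sobolev_space_iff[OF assms(1,2)] by blast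
  then have g: "sobolev_data s g" and re: "\<And>x. ift g x \<in> \<real>" and ug: "\<And>x. x \<in> \<Omega>
      \<Longrightarrow> complex_of_real (u x) = ift g x"
    by (auto simp: fourier_rep_def)
  note [measurable] = sobolev_data_measurable[OF g]
  define k where "k \<omega> = (cis b / 2) * g (\<omega> - a) + (cis (- b) / 2) * g (\<omega> - (- a))" for \<omega>
  have kd: "sobolev_data s k"
    unfolding k_def by (intro sobolev_data_add sobolev_data_cmult sobolev_data_shift g s0)
  have i: "integrable lborel (\<lambda>\<omega>. c * g (\<omega> - d))" for c d
    by (rule sobolev_data_integrable[OF sobolev_data_cmult(1)[OF sobolev_data_shift[OF g s0]] s])
  have "ift k x = complex_of_real (cos (a \<bullet> x + b)) * ift g x" for x
  proof -
    have "ift k x = (cis b / 2) * (cis (x \<bullet> a) * ift g x) + (cis (- b) / 2) * (cis (x \<bullet> (- a)) *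
        ift g x)"
      unfolding k_def ift_add[OF i i] ift_mult_left
      by (simp only: ift_shift[OF sobolev_data_measurable[OF g]])
    also have "\<dots> = (cis (a \<bullet> x + b) + cis (- (a \<bullet> x + b))) / 2 * ift g x"
    proof -
      have "cis (a \<bullet> x + b) = cis b * cis (x \<bullet> a)" by (simp add: cis_mult inner_commute add.commute)
      moreover have "cis (- (a \<bullet> x + b)) = cis (- b) * cis (x \<bullet> (- a))"
        by (simp add: cis_mult inner_commute algebra_simps)
      ultimately show ?thesis by (simp only: add_divide_distrib distrib_right times_divide_eq_left
          mult.assoc)
    qed
    also have "(cis (a \<bullet> x + b) + cis (- (a \<bullet> x + b))) / 2 = complex_of_real (cos (a \<bullet> x + b))"
      by (rule cos_cis)
    finally show ?thesis .
  qed
  then have "fourier_rep s \<Omega> (\<lambda>x. cos (a \<bullet> x + b) * u x) k"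
    using kd re ug by (auto simp: fourier_rep_def)
  then show ?thesis using sobolev_space_iff[OF assms(1,2)] by blast
qed

text \<open>The transform is the indicator function of the unit ball, modulated so that the phases cancel
  in the integral at \<open>x\<^sub>0\<close>; every Sobolev weight is integrable over the ball.\<close>

lemma sobolev_space_nonvanishing:
  fixes \<Omega> :: "'a::euclidean_space set"
  assumes "open \<Omega>" and s: "s > real DIM('a) / 2"
  shows "\<exists>u\<in>sobolev_space s \<Omega>. u x0 \<noteq> 0"
proof -
  have s0: "0 \<le> s" using s order_trans[of 0 "real DIM('a) / 2" s] by simp
  define g where "g \<omega> = complex_of_real (indicator (cball 0 1) \<omega>) * cis (- (x0 \<bullet> \<omega>))" for \<omega>
  have ind: "(\<lambda>\<omega>::'a. indicator (cball 0 1) \<omega> :: real) \<in> borel_measurable borel"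
    by (intro borel_measurable_indicator) auto
  have [measurable]: "g \<in> borel_measurable borel"
    unfolding g_def
    by (intro borel_measurable_times measurable_compose[OF ind borel_measurable_of_real]) measurable
  have ii: "integrable lborel (\<lambda>\<omega>::'a. indicator (cball 0 1) \<omega> :: real)"
    by (intro integrable_real_indicator emeasure_bounded_finite) auto
  have d: "sobolev_data s g"
    unfolding sobolev_data_def
  proof
    show "integrable lborel (\<lambda>\<omega>. weight s \<omega> * (cmod (g \<omega>))\<^sup>2)"
    proof (rule Bochner_Integration.integrable_bound)
      show "integrable lborel (\<lambda>\<omega>::'a. 2 powr s * indicator (cball 0 1) \<omega> :: real)" using ii by simp
      have "weight s \<omega> * (cmod (g \<omega>))\<^sup>2 \<le> 2 powr s * indicator (cball 0 1) \<omega>" for \<omega>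
      proof (cases "norm \<omega> \<le> 1")
        case True
        then have "weight s \<omega> \<le> 2 powr s"
          unfolding weight_def using s0 power_le_one[of "norm \<omega>" 2] by (intro powr_mono2) auto
        then show ?thesis using True by (simp add: g_def norm_mult)
      qed (simp add: g_def)
      then show "AE \<omega> in lborel. norm (weight s \<omega> * (cmod (g \<omega>))\<^sup>2)
          \<le> norm (2 powr s * indicator (cball 0 1) \<omega> :: real)"
        by (intro AE_I2) (simp add: abs_mult)
    qed measurable
  qed measurable
  have "cnj (ift g x) = ift g x" for x
  proof -
    have "cnj (g \<omega>) = g (- \<omega>)" for \<omega> by (simp add: g_def cis_cnj indicator_def)
    then show ?thesis using ift_reflect[of g "- x"] by (simp add: ift_cnj)
  qed
  then have re: "ift g x \<in> \<real>" for x by (metis Reals_cnj_iff)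
  have rep: "fourier_rep s \<Omega> (\<lambda>x. Re (ift g x)) g" using d re by (simp add: fourier_rep_def)
  have "g \<omega> * cis (x0 \<bullet> \<omega>) = complex_of_real (indicator (cball 0 1) \<omega>)" for \<omega>
    by (simp add: g_def mult.assoc cis_mult)
  then have "ift g x0 = (2 * pi) powr (- real DIM('a) / 2) *\<^sub>R complex_of_real (integral\<^sup>L
      lborel (\<lambda>\<omega>::'a. indicator (cball 0 1) \<omega> :: real))"
    unfolding ift_def by (simp only: integral_complex_of_real)
  moreover have "integral\<^sup>L lborel (\<lambda>\<omega>::'a. indicator (cball 0 1) \<omega> :: real) > 0"
    by (simp add: content_cball_pos)
  ultimately have "Re (ift g x0) \<noteq> 0" by simp
  moreover have "(\<lambda>x. Re (ift g x)) \<in> sobolev_space s \<Omega>" using rep sobolev_space_iff[OF assms]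
    by blast
  ultimately show ?thesis by (rule bexI)
qed

lemma sobolev_space_differentiable:
  fixes \<Omega> :: "'a::euclidean_space set"
  assumes "open \<Omega>" and \<sigma>: "\<sigma> > real DIM('a) / 2 + 1" and u: "u \<in> sobolev_space \<sigma> \<Omega>" and "x \<in> \<Omega>"
  shows "u differentiable (at x)"
  using fourier_rep_derivative(1)[OF assms(1) \<sigma>] sobolev_space_iff[OF assms(1), of \<sigma> u] u \<sigma> \<open>x \<in>
      \<Omega>\<close> by auto

text \<open>Starting from a function that does not vanish at \<open>x\<^sub>0\<close>, each point of \<open>P\<close> contributes a
  factor of the form \<open>(1 - cos) / 2\<close>, which vanishes to second order at that point and
  equals 1 at \<open>x\<^sub>0\<close>.\<close>

lemma sobolev_space_peak:
  fixes \<Omega> :: "'a::euclidean_space set"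
  assumes "open \<Omega>" and \<sigma>: "\<sigma> > real DIM('a) / 2 + 1" and "finite P" "P \<subseteq> \<Omega>" "x0 \<notin> P" "x0 \<in> \<Omega>"
  shows "\<exists>u\<in>sobolev_space \<sigma> \<Omega>. u x0 = 1 \<and> (\<forall>z\<in>P. u z = 0 \<and> (u has_derivative (\<lambda>_. 0)) (at z))"
  using assms(3-5)
proof (induction P rule: finite_induct)
  case empty
  obtain u where u: "u \<in> sobolev_space \<sigma> \<Omega>" "u x0 \<noteq> 0"
    using sobolev_space_nonvanishing[OF assms(1), of \<sigma> x0] \<sigma> by auto
  have "(\<lambda>x. (1 / u x0) * u x) \<in> sobolev_space \<sigma> \<Omega>"
    using \<sigma> by (intro sobolev_space_cmult u assms(1)) auto
  then show ?case using u(2) by (intro bexI[of _ "\<lambda>x. (1 / u x0) * u x"]) auto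
next
  case (insert w P)
  then obtain u where u: "u \<in> sobolev_space \<sigma> \<Omega>" "u x0 = 1"
    and uP: "\<And>z. z \<in> P \<Longrightarrow> u z = 0 \<and> (u has_derivative (\<lambda>_. 0)) (at z)" by auto
  have w: "w \<in> \<Omega>" "w \<noteq> x0" using insert by auto
  \<comment> \<open>With this frequency the cosine equals \<open>- 1\<close> at \<open>x0\<close> and 1 at \<open>w\<close>.\<close>
  define a where "a = (pi / (norm (x0 - w))\<^sup>2) *\<^sub>R (x0 - w)"
  define c where "c x = (1 - cos (a \<bullet> (x - w))) / 2" for x
  define v where "v x = c x * u x" for x
  have "a \<bullet> (x0 - w) = pi" using w(2) by (simp add: a_def power2_norm_eq_inner)
  then have cx0: "c x0 = 1" by (simp add: c_def)
  have veq: "v = (\<lambda>x. (1 / 2) * u x + (- 1 / 2) * (cos (a \<bullet> x + - (a \<bullet> w)) * u x))"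
    by (simp add: v_def c_def inner_diff_right field_simps fun_eq_iff)
  have "v \<in> sobolev_space \<sigma> \<Omega>"
    unfolding veq using \<sigma>
    by (intro sobolev_space_add sobolev_space_cmult sobolev_space_mult_cos u assms(1)) auto
  have cder: "(c has_derivative (\<lambda>h. sin (a \<bullet> (x - w)) * (a \<bullet> h) / 2)) (at x)" for x
    unfolding c_def by (auto intro!: derivative_eq_intros)
  have vder: "(v has_derivative (\<lambda>h. c x * D h + (sin (a \<bullet> (x - w)) * (a \<bullet> h) / 2) * u x)) (at x)"
    if "(u has_derivative D) (at x)" for x D
    unfolding v_def by (rule has_derivative_mult[OF cder that])
  have "v z = 0 \<and> (v has_derivative (\<lambda>_. 0)) (at z)" if "z \<in> insert w P" for z
  proof (cases "z = w")
    case True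
    obtain D where "(u has_derivative D) (at w)"
      using sobolev_space_differentiable[OF assms(1) \<sigma> u(1) w(1)] by (auto simp: differentiable_def)
    from vder[OF this] show ?thesis by (simp add: True v_def c_def)
  next
    case False
    then have "z \<in> P" using that by simp
    from vder[OF conjunct2[OF uP[OF this]]] uP[OF this] show ?thesis by (simp add: v_def)
  qed
  moreover have "v x0 = 1" using u(2) cx0 by (simp add: v_def)
  ultimately show ?case using \<open>v \<in> sobolev_space \<sigma> \<Omega>\<close> by blast
qed

text \<open>A function from the preceding lemma is multiplied by a sine that vanishes at \<open>x\<^sub>0\<close>.\<close>

lemma sobolev_space_slope:
  fixes \<Omega> :: "'a::euclidean_space set"
  assumes "open \<Omega>" and \<sigma>: "\<sigma> > real DIM('a) / 2 + 1" and "finite P" "P \<subseteq> \<Omega>" "x0 \<notin> P" "x0 \<in> \<Omega>"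
      and "w \<noteq> 0"
  shows "\<exists>u\<in>sobolev_space \<sigma> \<Omega>. u x0 = 0 \<and> frechet_derivative u (at x0) w = 1 \<and>
    (\<forall>z\<in>P. u z = 0 \<and> (u has_derivative (\<lambda>_. 0)) (at z))"
proof -
  obtain u where u: "u \<in> sobolev_space \<sigma> \<Omega>" "u x0 = 1"
    and uP: "\<And>z. z \<in> P \<Longrightarrow> u z = 0 \<and> (u has_derivative (\<lambda>_. 0)) (at z)"
    using sobolev_space_peak[OF assms(1-6)] by auto
  define d where "d = 1 / (norm w)\<^sup>2"
  \<comment> \<open>The phase turns the cosine into the sine of \<open>w \<bullet> (x - x0)\<close>.\<close>
  define c where "c x = d * cos (w \<bullet> x + (- (w \<bullet> x0) - pi / 2))" for x
  define v where "v x = c x * u x" for x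
  have c: "c x = d * sin (w \<bullet> (x - x0))" for x
    using sin_cos_eq[of "w \<bullet> (x - x0)"] cos_minus[of "pi / 2 - w \<bullet> (x - x0)"]
    by (simp add: c_def inner_diff_right algebra_simps)
  have veq: "v = (\<lambda>x. d * (cos (w \<bullet> x + (- (w \<bullet> x0) - pi / 2)) * u x))"
    by (simp add: v_def c_def mult.assoc fun_eq_iff)
  have "v \<in> sobolev_space \<sigma> \<Omega>"
    unfolding veq using \<sigma> by (intro sobolev_space_cmult sobolev_space_mult_cos u assms(1)) auto
  have cder: "(c has_derivative (\<lambda>h. d * (cos (w \<bullet> (x - x0)) * (w \<bullet> h)))) (at x)" for x
    unfolding c[abs_def] by (auto intro!: derivative_eq_intros)
  have vder: "(v has_derivative (\<lambda>h. c x * D h + d * (cos (w \<bullet> (x - x0)) * (w \<bullet> h)) * u x)) (at x)"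
    if "(u has_derivative D) (at x)" for x D
    unfolding v_def by (rule has_derivative_mult[OF cder that])
  have "v z = 0 \<and> (v has_derivative (\<lambda>_. 0)) (at z)" if "z \<in> P" for z
    using vder[OF conjunct2[OF uP[OF that]]] uP[OF that] by (simp add: v_def)
  moreover have "v x0 = 0" by (simp add: v_def c)
  moreover have "frechet_derivative v (at x0) w = 1"
  proof -
    obtain D where "(u has_derivative D) (at x0)"
      using sobolev_space_differentiable[OF assms(1) \<sigma> u(1) \<open>x0 \<in> \<Omega>\<close>]
      by (auto simp: differentiable_def)
    from frechet_derivative_at[OF vder[OF this]]
    have "frechet_derivative v (at x0) = (\<lambda>h. d * (w \<bullet> h))" using u(2) by (simp add: c)
    then show ?thesis using \<open>w \<noteq> 0\<close> by (simp add: d_def power2_norm_eq_inner)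
  qed
  ultimately show ?thesis using \<open>v \<in> sobolev_space \<sigma> \<Omega>\<close> by blast
qed

section \<open>Norm estimates in Sobolev spaces\<close>

text \<open>The factor 2 comes from \<open>\<bar>a + b\<bar>\<^sup>2 \<le> 2 \<bar>a\<bar>\<^sup>2 + 2 \<bar>b\<bar>\<^sup>2\<close>, which replaces the Minkowski
  inequality.\<close>

lemma sobolev_norm_add_le:
  fixes \<Omega> :: "'a::euclidean_space set"
  assumes \<Omega>: "open \<Omega>" and s: "s > real DIM('a) / 2" and u: "u \<in> sobolev_space s \<Omega>"
      and v: "v \<in> sobolev_space s \<Omega>"
  shows "sobolev_norm s \<Omega> (\<lambda>x. u x + v x) \<le> 2 * (sobolev_norm s \<Omega> u + sobolev_norm s \<Omega> v)"
proof -
  have "sobolev_norm s \<Omega> (\<lambda>x. u x + v x) - 2 * sobolev_norm s \<Omega> u \<le> 2 * sobolev_norm s \<Omega> v"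
  proof (rule le_sobolev_normI[OF \<Omega> s v])
    fix k assume k: "fourier_rep s \<Omega> v k"
    have "sobolev_norm s \<Omega> (\<lambda>x. u x + v x) - 2 * data_norm s k \<le> 2 * sobolev_norm s \<Omega> u"
    proof (rule le_sobolev_normI[OF \<Omega> s u])
      fix g assume g: "fourier_rep s \<Omega> u g"
      have "sobolev_norm s \<Omega> (\<lambda>x. u x + v x) \<le> data_norm s (\<lambda>\<omega>. g \<omega> + k \<omega>)"
        by (rule sobolev_norm_le[OF s fourier_rep_add[OF s g k]])
      also have "\<dots> \<le> 2 * (data_norm s g + data_norm s k)"
        using g k by (intro sobolev_data_add(2)) (auto simp: fourier_rep_def)
      finally show "sobolev_norm s \<Omega> (\<lambda>x. u x + v x) - 2 * data_norm s k \<le> 2 * data_norm s g"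
        by simp
    qed simp
    then show "sobolev_norm s \<Omega> (\<lambda>x. u x + v x) - 2 * sobolev_norm s \<Omega> u \<le> 2 * data_norm s k"
      by simp
  qed simp
  then show ?thesis by simp
qed

lemma sobolev_norm_cmult_le:
  fixes \<Omega> :: "'a::euclidean_space set"
  assumes \<Omega>: "open \<Omega>" and s: "s > real DIM('a) / 2" and u: "u \<in> sobolev_space s \<Omega>"
  shows "sobolev_norm s \<Omega> (\<lambda>x. c * u x) \<le> \<bar>c\<bar> * sobolev_norm s \<Omega> u"
proof (rule le_sobolev_normI[OF \<Omega> s u])
  fix g assume g: "fourier_rep s \<Omega> u g"
  have "sobolev_norm s \<Omega> (\<lambda>x. c * u x) \<le> data_norm s (\<lambda>\<omega>. complex_of_real c * g \<omega>)"
    by (rule sobolev_norm_le[OF s fourier_rep_cmult[OF g]])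
  also have "\<dots> \<le> cmod (complex_of_real c) * data_norm s g"
    using g by (intro sobolev_data_cmult(2)) (simp add: fourier_rep_def)
  finally show "sobolev_norm s \<Omega> (\<lambda>x. c * u x) \<le> \<bar>c\<bar> * data_norm s g" by simp
qed simp

lemma sobolev_space_algebra:
  fixes \<Omega> :: "'a::euclidean_space set"
  assumes \<Omega>: "open \<Omega>" and s: "s > real DIM('a) / 2"
  shows "\<exists>C\<ge>0. \<forall>u\<in>sobolev_space s \<Omega>. \<forall>v\<in>sobolev_space s \<Omega>. (\<lambda>x. u x * v x) \<in> sobolev_space s \<Omega> \<and>
    sobolev_norm s \<Omega> (\<lambda>x. u x * v x) \<le> C * sobolev_norm s \<Omega> u * sobolev_norm s \<Omega> v"
proof -
  obtain C where C: "0 \<le> C" and mult: "\<And>u v g k. fourier_rep s \<Omega> u g \<Longrightarrow> fourier_rep s \<Omega> v k \<Longrightarrow>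
    \<exists>p. fourier_rep s \<Omega> (\<lambda>x. u x * v x) p \<and> data_norm s p \<le> C * data_norm s g * data_norm s k"
    using fourier_rep_mult[OF s, of \<Omega>] by blast
  have "(\<lambda>x. u x * v x) \<in> sobolev_space s \<Omega> \<and>
    sobolev_norm s \<Omega> (\<lambda>x. u x * v x) \<le> C * sobolev_norm s \<Omega> u * sobolev_norm s \<Omega> v"
    if u: "u \<in> sobolev_space s \<Omega>" and v: "v \<in> sobolev_space s \<Omega>" for u v
  proof
    show "(\<lambda>x. u x * v x) \<in> sobolev_space s \<Omega>"
      using u v mult unfolding sobolev_space_iff[OF \<Omega> s] by blast
    show "sobolev_norm s \<Omega> (\<lambda>x. u x * v x) \<le> C * sobolev_norm s \<Omega> u * sobolev_norm s \<Omega> v"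
    proof (rule le_sobolev_normI[OF \<Omega> s v])
      show "0 \<le> C * sobolev_norm s \<Omega> u" using C sobolev_norm_nonneg[OF u] by simp
      fix k assume k: "fourier_rep s \<Omega> v k"
      have "sobolev_norm s \<Omega> (\<lambda>x. u x * v x) \<le> C * data_norm s k * sobolev_norm s \<Omega> u"
      proof (rule le_sobolev_normI[OF \<Omega> s u])
        show "0 \<le> C * data_norm s k" using C by simp
        fix g assume g: "fourier_rep s \<Omega> u g"
        obtain p where p: "fourier_rep s \<Omega> (\<lambda>x. u x * v x) p" "data_norm s p
            \<le> C * data_norm s g * data_norm s k"
          using mult[OF g k] by blast
        show "sobolev_norm s \<Omega> (\<lambda>x. u x * v x) \<le> C * data_norm s k * data_norm s g"
          using sobolev_norm_le[OF s p(1)] p(2) by (simp add: mult_ac)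
      qed
      then show "sobolev_norm s \<Omega> (\<lambda>x. u x * v x) \<le> C * sobolev_norm s \<Omega> u * data_norm s k"
        by (simp add: mult_ac)
    qed
  qed
  with C show ?thesis by blast
qed

lemma sobolev_space_partial_derivative:
  fixes \<Omega> :: "'a::euclidean_space set"
  assumes \<Omega>: "open \<Omega>" and \<sigma>: "\<sigma> > real DIM('a) / 2 + 1" and u: "u \<in> sobolev_space \<sigma> \<Omega>" and "norm v
      \<le> 1"
  shows "(\<lambda>x. frechet_derivative u (at x) v) \<in> sobolev_space (\<sigma> - 1) \<Omega>"
    and "sobolev_norm (\<sigma> - 1) \<Omega> (\<lambda>x. frechet_derivative u (at x) v) \<le> sobolev_norm \<sigma> \<Omega> u"
proof -
  have s: "\<sigma> - 1 > real DIM('a) / 2" and s': "\<sigma> > real DIM('a) / 2" using \<sigma> by auto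
  note rep = fourier_rep_derivative(2)[OF \<Omega> \<sigma> _ \<open>norm v \<le> 1\<close>]
  show "(\<lambda>x. frechet_derivative u (at x) v) \<in> sobolev_space (\<sigma> - 1) \<Omega>"
    using u rep unfolding sobolev_space_iff[OF \<Omega> s] sobolev_space_iff[OF \<Omega> s'] by blast
  have "sobolev_norm (\<sigma> - 1) \<Omega> (\<lambda>x. frechet_derivative u (at x) v) \<le> 1 * sobolev_norm \<sigma> \<Omega> u"
  proof (rule le_sobolev_normI[OF \<Omega> s' u])
    fix g assume g: "fourier_rep \<sigma> \<Omega> u g"
    have "sobolev_data \<sigma> g" using g by (simp add: fourier_rep_def)
    from sobolev_norm_le[OF s rep[OF g]] sobolev_data_derivative(2)[OF this \<open>norm v \<le> 1\<close>]
    show "sobolev_norm (\<sigma> - 1) \<Omega> (\<lambda>x. frechet_derivative u (at x) v) \<le> 1 * data_norm \<sigma> g" by simp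
  qed simp
  then show "sobolev_norm (\<sigma> - 1) \<Omega> (\<lambda>x. frechet_derivative u (at x) v) \<le> sobolev_norm \<sigma> \<Omega> u"
    by simp
qed

lemma sobolev_space_weaken:
  fixes \<Omega> :: "'a::euclidean_space set"
  assumes \<Omega>: "open \<Omega>" and s: "s > real DIM('a) / 2" and "s \<le> \<sigma>" and u: "u \<in> sobolev_space \<sigma> \<Omega>"
  shows "u \<in> sobolev_space s \<Omega>" and "sobolev_norm s \<Omega> u \<le> sobolev_norm \<sigma> \<Omega> u"
proof -
  have \<sigma>: "\<sigma> > real DIM('a) / 2" using assms by simp
  note rep = fourier_rep_weaken[OF _ \<open>s \<le> \<sigma>\<close>, of \<Omega> u]
  show "u \<in> sobolev_space s \<Omega>"
    using u rep unfolding sobolev_space_iff[OF \<Omega> s] sobolev_space_iff[OF \<Omega> \<sigma>] by blast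
  have "sobolev_norm s \<Omega> u \<le> 1 * sobolev_norm \<sigma> \<Omega> u"
  proof (rule le_sobolev_normI[OF \<Omega> \<sigma> u])
    fix g assume g: "fourier_rep \<sigma> \<Omega> u g"
    have "sobolev_data \<sigma> g" using g by (simp add: fourier_rep_def)
    from sobolev_norm_le[OF s rep[OF g]] sobolev_data_weaken(2)[OF this \<open>s \<le> \<sigma>\<close>]
    show "sobolev_norm s \<Omega> u \<le> 1 * data_norm \<sigma> g" by simp
  qed simp
  then show "sobolev_norm s \<Omega> u \<le> sobolev_norm \<sigma> \<Omega> u" by simp
qed

section \<open>Bounded operators on matrix-valued functions\<close>

definition entry_norm :: "real \<Rightarrow> (real^'n) set \<Rightarrow> (real^'n \<Rightarrow> real^'n^'n) \<Rightarrow> real" where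
  "entry_norm \<sigma> \<Omega> M = (\<Sum>i\<in>UNIV. \<Sum>j\<in>UNIV. sobolev_norm \<sigma> \<Omega> (\<lambda>x. M x $ i $ j))"

text \<open>Scalar components of operators on symmetric matrix functions. The closure properties below
  reduce the boundedness of \<^const>\<open>matrix_op\<close> to that of the entries and of their partial
  derivatives.\<close>

definition bounded_op ::
    "real \<Rightarrow> real \<Rightarrow> (real^'n) set \<Rightarrow> ((real^'n \<Rightarrow> real^'n^'n) \<Rightarrow> real^'n \<Rightarrow> real) \<Rightarrow> bool" where
  "bounded_op \<sigma> s \<Omega> T \<longleftrightarrow> (\<exists>K\<ge>0. \<forall>M\<in>sobolev_symmat \<sigma> \<Omega>.
    T M \<in> sobolev_space s \<Omega> \<and> sobolev_norm s \<Omega> (T M) \<le> K * entry_norm \<sigma> \<Omega> M)"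

lemma sobolev_symmat_entry: "M \<in> sobolev_symmat \<sigma> \<Omega> \<Longrightarrow> (\<lambda>x. M x $ i $ j) \<in> sobolev_space \<sigma> \<Omega>"
  by (simp add: sobolev_symmat_def sobolev_mat_def)

lemma entry_le_entry_norm:
  assumes "M \<in> sobolev_symmat \<sigma> \<Omega>"
  shows "sobolev_norm \<sigma> \<Omega> (\<lambda>x. M x $ i $ j) \<le> entry_norm \<sigma> \<Omega> M"
proof -
  have n: "0 \<le> sobolev_norm \<sigma> \<Omega> (\<lambda>x. M x $ i $ j)" for i j
    by (rule sobolev_norm_nonneg[OF sobolev_symmat_entry[OF assms]])
  have "sobolev_norm \<sigma> \<Omega> (\<lambda>x. M x $ i $ j) \<le> (\<Sum>j\<in>UNIV. sobolev_norm \<sigma> \<Omega> (\<lambda>x. M x $ i $ j))"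
    by (rule member_le_sum) (auto simp: n)
  also have "\<dots> \<le> entry_norm \<sigma> \<Omega> M"
    unfolding entry_norm_def
    by (rule member_le_sum[of i UNIV "\<lambda>i. \<Sum>j\<in>UNIV. sobolev_norm \<sigma> \<Omega> (\<lambda>x. M x $ i $ j)"]) (auto
        intro!: sum_nonneg n)
  finally show ?thesis .
qed

lemma entry_norm_nonneg: "M \<in> sobolev_symmat \<sigma> \<Omega> \<Longrightarrow> 0 \<le> entry_norm \<sigma> \<Omega> M"
  unfolding entry_norm_def by (intro sum_nonneg sobolev_norm_nonneg sobolev_symmat_entry)

lemma bounded_op_add:
  fixes \<Omega> :: "(real^'n) set"
  assumes \<Omega>: "open \<Omega>" and s: "s > real CARD('n) / 2" and T: "bounded_op \<sigma> s \<Omega> T"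
      and U: "bounded_op \<sigma> s \<Omega> U"
  shows "bounded_op \<sigma> s \<Omega> (\<lambda>M x. T M x + U M x)"
proof -
  have s': "s > real DIM(real^'n) / 2" using s by simp
  obtain K where K: "0 \<le> K" "\<And>M. M \<in> sobolev_symmat \<sigma> \<Omega> \<Longrightarrow> T M \<in> sobolev_space s \<Omega>
      \<and> sobolev_norm s \<Omega> (T M) \<le> K * entry_norm \<sigma> \<Omega> M"
    using T unfolding bounded_op_def by blast
  obtain L where L: "0 \<le> L" "\<And>M. M \<in> sobolev_symmat \<sigma> \<Omega> \<Longrightarrow> U M \<in> sobolev_space s \<Omega>
      \<and> sobolev_norm s \<Omega> (U M) \<le> L * entry_norm \<sigma> \<Omega> M"
    using U unfolding bounded_op_def by blast
  have "(\<lambda>x. T M x + U M x) \<in> sobolev_space s \<Omega> \<and>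
      sobolev_norm s \<Omega> (\<lambda>x. T M x + U M x) \<le> (2 * (K + L)) * entry_norm \<sigma> \<Omega> M" if M:
          "M \<in> sobolev_symmat \<sigma> \<Omega>" for M
  proof
    have t: "T M \<in> sobolev_space s \<Omega>" and u: "U M \<in> sobolev_space s \<Omega>" using K L M by auto
    show "(\<lambda>x. T M x + U M x) \<in> sobolev_space s \<Omega>" by (rule sobolev_space_add[OF \<Omega> s' t u])
    show "sobolev_norm s \<Omega> (\<lambda>x. T M x + U M x) \<le> (2 * (K + L)) * entry_norm \<sigma> \<Omega> M"
      using sobolev_norm_add_le[OF \<Omega> s' t u] K(2)[OF M] L(2)[OF M] by (simp add: algebra_simps)
  qed
  then show ?thesis unfolding bounded_op_def using K(1) L(1) by (intro exI[of _ "2 * (K + L)"]) auto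
qed

lemma bounded_op_zero:
  fixes \<Omega> :: "(real^'n) set"
  assumes \<Omega>: "open \<Omega>" and s: "s > real CARD('n) / 2"
  shows "bounded_op \<sigma> s \<Omega> (\<lambda>M x. 0)"
proof -
  have s': "s > real DIM(real^'n) / 2" using s by simp
  have r: "fourier_rep s \<Omega> (\<lambda>x. 0) (\<lambda>_. 0)" by (simp add: fourier_rep_def sobolev_data_def ift_def)
  have "sobolev_norm s \<Omega> (\<lambda>x. 0) \<le> 0" using sobolev_norm_le[OF s' r] by (simp add: data_norm_def)
  moreover have "(\<lambda>x. 0) \<in> sobolev_space s \<Omega>" using r sobolev_space_iff[OF \<Omega> s'] by blast
  ultimately show ?thesis unfolding bounded_op_def by (intro exI[of _ 0]) auto
qed

lemma bounded_op_sum: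
  fixes \<Omega> :: "(real^'n) set"
  assumes \<Omega>: "open \<Omega>" and s: "s > real CARD('n) / 2" and "finite I" and "\<And>k. k \<in> I
      \<Longrightarrow> bounded_op \<sigma> s \<Omega> (T k)"
  shows "bounded_op \<sigma> s \<Omega> (\<lambda>M x. \<Sum>k\<in>I. T k M x)"
  using assms(3,4)
proof (induction I rule: finite_induct)
  case empty
  then show ?case by (simp add: bounded_op_zero[OF \<Omega> s])
next
  case (insert k I)
  then show ?case using bounded_op_add[OF \<Omega> s, of \<sigma> "T k" "\<lambda>M x. \<Sum>k\<in>I. T k M x"] by simp
qed

lemma bounded_op_mult:
  fixes \<Omega> :: "(real^'n) set"
  assumes \<Omega>: "open \<Omega>" and s: "s > real CARD('n) / 2" and T: "bounded_op \<sigma> s \<Omega> T"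
      and v: "v \<in> sobolev_space s \<Omega>"
  shows "bounded_op \<sigma> s \<Omega> (\<lambda>M x. T M x * v x)"
proof -
  have s': "s > real DIM(real^'n) / 2" using s by simp
  obtain K where K: "0 \<le> K" "\<And>M. M \<in> sobolev_symmat \<sigma> \<Omega> \<Longrightarrow> T M \<in> sobolev_space s \<Omega>
      \<and> sobolev_norm s \<Omega> (T M) \<le> K * entry_norm \<sigma> \<Omega> M"
    using T unfolding bounded_op_def by blast
  obtain C where C: "0 \<le> C" "\<And>u v. u\<in>sobolev_space s \<Omega> \<Longrightarrow> v\<in>sobolev_space s \<Omega>
      \<Longrightarrow> (\<lambda>x. u x * v x) \<in> sobolev_space s \<Omega> \<and>
    sobolev_norm s \<Omega> (\<lambda>x. u x * v x) \<le> C * sobolev_norm s \<Omega> u * sobolev_norm s \<Omega> v"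
    using sobolev_space_algebra[OF \<Omega> s'] by blast
  have n: "0 \<le> sobolev_norm s \<Omega> v" by (rule sobolev_norm_nonneg[OF v])
  have "sobolev_norm s \<Omega> (\<lambda>x. T M x * v x) \<le> (C * K * sobolev_norm s \<Omega> v) * entry_norm \<sigma> \<Omega> M"
    if M: "M \<in> sobolev_symmat \<sigma> \<Omega>" for M
  proof -
    have "sobolev_norm s \<Omega> (\<lambda>x. T M x * v x) \<le> C * sobolev_norm s \<Omega> (T M) * sobolev_norm s \<Omega> v"
      using C(2)[OF _ v] K(2)[OF M] by blast
    also have "\<dots> \<le> C * (K * entry_norm \<sigma> \<Omega> M) * sobolev_norm s \<Omega> v"
      using K(2)[OF M] C(1) n by (intro mult_right_mono mult_left_mono) auto
    finally show ?thesis by (simp add: mult_ac)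
  qed
  then show ?thesis unfolding bounded_op_def
    using K C v n by (intro exI[of _ "C * K * sobolev_norm s \<Omega> v"]) auto
qed

lemma matrix_op_entry:
  "matrix_op V f M x $ i $ j =
    (\<Sum>k\<in>UNIV. M x $ k $ j * V x $ k $ i) + (\<Sum>k\<in>UNIV. M x $ i $ k * V x $ k $ j) +
    (\<Sum>k\<in>UNIV. frechet_derivative (\<lambda>y. M y $ i $ j) (at x) (axis k 1) * f x $ k)"
  by (simp add: matrix_op_def matrix_matrix_mult_def transpose_def gradient_def inner_vec_def
      mult.commute)

lemma matrix_op_bounded:
  fixes \<Omega> :: "(real^'n) set" and V :: "real^'n \<Rightarrow> real^'n^'n" and f :: "real^'n \<Rightarrow> real^'n"
  assumes \<Omega>: "open \<Omega>" and \<sigma>: "\<sigma> > real CARD('n) / 2 + 1"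
    and V: "V \<in> sobolev_mat (\<sigma> - 1) \<Omega>" and f: "f \<in> sobolev_vec (\<sigma> - 1) \<Omega>"
  shows "bounded_op \<sigma> (\<sigma> - 1) \<Omega> (\<lambda>M x. matrix_op V f M x $ i $ j)"
proof -
  have s: "\<sigma> - 1 > real CARD('n) / 2" and s': "\<sigma> - 1 > real DIM(real^'n) / 2"
      and \<sigma>': "\<sigma> > real DIM(real^'n) / 2 + 1"
    using \<sigma> by auto
  have e: "bounded_op \<sigma> (\<sigma> - 1) \<Omega> (\<lambda>M x. M x $ i $ j)" for i j
    unfolding bounded_op_def
  proof (rule exI[of _ 1], intro conjI ballI)
    fix M :: "real^'n \<Rightarrow> real^'n^'n" assume M: "M \<in> sobolev_symmat \<sigma> \<Omega>"
    note w = sobolev_space_weaken[OF \<Omega> s' _ sobolev_symmat_entry[OF M]]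
    show "(\<lambda>x. M x $ i $ j) \<in> sobolev_space (\<sigma> - 1) \<Omega>" by (rule w) simp
    show "sobolev_norm (\<sigma> - 1) \<Omega> (\<lambda>x. M x $ i $ j) \<le> 1 * entry_norm \<sigma> \<Omega> M"
      using w(2)[of i j] entry_le_entry_norm[OF M, of i j] by simp
  qed simp
  have d: "bounded_op \<sigma> (\<sigma> - 1) \<Omega> (\<lambda>M x. frechet_derivative (\<lambda>y. M y $ i $ j) (at x) (axis k 1))"
      for i j k
    unfolding bounded_op_def
  proof (rule exI[of _ 1], intro conjI ballI)
    fix M :: "real^'n \<Rightarrow> real^'n^'n" assume M: "M \<in> sobolev_symmat \<sigma> \<Omega>"
    have "norm (axis k 1 :: real^'n) \<le> 1" by simp
    note w = sobolev_space_partial_derivative[OF \<Omega> \<sigma>' sobolev_symmat_entry[OF M] this]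
    show "(\<lambda>x. frechet_derivative (\<lambda>y. M y $ i $ j) (at x) (axis k 1)) \<in> sobolev_space (\<sigma> - 1) \<Omega>"
      by (rule w)
    show "sobolev_norm (\<sigma> - 1) \<Omega> (\<lambda>x. frechet_derivative (\<lambda>y. M y $ i $ j) (at x) (axis k 1))
        \<le> 1 * entry_norm \<sigma> \<Omega> M"
      using w(2)[of i j] entry_le_entry_norm[OF M, of i j] by simp
  qed simp
  have v: "(\<lambda>x. V x $ i $ j) \<in> sobolev_space (\<sigma> - 1) \<Omega>" "(\<lambda>x. f x $ i) \<in> sobolev_space (\<sigma> - 1) \<Omega>"
      for i j
    using V f by (auto simp: sobolev_mat_def sobolev_vec_def)
  show ?thesis
    unfolding matrix_op_entry
    by (intro bounded_op_add bounded_op_sum bounded_op_mult \<Omega> s e d v) auto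
qed

text \<open>On the open set \<open>\<Omega>\<close> two mirrored entries of \<open>M\<close> agree, hence so do their derivatives, and the
  two matrix products are transposes of each other.\<close>

lemma matrix_op_symmetric:
  fixes \<Omega> :: "(real^'n) set"
  assumes \<Omega>: "open \<Omega>" and \<sigma>: "\<sigma> > real CARD('n) / 2 + 1" and M: "M \<in> sobolev_symmat \<sigma> \<Omega>"
      and x: "x \<in> \<Omega>"
  shows "matrix_op V f M x $ i $ j = matrix_op V f M x $ j $ i"
proof -
  have sym: "M y $ i $ j = M y $ j $ i" if "y \<in> \<Omega>" for y i j
  proof -
    have "transpose (M y) $ j $ i = M y $ j $ i" using M that by (simp add: sobolev_symmat_def)
    then show ?thesis by (simp add: transpose_def)
  qed
  have \<sigma>': "\<sigma> > real DIM(real^'n) / 2 + 1" using \<sigma> by simp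
  have "frechet_derivative (\<lambda>y. M y $ i $ j) (at x) = frechet_derivative (\<lambda>y. M y $ j $ i) (at x)"
    by (rule frechet_derivative_transform_within_open[OF
          sobolev_space_differentiable[OF \<Omega> \<sigma>' sobolev_symmat_entry[OF M] x] \<Omega> x]) (rule sym)
  moreover have "(\<Sum>k\<in>UNIV. M x $ k $ j * V x $ k $ i) = (\<Sum>k\<in>UNIV. M x $ j $ k * V x $ k $ i)"
    by (simp only: sym[OF x, of _ j])
  moreover have "(\<Sum>k\<in>UNIV. M x $ k $ i * V x $ k $ j) = (\<Sum>k\<in>UNIV. M x $ i $ k * V x $ k $ j)"
    by (simp only: sym[OF x, of _ i])
  ultimately show ?thesis unfolding matrix_op_entry by simp
qed

lemma matrix_op_sobolev_symmat:
  fixes \<Omega> :: "(real^'n) set"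
  assumes \<Omega>: "open \<Omega>" and \<sigma>: "\<sigma> > real CARD('n) / 2 + 1"
    and V: "V \<in> sobolev_mat (\<sigma> - 1) \<Omega>" and f: "f \<in> sobolev_vec (\<sigma> - 1) \<Omega>"
        and M: "M \<in> sobolev_symmat \<sigma> \<Omega>"
  shows "matrix_op V f M \<in> sobolev_symmat (\<sigma> - 1) \<Omega>"
  using matrix_op_bounded[OF \<Omega> \<sigma> V f] matrix_op_symmetric[OF \<Omega> \<sigma> M] M
  by (auto simp: sobolev_symmat_def sobolev_mat_def bounded_op_def transpose_def vec_eq_iff)

lemma entry_functional_eq: "entry_functional V f x (k, i, j) M = matrix_op V f M (x k) $ i $ j"
  by (simp add: entry_functional_def inner_axis' matrix_vector_mult_basis column_def)

lemma gradient_inner: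
  assumes "u differentiable (at x)"
  shows "gradient u x \<bullet> w = frechet_derivative u (at x) w"
proof -
  have lin: "linear (frechet_derivative u (at x))" by (rule linear_frechet_derivative[OF assms])
  have "frechet_derivative u (at x) w = frechet_derivative u (at x) (\<Sum>k\<in>UNIV. w $ k *\<^sub>R axis k 1)"
    using basis_expansion[of w] by (simp add: scalar_mult_eq_scaleR)
  also have "\<dots> = (\<Sum>k\<in>UNIV. w $ k * frechet_derivative u (at x) (axis k 1))"
    using lin by (simp add: linear_sum linear_cmul)
  finally show ?thesis by (simp add: gradient_def inner_vec_def mult.commute)
qed

lemma sobolev_symmat_differentiable:
  fixes \<Omega> :: "(real^'n) set"
  assumes "open \<Omega>" and "\<sigma> > real CARD('n) / 2 + 1" and "M \<in> sobolev_symmat \<sigma> \<Omega>" and "x \<in> \<Omega>"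
  shows "(\<lambda>y. M y $ i $ j) differentiable (at x)"
  using assms by (intro sobolev_space_differentiable[of \<Omega> \<sigma>] sobolev_symmat_entry) auto

lemma matrix_op_add:
  assumes "\<And>i j. (\<lambda>y. M y $ i $ j) differentiable (at x)" "\<And>i j. (\<lambda>y. N y $ i $ j)
      differentiable (at x)"
  shows "matrix_op V f (\<lambda>y. M y + N y) x = matrix_op V f M x + matrix_op V f N x"
proof -
  have "frechet_derivative (\<lambda>y. M y $ i $ j + N y $ i $ j) (at x) =
     (\<lambda>h. frechet_derivative (\<lambda>y. M y $ i $ j) (at x) h + frechet_derivative (\<lambda>y. N y $ i $ j) (at
         x) h)" for i j
    using assms by (intro frechet_derivative_at[symmetric] has_derivative_add) (auto simp:
        frechet_derivative_works[symmetric])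
  then show ?thesis by (simp add: vec_eq_iff matrix_op_entry sum.distrib distrib_right)
qed

lemma matrix_op_scaleR:
  assumes "\<And>i j. (\<lambda>y. M y $ i $ j) differentiable (at x)"
  shows "matrix_op V f (\<lambda>y. c *\<^sub>R M y) x = c *\<^sub>R matrix_op V f M x"
proof -
  have "frechet_derivative (\<lambda>y. c * M y $ i $ j) (at x) =
     (\<lambda>h. c * frechet_derivative (\<lambda>y. M y $ i $ j) (at x) h)" for i j
    using assms by (intro frechet_derivative_at[symmetric] has_derivative_mult_right) (auto simp:
        frechet_derivative_works[symmetric])
  then show ?thesis by (simp add: vec_eq_iff matrix_op_entry sum_distrib_left distrib_left mult_ac)
qed

text \<open>The product rule for matrix functions of the form \<open>\<phi> E\<close>, which suffice for interpolation.\<close>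

lemma matrix_op_scalar_times_matrix:
  fixes \<phi> :: "real^'n \<Rightarrow> real"
  assumes \<phi>: "\<phi> differentiable (at x)"
  shows "matrix_op V f (\<lambda>y. \<phi> y *\<^sub>R E) x =
    \<phi> x *\<^sub>R (transpose (V x) ** E + E ** V x) + frechet_derivative \<phi> (at x) (f x) *\<^sub>R E"
proof -
  have d: "(\<lambda>y. \<phi> y * E $ i $ j) differentiable (at x)"
    and D: "frechet_derivative (\<lambda>y. \<phi> y * E $ i $ j) (at x)
        = (\<lambda>h. frechet_derivative \<phi> (at x) h * E $ i $ j)" for i j
  proof -
    have "((\<lambda>y. \<phi> y * E $ i $ j) has_derivative (\<lambda>h. frechet_derivative \<phi> (at x) h * E $ i $
        j)) (at x)"
      using \<phi> by (intro has_derivative_mult_left) (simp add: frechet_derivative_works[symmetric])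
    then show "(\<lambda>y. \<phi> y * E $ i $ j) differentiable (at x)"
      "frechet_derivative (\<lambda>y. \<phi> y * E $ i $ j) (at x)
          = (\<lambda>h. frechet_derivative \<phi> (at x) h * E $ i $ j)"
      by (auto simp: differentiable_def dest: frechet_derivative_at)
  qed
  show ?thesis
    by (simp add: vec_eq_iff matrix_op_def gradient_inner[OF d] D matrix_matrix_mult_def
        sum_distrib_left distrib_left mult_ac)
qed

section \<open>Linear independence\<close>

text \<open>Where \<open>f\<close> does not vanish the derivative part of the operator is prescribed; where it
  vanishes the algebraic part is, by solving a Lyapunov equation.\<close>

lemma matrix_interpolation:
  fixes \<Omega> :: "(real^'n) set"
  assumes \<Omega>: "open \<Omega>" and \<sigma>: "\<sigma> > real CARD('n) / 2 + 1"
    and spec: "f x0 = 0 \<Longrightarrow> (\<forall>\<mu>. complex_eigenvalue (V x0) \<mu> \<longrightarrow> Re \<mu> < 0)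
        \<or> (\<forall>\<mu>. complex_eigenvalue (V x0) \<mu> \<longrightarrow> Re \<mu> > 0)"
    and P: "finite P" "P \<subseteq> \<Omega>" "x0 \<notin> P" "x0 \<in> \<Omega>" and sym: "transpose E = E"
  shows "\<exists>M\<in>sobolev_symmat \<sigma> \<Omega>. matrix_op V f M x0 = E \<and> (\<forall>z\<in>P. matrix_op V f M z = 0)"
proof -
  have \<sigma>': "\<sigma> > real DIM(real^'n) / 2 + 1" "\<sigma> > real DIM(real^'n) / 2" using \<sigma> by auto
  have symmat: "(\<lambda>y. \<phi> y *\<^sub>R A) \<in> sobolev_symmat \<sigma> \<Omega>"
    if "\<phi> \<in> sobolev_space \<sigma> \<Omega>" "transpose A = A" for \<phi> and A :: "real^'n^'n"
  proof -
    have "(\<lambda>y. \<phi> y * A $ i $ j) \<in> sobolev_space \<sigma> \<Omega>" for i j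
      using sobolev_space_cmult[OF \<Omega> \<sigma>'(2) that(1), of "A $ i $ j"] by (simp only: mult.commute)
    then show ?thesis
      using that(2) by (simp add: sobolev_symmat_def sobolev_mat_def transpose_scalar)
  qed
  have zero: "matrix_op V f (\<lambda>y. \<phi> y *\<^sub>R A) z = 0"
    if "\<phi> z = 0 \<and> (\<phi> has_derivative (\<lambda>_. 0)) (at z)" for \<phi> z and A :: "real^'n^'n"
  proof -
    have "\<phi> differentiable (at z)" using that by (auto simp: differentiable_def)
    moreover have "frechet_derivative \<phi> (at z) = (\<lambda>_. 0)" using that
      by (metis frechet_derivative_at)
    ultimately show ?thesis using that by (simp add: matrix_op_scalar_times_matrix)
  qed
  show ?thesis
  proof (cases "f x0 = 0")
    case True
    obtain A where A: "transpose A = A" "transpose (V x0) ** A + A ** V x0 = E"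
      using lyapunov_solvable[OF spec[OF True] sym] by blast
    obtain \<phi> where \<phi>: "\<phi> \<in> sobolev_space \<sigma> \<Omega>" "\<phi> x0 = 1" "\<forall>z\<in>P. \<phi> z = 0
        \<and> (\<phi> has_derivative (\<lambda>_. 0)) (at z)"
      using sobolev_space_peak[OF \<Omega> \<sigma>'(1) P] by blast
    have d: "\<phi> differentiable (at x0)" by (rule sobolev_space_differentiable[OF \<Omega> \<sigma>'(1) \<phi>(1) P(4)])
    have "frechet_derivative \<phi> (at x0) 0 = 0" by (rule linear_0[OF linear_frechet_derivative[OF d]])
    then have "matrix_op V f (\<lambda>y. \<phi> y *\<^sub>R A) x0 = E"
      by (simp add: matrix_op_scalar_times_matrix[OF d] \<phi>(2) True A(2))
    then show ?thesis using symmat[OF \<phi>(1) A(1)] zero \<phi>(3) by blast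
  next
    case False
    obtain \<phi> where \<phi>: "\<phi> \<in> sobolev_space \<sigma> \<Omega>" "\<phi> x0 = 0" "frechet_derivative \<phi> (at x0) (f x0) = 1"
        "\<forall>z\<in>P. \<phi> z = 0 \<and> (\<phi> has_derivative (\<lambda>_. 0)) (at z)"
      using sobolev_space_slope[OF \<Omega> \<sigma>'(1) P False] by blast
    have d: "\<phi> differentiable (at x0)" by (rule sobolev_space_differentiable[OF \<Omega> \<sigma>'(1) \<phi>(1) P(4)])
    have "matrix_op V f (\<lambda>y. \<phi> y *\<^sub>R E) x0 = E"
      by (simp add: matrix_op_scalar_times_matrix[OF d] \<phi>(2,3))
    then show ?thesis using symmat[OF \<phi>(1) sym] zero \<phi>(4) by blast
  qed
qed

text \<open>For each index in the family there is a matrix function on which this functional has the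
  value 1 and all the others vanish.\<close>

lemma entry_functionals_independent:
  fixes \<Omega> :: "(real^('n::{finite,linorder})) set"
  assumes \<Omega>: "open \<Omega>" and \<sigma>: "\<sigma> > real CARD('n) / 2 + 1"
    and spec: "(\<forall>x0 \<in> \<Omega>. f x0 = 0 \<longrightarrow> (\<forall>\<mu>. complex_eigenvalue (V x0) \<mu> \<longrightarrow> Re \<mu> < 0)) \<or>
         (\<forall>x0 \<in> \<Omega>. f x0 = 0 \<longrightarrow> (\<forall>\<mu>. complex_eigenvalue (V x0) \<mu> \<longrightarrow> Re \<mu> > 0))"
    and x: "inj_on x {1..N}" "x ` {1..N} \<subseteq> \<Omega>"
  shows "independent_functionals (sobolev_symmat \<sigma> \<Omega>) (upper_indices N) (entry_functional V f x)"
  unfolding independent_functionals_def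
proof (intro allI impI ballI)
  fix c and p :: "nat \<times> 'n \<times> 'n"
  assume c: "\<forall>u\<in>sobolev_symmat \<sigma> \<Omega>. (\<Sum>p\<in>upper_indices N. c p * entry_functional V f x p u) = 0"
    and p: "p \<in> upper_indices N"
  obtain k0 i0 j0 where p_eq: "p = (k0, i0, j0)" by (cases p)
  have k0: "k0 \<in> {1..N}" and ij: "i0 \<le> j0" using p by (auto simp: p_eq upper_indices_def)
  define E :: "((real, 'n) vec, 'n) vec" where "E = (\<chi> i j. if (i = i0 \<and> j = j0) \<or> (i = j0 \<and> j
      = i0) then 1 else 0)"
  have E_ij: "transpose E $ i $ j = E $ i $ j" for i j
    unfolding E_def transpose_def vec_lambda_beta by (rule if_cong) blast+
  have E_sym: "transpose E = E" by (intro vec_eq_iff[THEN iffD2] allI) (rule E_ij)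
  have x_notin: "x k0 \<notin> x ` ({1..N} - {k0})" using inj_on_image_mem_iff[OF x(1) k0, of "{1..N}
      - {k0}"] by blast
  have "x k0 \<in> \<Omega>" and x_sub: "x ` ({1..N} - {k0}) \<subseteq> \<Omega>" using x(2) k0 by auto
  obtain M where M: "M \<in> sobolev_symmat \<sigma> \<Omega>" "matrix_op V f M (x k0) = E"
      "\<forall>z\<in>x ` ({1..N} - {k0}). matrix_op V f M z = 0"
  proof -
    have "f (x k0) = 0 \<Longrightarrow> (\<forall>\<mu>. complex_eigenvalue (V (x k0)) \<mu> \<longrightarrow> Re \<mu> < 0) \<or>
        (\<forall>\<mu>. complex_eigenvalue (V (x k0)) \<mu> \<longrightarrow> Re \<mu> > 0)"
      using spec \<open>x k0 \<in> \<Omega>\<close> by blast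
    then have "\<exists>M\<in>sobolev_symmat \<sigma> \<Omega>. matrix_op V f M (x k0) = E
        \<and> (\<forall>z\<in>x ` ({1..N} - {k0}). matrix_op V f M z = 0)"
      by (intro matrix_interpolation[OF \<Omega> \<sigma>]) (use E_sym x_notin \<open>x k0 \<in> \<Omega>\<close> x_sub in simp_all)
    then show ?thesis using that by (elim bexE conjE)
  qed
  have "entry_functional V f x q M = (if q = p then 1 else 0)" if "q \<in> upper_indices N" for q
  proof -
    obtain k i j where q: "q = (k, i, j)" by (cases q)
    have kij: "k \<in> {1..N}" "i \<le> j" using that by (auto simp: q upper_indices_def)
    show ?thesis
    proof (cases "k = k0")
      case True
      have "E $ i $ j = (if i = i0 \<and> j = j0 then 1 else 0)"
        using kij(2) ij by (auto simp: E_def)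
      then show ?thesis by (simp add: q entry_functional_eq True M(2) p_eq)
    next
      case False
      then have "matrix_op V f M (x k) = 0" using M(3) kij(1) by blast
      then show ?thesis using False by (simp add: q entry_functional_eq p_eq)
    qed
  qed
  then have "(\<Sum>q\<in>upper_indices N. c q * entry_functional V f x q M) = (\<Sum>q\<in>upper_indices N. if q
      = p then c q else 0)"
    by (intro sum.cong) auto
  moreover have "finite (upper_indices N :: (nat \<times> 'n \<times> 'n) set)"
    by (rule finite_subset[of _ "{1..N} \<times> UNIV"]) (auto simp: upper_indices_def)
  ultimately have "c p = 0" using c M(1) p by (simp add: sum.delta)
  then show "c p = 0" .
qed

section \<open>The error estimate\<close>

text \<open>By the lower bound in the equivalence of norms, each entry is dominated by the matrix norm.\<close>

lemma entry_norm_le_mat_norm: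
  fixes \<Omega> :: "(real^'n) set"
  assumes ip: "equivalent_inner_product \<sigma> \<Omega> ip"
  shows "\<exists>K\<ge>0. \<forall>M\<in>sobolev_symmat \<sigma> \<Omega>. entry_norm \<sigma> \<Omega> M \<le> K * mat_norm ip M"
proof -
  obtain a where a: "a > 0" and le: "\<And>u. u \<in> sobolev_space \<sigma> \<Omega> \<Longrightarrow> a * (sobolev_norm \<sigma> \<Omega> u)\<^sup>2
      \<le> ip u u"
    using ip unfolding equivalent_inner_product_def by blast
  have "entry_norm \<sigma> \<Omega> M \<le> real (CARD('n) * CARD('n)) / sqrt a * mat_norm ip M" if M:
      "M \<in> sobolev_symmat \<sigma> \<Omega>" for M
  proof -
    let ?u = "\<lambda>i j x. M x $ i $ j"
    note ms = sobolev_symmat_entry[OF M]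
    have nn: "0 \<le> ip (?u i j) (?u i j)" for i j
      using le[OF ms, of i j] a zero_le_power2[of "sobolev_norm \<sigma> \<Omega> (?u i j)"]
      by (meson less_imp_le mult_nonneg_nonneg order_trans)
    have "sobolev_norm \<sigma> \<Omega> (?u i j) \<le> mat_norm ip M / sqrt a" for i j
    proof -
      have "a * (sobolev_norm \<sigma> \<Omega> (?u i j))\<^sup>2 \<le> ip (?u i j) (?u i j)" by (rule le[OF ms])
      also have "\<dots> \<le> (\<Sum>j\<in>UNIV. ip (?u i j) (?u i j))"
        by (rule member_le_sum[of j UNIV "\<lambda>j. ip (?u i j) (?u i j)"]) (auto simp: nn)
      also have "\<dots> \<le> (\<Sum>i\<in>UNIV. \<Sum>j\<in>UNIV. ip (?u i j) (?u i j))"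
        by (rule member_le_sum[of i UNIV "\<lambda>i. \<Sum>j\<in>UNIV. ip (?u i j) (?u i j)"]) (auto intro!:
            sum_nonneg nn)
      finally have "sqrt (a * (sobolev_norm \<sigma> \<Omega> (?u i j))\<^sup>2) \<le> mat_norm ip M"
        unfolding mat_norm_def by (rule real_sqrt_le_mono)
      then have "sqrt a * sobolev_norm \<sigma> \<Omega> (?u i j) \<le> mat_norm ip M"
        using sobolev_norm_nonneg[OF ms, of i j] by (simp add: real_sqrt_mult)
      then show ?thesis using a by (simp add: pos_le_divide_eq mult.commute)
    qed
    then have "entry_norm \<sigma> \<Omega> M \<le> (\<Sum>i\<in>(UNIV::'n set). \<Sum>j\<in>(UNIV::'n set). mat_norm ip M / sqrt a)"
      unfolding entry_norm_def by (intro sum_mono)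
    then show ?thesis by simp
  qed
  moreover have "0 \<le> real (CARD('n) * CARD('n)) / sqrt a" using a by simp
  ultimately show ?thesis by blast
qed

lemma sobolev_space_bound:
  fixes \<Omega> :: "'a::euclidean_space set"
  assumes \<Omega>: "open \<Omega>" and s: "s > real DIM('a) / 2"
  shows "\<exists>C\<ge>0. \<forall>u\<in>sobolev_space s \<Omega>. \<forall>x\<in>\<Omega>. \<bar>u x\<bar> \<le> C * sobolev_norm s \<Omega> u"
proof (rule exI[of _ "(2 * pi) powr (- real DIM('a) / 2) * embedding_const TYPE('a) s"], intro
    conjI ballI)
  fix u x assume "u \<in> sobolev_space s \<Omega>" "x \<in> \<Omega>"
  then show "\<bar>u x\<bar> \<le> (2 * pi) powr (- real DIM('a) / 2) * embedding_const TYPE('a) s *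
      sobolev_norm s \<Omega> u"
    by (intro le_sobolev_normI[OF \<Omega> s] fourier_rep_bound[OF s]) auto
qed simp

lemma entry_functional_in_dual:
  fixes \<Omega> :: "(real^('n::{finite,linorder})) set"
  assumes \<Omega>: "open \<Omega>" and \<sigma>: "\<sigma> > real CARD('n) / 2 + 1" and ip: "equivalent_inner_product \<sigma> \<Omega> ip"
    and V: "V \<in> sobolev_mat (\<sigma> - 1) \<Omega>" and f: "f \<in> sobolev_vec (\<sigma> - 1) \<Omega>" and x: "x k \<in> \<Omega>"
  shows "in_dual (sobolev_symmat \<sigma> \<Omega>) (mat_norm ip) (entry_functional V f x (k, i, j))"
  unfolding in_dual_def entry_functional_eq
proof (intro conjI ballI allI)
  note d = sobolev_symmat_differentiable[OF \<Omega> \<sigma> _ x]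
  show "matrix_op V f (\<lambda>x. u x + v x) (x k) $ i $ j = matrix_op V f u (x k) $ i $ j
      + matrix_op V f v (x k) $ i $ j"
    if "u \<in> sobolev_symmat \<sigma> \<Omega>" "v \<in> sobolev_symmat \<sigma> \<Omega>" for u v
    by (simp add: matrix_op_add[OF d[OF that(1)] d[OF that(2)]])
  show "matrix_op V f (\<lambda>x. c *\<^sub>R u x) (x k) $ i $ j = c * matrix_op V f u (x k) $ i $ j"
    if "u \<in> sobolev_symmat \<sigma> \<Omega>" for c u
    by (simp add: matrix_op_scaleR[OF d[OF that]])
  have s: "\<sigma> - 1 > real DIM((real, 'n) vec) / 2" using \<sigma> by simp
  obtain C where C: "0 \<le> C" "\<And>u x. u\<in>sobolev_space (\<sigma> - 1) \<Omega> \<Longrightarrow> x \<in> \<Omega> \<Longrightarrow> \<bar>u x\<bar>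
      \<le> C * sobolev_norm (\<sigma> - 1) \<Omega> u"
    using sobolev_space_bound[OF \<Omega> s] by blast
  obtain K where K: "0 \<le> K" "\<And>M. M \<in> sobolev_symmat \<sigma> \<Omega>
      \<Longrightarrow> (\<lambda>x. matrix_op V f M x $ i $ j) \<in> sobolev_space (\<sigma> - 1) \<Omega> \<and>
      sobolev_norm (\<sigma> - 1) \<Omega> (\<lambda>x. matrix_op V f M x $ i $ j) \<le> K * entry_norm \<sigma> \<Omega> M"
    using matrix_op_bounded[OF \<Omega> \<sigma> V f, of i j] unfolding bounded_op_def by blast
  obtain L where L: "0 \<le> L" "\<And>M. M \<in> sobolev_symmat \<sigma> \<Omega> \<Longrightarrow> entry_norm \<sigma> \<Omega> M \<le> L * mat_norm ip M"
    using entry_norm_le_mat_norm[OF ip] by blast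
  show "\<exists>B. \<forall>u\<in>sobolev_symmat \<sigma> \<Omega>. \<bar>matrix_op V f u (x k) $ i $ j\<bar> \<le> B * mat_norm ip u"
  proof (intro exI ballI)
    fix M :: "(real, 'n) vec \<Rightarrow> ((real, 'n) vec, 'n) vec"
    assume M: "M \<in> sobolev_symmat \<sigma> \<Omega>"
    have "\<bar>matrix_op V f M (x k) $ i $ j\<bar> \<le> C * sobolev_norm (\<sigma> - 1) \<Omega> (\<lambda>x. matrix_op V f M x $ i
        $ j)"
      using C(2)[OF conjunct1[OF K(2)[OF M]] x] .
    also have "\<dots> \<le> C * (K * entry_norm \<sigma> \<Omega> M)" using C(1) K(2)[OF M] by (intro mult_left_mono) auto
    also have "\<dots> \<le> C * (K * (L * mat_norm ip M))" using C(1) K(1) L(2)[OF M]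
      by (intro mult_left_mono) auto
    finally show "\<bar>matrix_op V f M (x k) $ i $ j\<bar> \<le> (C * K * L) * mat_norm ip M"
      by (simp add: mult_ac)
  qed
qed

lemma mat_Linf_norm_leI:
  fixes \<Omega> :: "(real^'n) set"
  assumes \<Omega>: "open \<Omega>" and cont: "\<And>i j. continuous_on \<Omega> (\<lambda>x. A x $ i $ j)"
    and le: "\<And>x i j. x \<in> \<Omega> \<Longrightarrow> \<bar>A x $ i $ j\<bar> \<le> b"
  shows "mat_Linf_norm \<Omega> A \<le> ereal b"
proof -
  have "esssup (restrict_space lborel \<Omega>) (\<lambda>x. ereal \<bar>A x $ i $ j\<bar>) \<le> ereal b" for i j
  proof (rule esssup_I)
    have "(\<lambda>x. \<bar>A x $ i $ j\<bar>) \<in> borel_measurable (restrict_space borel \<Omega>)"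
      by (rule borel_measurable_continuous_on_restrict[OF continuous_on_rabs[OF cont]])
    then have "(\<lambda>x. \<bar>A x $ i $ j\<bar>) \<in> borel_measurable (restrict_space lborel \<Omega>)"
      by (simp add: measurable_def space_restrict_space sets_restrict_space)
    then show "(\<lambda>x. ereal \<bar>A x $ i $ j\<bar>) \<in> borel_measurable (restrict_space lborel \<Omega>)" by measurable
    show "AE x in restrict_space lborel \<Omega>. ereal \<bar>A x $ i $ j\<bar> \<le> ereal b"
      using le by (intro AE_I2) (auto simp: space_restrict_space)
  qed
  then show ?thesis unfolding mat_Linf_norm_def by (subst Max_le_iff) auto
qed

text \<open>The entries of \<open>F(M) - F(S)\<close> vanish on \<open>X\<close>: those on and above the diagonal by the
  interpolation conditions, the others by symmetry. Their norms are controlled by the norm of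
  \<open>M\<close>, because \<open>M\<close> itself is admissible in the minimization that defines \<open>S\<close>. The sampling
  inequality concludes.\<close>

lemma optimal_recovery_error:
  fixes \<Omega> :: "(real^('n::{finite,linorder})) set"
  assumes dom: "bounded_lipschitz_domain \<Omega>" and \<sigma>: "\<sigma> > real CARD('n) / 2 + 1"
      and ip: "equivalent_inner_product \<sigma> \<Omega> ip"
    and V: "V \<in> sobolev_mat (\<sigma> - 1) \<Omega>" and f: "f \<in> sobolev_vec (\<sigma> - 1) \<Omega>"
  shows "\<exists>C\<ge>0. \<forall>N x. 1 \<le> N \<and> x ` {1..N} \<subseteq> \<Omega> \<longrightarrow>
      (\<forall>M \<in> sobolev_symmat \<sigma> \<Omega>. \<forall>S.
        optimal_recovery (sobolev_symmat \<sigma> \<Omega>) (mat_norm ip) (upper_indices N) (entry_functional V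
            f x) M S \<longrightarrow>
        mat_Linf_norm \<Omega> (\<lambda>y. matrix_op V f M y - matrix_op V f S y)
          \<le> ereal (C * fill_distance (x ` {1..N}) \<Omega> powr (\<sigma> - 1 - real CARD('n) / 2) * mat_norm ip
              M))"
proof -
  have \<Omega>: "open \<Omega>" using dom by (simp add: bounded_lipschitz_domain_def)
  have s: "\<sigma> - 1 > real DIM((real, 'n) vec) / 2" using \<sigma> by simp
  let ?e = "\<sigma> - 1 - real CARD('n) / 2"
  obtain C where C: "0 \<le> C" "\<And>X u g x. finite X \<Longrightarrow> X \<noteq> {} \<Longrightarrow> X \<subseteq> \<Omega> \<Longrightarrow> fourier_rep (\<sigma> - 1) \<Omega> u g \<Longrightarrow>
    (\<forall>z\<in>X. u z = 0) \<Longrightarrow> x \<in> \<Omega> \<Longrightarrow> \<bar>u x\<bar> \<le> C * fill_distance X \<Omega> powr ?e * data_norm (\<sigma> - 1) g"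
    using sampling_inequality[OF dom s] by auto
  obtain K where K: "\<And>i j. 0 \<le> K i j" "\<And>M i j. M \<in> sobolev_symmat \<sigma> \<Omega>
      \<Longrightarrow> (\<lambda>x. matrix_op V f M x $ i $ j) \<in> sobolev_space (\<sigma> - 1) \<Omega> \<and>
      sobolev_norm (\<sigma> - 1) \<Omega> (\<lambda>x. matrix_op V f M x $ i $ j) \<le> K i j * entry_norm \<sigma> \<Omega> M"
    using matrix_op_bounded[OF \<Omega> \<sigma> V f] unfolding bounded_op_def by metis
  obtain L where L: "0 \<le> L" "\<And>M. M \<in> sobolev_symmat \<sigma> \<Omega> \<Longrightarrow> entry_norm \<sigma> \<Omega> M \<le> L * mat_norm ip M"
    using entry_norm_le_mat_norm[OF ip] by blast
  define K0 where "K0 = (\<Sum>i\<in>UNIV. \<Sum>j\<in>UNIV. K i j)"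
  have K0: "K i j \<le> K0" "0 \<le> K0" for i j
  proof -
    have "K i j \<le> (\<Sum>j\<in>UNIV. K i j)" by (rule member_le_sum) (auto simp: K)
    also have "\<dots> \<le> K0" unfolding K0_def
      by (rule member_le_sum[of i UNIV "\<lambda>i. \<Sum>j\<in>UNIV. K i j"]) (auto intro!: sum_nonneg K)
    finally show "K i j \<le> K0" .
    show "0 \<le> K0" unfolding K0_def by (intro sum_nonneg K)
  qed
  have main: "mat_Linf_norm \<Omega> (\<lambda>y. matrix_op V f M y - matrix_op V f S y)
      \<le> ereal (C * (4 * K0 * L) * fill_distance (x ` {1..N}) \<Omega> powr ?e * mat_norm ip M)"
    if N: "1 \<le> N" "x ` {1..N} \<subseteq> \<Omega>" and M: "M \<in> sobolev_symmat \<sigma> \<Omega>"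
      and opt: "optimal_recovery (sobolev_symmat \<sigma> \<Omega>) (mat_norm ip) (upper_indices
          N) (entry_functional V f x) M S"
    for N x M S
  proof -
    have S: "S \<in> sobolev_symmat \<sigma> \<Omega>" and interp: "\<And>p. p \<in> upper_indices N
        \<Longrightarrow> entry_functional V f x p S = entry_functional V f x p M"
      and min: "mat_norm ip S \<le> mat_norm ip M"
      using opt M by (auto simp: optimal_recovery_def)
    let ?w = "\<lambda>i j y. matrix_op V f M y $ i $ j - matrix_op V f S y $ i $ j"
    let ?X = "x ` {1..N}"
    have norm_le: "sobolev_norm (\<sigma> - 1) \<Omega> (\<lambda>x. matrix_op V f A x $ i $ j) \<le> K0 * L * mat_norm ip M"
      if A: "A \<in> sobolev_symmat \<sigma> \<Omega>" and "mat_norm ip A \<le> mat_norm ip M" for A i j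
    proof -
      have "sobolev_norm (\<sigma> - 1) \<Omega> (\<lambda>x. matrix_op V f A x $ i $ j) \<le> K i j * entry_norm \<sigma> \<Omega> A"
        using K(2)[OF A] by blast
      also have "\<dots> \<le> K0 * entry_norm \<sigma> \<Omega> A" by (intro mult_right_mono K0 entry_norm_nonneg A)
      also have "\<dots> \<le> K0 * (L * mat_norm ip A)" by (intro mult_left_mono K0 L A)
      also have "\<dots> \<le> K0 * (L * mat_norm ip M)" by (intro mult_left_mono K0 L that(2))
      finally show ?thesis by (simp add: mult.assoc)
    qed
    have w: "?w i j \<in> sobolev_space (\<sigma> - 1) \<Omega>"
      and w_norm: "sobolev_norm (\<sigma> - 1) \<Omega> (?w i j) \<le> 4 * K0 * L * mat_norm ip M" for i j
    proof -
      have a: "(\<lambda>x. matrix_op V f M x $ i $ j) \<in> sobolev_space (\<sigma> - 1) \<Omega>"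
        and b: "(\<lambda>x. matrix_op V f S x $ i $ j) \<in> sobolev_space (\<sigma> - 1) \<Omega>"
        using K(2) M S by blast+
      note c = sobolev_space_cmult[OF \<Omega> s b, of "-1"]
      show "?w i j \<in> sobolev_space (\<sigma> - 1) \<Omega>" using sobolev_space_add[OF \<Omega> s a c] by simp
      have "sobolev_norm (\<sigma> - 1) \<Omega> (?w i j) \<le> 2 * (sobolev_norm (\<sigma> - 1) \<Omega> (\<lambda>x. matrix_op V f M x $
          i $ j) +
          sobolev_norm (\<sigma> - 1) \<Omega> (\<lambda>x. - 1 * matrix_op V f S x $ i $ j))"
        using sobolev_norm_add_le[OF \<Omega> s a c] by simp
      also have "\<dots> \<le> 2 * (K0 * L * mat_norm ip M + K0 * L * mat_norm ip M)"
        using sobolev_norm_cmult_le[OF \<Omega> s b, of "-1"] norm_le[OF M, of i j] norm_le[OF S min, of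
            i j]
        by (intro mult_left_mono add_mono) auto
      finally show "sobolev_norm (\<sigma> - 1) \<Omega> (?w i j) \<le> 4 * K0 * L * mat_norm ip M" by simp
    qed
    have zero: "?w i j z = 0" if z: "z \<in> ?X" for i j z
    proof -
      obtain k where k: "k \<in> {1..N}" "z = x k" using z by blast
      have le: "?w i j z = 0" if "i \<le> j" for i j
        using interp[of "(k, i, j)"] k that by (simp add: upper_indices_def entry_functional_eq)
      have "z \<in> \<Omega>" using z N(2) by blast
      then show ?thesis
        using le[of i j] le[of j i] matrix_op_symmetric[OF \<Omega> \<sigma> M, of z V f i j]
            matrix_op_symmetric[OF \<Omega> \<sigma> S, of z V f i j]
        by (cases "i \<le> j") auto
    qed
    have X: "finite ?X" "?X \<noteq> {}" "?X \<subseteq> \<Omega>" using N by auto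
    have c0: "0 \<le> C * fill_distance ?X \<Omega> powr ?e" using C(1) by simp
    have "\<bar>?w i j y\<bar> \<le> C * (4 * K0 * L) * fill_distance ?X \<Omega> powr ?e * mat_norm ip M" if "y \<in> \<Omega>"
        for i j y
    proof -
      have "\<bar>?w i j y\<bar> \<le> C * fill_distance ?X \<Omega> powr ?e * sobolev_norm (\<sigma> - 1) \<Omega> (?w i j)"
        by (rule le_sobolev_normI[OF \<Omega> s w _ c0]) (use C(2)[OF X _ _ that] zero in blast)
      also have "\<dots> \<le> C * fill_distance ?X \<Omega> powr ?e * (4 * K0 * L * mat_norm ip M)"
        by (rule mult_left_mono[OF w_norm c0])
      finally show ?thesis by (simp add: mult_ac)
    qed
    moreover have "continuous_on \<Omega> (?w i j)" for i j using w by (simp add: sobolev_space_def)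
    ultimately show ?thesis by (intro mat_Linf_norm_leI[OF \<Omega>]) auto
  qed
  have "0 \<le> C * (4 * K0 * L)" using C(1) K0 L(1) by simp
  with main show ?thesis by blast
qed

lemma mat_norm_nonneg_on_symmat:
  assumes ip: "equivalent_inner_product \<sigma> \<Omega> ip" and M: "M \<in> sobolev_symmat \<sigma> \<Omega>"
  shows "0 \<le> mat_norm ip M"
proof -
  obtain a where a: "a > 0" and le: "\<And>u. u \<in> sobolev_space \<sigma> \<Omega> \<Longrightarrow> a * (sobolev_norm \<sigma> \<Omega> u)\<^sup>2
      \<le> ip u u"
    using ip unfolding equivalent_inner_product_def by blast
  have "0 \<le> ip (\<lambda>x. M x $ i $ j) (\<lambda>x. M x $ i $ j)" for i j
    using le[OF sobolev_symmat_entry[OF M], of i j] a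
    by (meson less_imp_le mult_nonneg_nonneg order_trans zero_le_power2)
  then show ?thesis unfolding mat_norm_def by (intro real_sqrt_ge_zero sum_nonneg)
qed

theorem theorem6p6:
  fixes \<Omega> :: "(real^('n::{finite,linorder})) set"
    and \<sigma> :: real
    and V :: "(real, 'n) vec \<Rightarrow> ((real, 'n) vec, 'n) vec"
    and f :: "(real, 'n) vec \<Rightarrow> (real, 'n) vec"
    and ip :: "((real, 'n) vec \<Rightarrow> real) \<Rightarrow> ((real, 'n) vec \<Rightarrow> real) \<Rightarrow> real"
  assumes "bounded_lipschitz_domain \<Omega>"
    and "\<sigma> > real CARD('n) / 2 + 1"
    and "equivalent_inner_product \<sigma> \<Omega> ip"
    and "V \<in> sobolev_mat (\<sigma> - 1) \<Omega>"
    and "f \<in> sobolev_vec (\<sigma> - 1) \<Omega>"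
    and "(\<forall>x0 \<in> \<Omega>. f x0 = 0 \<longrightarrow> (\<forall>\<mu>. complex_eigenvalue (V x0) \<mu> \<longrightarrow> Re \<mu> < 0)) \<or>
         (\<forall>x0 \<in> \<Omega>. f x0 = 0 \<longrightarrow> (\<forall>\<mu>. complex_eigenvalue (V x0) \<mu> \<longrightarrow> Re \<mu> > 0))"
  shows "(\<forall>M \<in> sobolev_symmat \<sigma> \<Omega>. matrix_op V f M \<in> sobolev_symmat (\<sigma> - 1) \<Omega>) \<and>
    (\<forall>N x. 1 \<le> N \<and> inj_on x {1..N} \<and> x ` {1..N} \<subseteq> \<Omega> \<longrightarrow>
      (\<forall>p \<in> upper_indices N.
        in_dual (sobolev_symmat \<sigma> \<Omega>) (mat_norm ip) (entry_functional V f x p)) \<and>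
      independent_functionals (sobolev_symmat \<sigma> \<Omega>) (upper_indices N) (entry_functional V f x)) \<and>
    (\<exists>C > 0. \<forall>N x. 1 \<le> N \<and> inj_on x {1..N} \<and> x ` {1..N} \<subseteq> \<Omega> \<longrightarrow>
      (\<forall>M \<in> sobolev_symmat \<sigma> \<Omega>. \<forall>S.
        optimal_recovery (sobolev_symmat \<sigma> \<Omega>) (mat_norm ip) (upper_indices N)
          (entry_functional V f x) M S \<longrightarrow>
        mat_Linf_norm \<Omega> (\<lambda>y. matrix_op V f M y - matrix_op V f S y)
          \<le> ereal (C * fill_distance (x ` {1..N}) \<Omega> powr (\<sigma> - 1 - real CARD('n) / 2)
              * mat_norm ip M)))"
proof (intro conjI allI impI ballI)
  have \<Omega>: "open \<Omega>" using assms(1) by (simp add: bounded_lipschitz_domain_def)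
  show "matrix_op V f M \<in> sobolev_symmat (\<sigma> - 1) \<Omega>" if "M \<in> sobolev_symmat \<sigma> \<Omega>" for M
    by (rule matrix_op_sobolev_symmat[OF \<Omega> assms(2,4,5) that])
  fix N :: nat and x :: "nat \<Rightarrow> (real, 'n) vec" assume x: "1 \<le> N \<and> inj_on x {1..N} \<and> x ` {1..N} \<subseteq> \<Omega>"
  show "in_dual (sobolev_symmat \<sigma> \<Omega>) (mat_norm ip) (entry_functional V f x p)" if "p \<in> upper_indices N" for p
  proof -
    obtain k i j where p: "p = (k, i, j)" by (cases p)
    have "x k \<in> \<Omega>" using that x by (auto simp: p upper_indices_def)
    then show ?thesis unfolding p by (rule entry_functional_in_dual[OF \<Omega> assms(2-5)])
  qed
  show "independent_functionals (sobolev_symmat \<sigma> \<Omega>) (upper_indices N) (entry_functional V f x)"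
    using x by (intro entry_functionals_independent[OF \<Omega> assms(2,6)]) auto
next
  obtain C where C: "0 \<le> C" and err: "\<forall>N x. 1 \<le> N \<and> x ` {1..N} \<subseteq> \<Omega> \<longrightarrow>
      (\<forall>M \<in> sobolev_symmat \<sigma> \<Omega>. \<forall>S.
        optimal_recovery (sobolev_symmat \<sigma> \<Omega>) (mat_norm ip) (upper_indices N) (entry_functional V f x) M S \<longrightarrow>
        mat_Linf_norm \<Omega> (\<lambda>y. matrix_op V f M y - matrix_op V f S y)
          \<le> ereal (C * fill_distance (x ` {1..N}) \<Omega> powr (\<sigma> - 1 - real CARD('n) / 2) * mat_norm ip M))"
    using optimal_recovery_error[OF assms(1-5)] by (elim exE conjE) (rule that, assumption+)
  show "\<exists>C > 0. \<forall>N x. 1 \<le> N \<and> inj_on x {1..N} \<and> x ` {1..N} \<subseteq> \<Omega> \<longrightarrow>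
      (\<forall>M \<in> sobolev_symmat \<sigma> \<Omega>. \<forall>S.
        optimal_recovery (sobolev_symmat \<sigma> \<Omega>) (mat_norm ip) (upper_indices N)
          (entry_functional V f x) M S \<longrightarrow>
        mat_Linf_norm \<Omega> (\<lambda>y. matrix_op V f M y - matrix_op V f S y)
          \<le> ereal (C * fill_distance (x ` {1..N}) \<Omega> powr (\<sigma> - 1 - real CARD('n) / 2)
              * mat_norm ip M))"
  proof (rule exI[of _ "C + 1"], intro conjI allI impI ballI)
    show "0 < C + 1" using C by simp
    fix N :: nat and x :: "nat \<Rightarrow> (real, 'n) vec" and M S
    assume x: "1 \<le> N \<and> inj_on x {1..N} \<and> x ` {1..N} \<subseteq> \<Omega>" and M: "M \<in> sobolev_symmat \<sigma> \<Omega>"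
      and opt: "optimal_recovery (sobolev_symmat \<sigma> \<Omega>) (mat_norm ip) (upper_indices N) (entry_functional V f x) M S"
    let ?h = "fill_distance (x ` {1..N}) \<Omega> powr (\<sigma> - 1 - real CARD('n) / 2)"
    have "mat_Linf_norm \<Omega> (\<lambda>y. matrix_op V f M y - matrix_op V f S y) \<le> ereal (C * ?h * mat_norm ip M)"
      using err x M opt by blast
    also have "\<dots> \<le> ereal ((C + 1) * ?h * mat_norm ip M)"
      using mat_norm_nonneg_on_symmat[OF assms(3) M] by (simp add: mult_right_mono)
    finally show "mat_Linf_norm \<Omega> (\<lambda>y. matrix_op V f M y - matrix_op V f S y) \<le> ereal ((C + 1) * ?h * mat_norm ip M)" .
  qed
qed

end
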